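(* Let $d>2$ be an integer and $\beta>0$. For every $0<\delta<R<\infty$ and every bounded continuous function $\Phi:\mathsf M_N\to\mathbb R$, $$\sup_{j\in\mathbb N:\ \delta\le j/V_L\le R}\Big|\int_{\mathsf M_N}\Phi(m)\,\mathsf J^N_{L,j}(dm)-\Phi\big(\mathbb Q^{\mathrm{ref}}_{N,\mathrm{two}}\big)\Big|\longrightarrow0\qquad(L\to\infty).$$
   Context: $\Lambda_L=(0,L)^d$, $V_L=L^d$, $Q=(0,1)^d$. $q^{\Lambda_L,N}_t$ is the Neumann heat kernel of $e^{t\Delta}$ on $\Lambda_L$. Neumann one-loop law of duration $\beta j$: choose the root $A\in\Lambda_L$ with density $q^{\Lambda_L,N}_{\beta j}(A,A)/\int_{\Lambda_L}q^{\Lambda_L,N}_{\beta j}(z,z)\,dz$, and given $A$ let $\omega:[0,\beta j]\to\overline{\Lambda_L}$ be the bridge from $A$ to $A$ of reflected Brownian motion in $\overline{\Lambda_L}$ (transition density $q^{\Lambda_L,N}_t$). Mark. $S_{L,j}=\beta j/L^2$; $Y_{L,j}(s)=L^{-1}\omega(L^2s)$, $0\le s\le S_{L,j}$, extended $S_{L,j}$-periodically to $\mathbb R$; $(\theta_u\gamma)(t)=\gamma(u+t)$. $\mathcal X_N=C_{\mathrm{loc}}(\mathbb R,\overline Q)$ is the space of continuous paths $\mathbb R\to\overline Q$ with uniform convergence on compact time intervals; $\mathsf M_N=\mathcal P(\mathcal X_N)$ with the weak topology. The mark is $\mathcal M^N_{L,j}=\frac1{S_{L,j}}\int_0^{S_{L,j}}\delta_{\theta_uY_{L,j}}\,du\in\mathsf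 M_N$, and $\mathsf J^N_{L,j}$ is its law under the Neumann one-loop law of duration $\beta j$. Limit. $p^{Q,N}_t$ is the Neumann heat kernel of $e^{t\Delta}$ on $Q$. $\mathbb Q^{\mathrm{ref}}_{N,\mathrm{two}}\in\mathcal P(\mathcal X_N)$ is the law of two-sided stationary reflected Brownian motion in $\overline Q$, with finite-dimensional distributions, for $t_1<\dots<t_k$, $dr_1\,p^{Q,N}_{t_2-t_1}(r_1,r_2)\cdots p^{Q,N}_{t_k-t_{k-1}}(r_{k-1},r_k)\,dr_2\cdots dr_k$. *)

theory Defs
  imports "HOL-Probability.Probability" "HOL-Library.Real_Mod"
begin

definition open_cube :: "real \<Rightarrow> (real ^ 'n) set" where
  "open_cube L = box 0 (vec L)"

definition closed_cube :: "real \<Rightarrow> (real ^ 'n) set" where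
  "closed_cube L = cbox 0 (vec L)"


text \<open>
  \<open>f\<close> is of class \<open>C\<^sup>2\<close> on the closed cube (one-sided derivatives at the boundary; \<open>D\<close> is the
  gradient, \<open>H\<close> the Hessian), its normal derivative vanishes on every face, and \<open>g\<close> is its Laplacian.
\<close>

definition neumann_laplacian :: "real \<Rightarrow> (real ^ 'n \<Rightarrow> real) \<Rightarrow> (real ^ 'n \<Rightarrow> real) \<Rightarrow> bool" where
  "neumann_laplacian L f g \<longleftrightarrow>
     (\<exists>(D :: real ^ 'n \<Rightarrow> real ^ 'n) (H :: real ^ 'n \<Rightarrow> real ^ 'n ^ 'n).
        continuous_on (closed_cube L) H \<and>
        (\<forall>x\<in>closed_cube L.
           (f has_derivative (\<lambda>h. D x \<bullet> h)) (at x within closed_cube L) \<and>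
           (D has_derivative (\<lambda>h. H x *v h)) (at x within closed_cube L) \<and>
           (\<forall>i. x $ i = 0 \<or> x $ i = L \<longrightarrow> D x $ i = 0) \<and>
           g x = trace (H x)))"

text \<open>
  The Neumann heat kernel of \<open>e\<^bsup>t\<Delta>\<^esup>\<close> (generator \<open>\<Delta>\<close>, not \<open>\<Delta>/2\<close>) on the cube of side \<open>L\<close>, as the
  nonnegative fundamental solution: for every source point \<open>y\<close>, the function \<open>(t, x) \<mapsto> q t x y\<close> is a
  classical solution of the heat equation with Neumann boundary condition, with initial value the
  Dirac mass at \<open>y\<close>.  This determines \<open>q t x y\<close> for \<open>t > 0\<close> and \<open>x\<close>, \<open>y\<close> in the closed cube; other
  values of \<open>q\<close> are irrelevant.
\<close>

definition neumann_heat_kernel :: "real \<Rightarrow> (real \<Rightarrow> real ^ 'n \<Rightarrow> real ^ 'n \<Rightarrow> real) \<Rightarrow> bool" where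
  "neumann_heat_kernel L q \<longleftrightarrow>
     continuous_on ({0<..} \<times> closed_cube L \<times> closed_cube L) (\<lambda>(t, x, y). q t x y) \<and>
     (\<forall>t>0. \<forall>x\<in>closed_cube L. \<forall>y\<in>closed_cube L. 0 \<le> q t x y) \<and>
     (\<exists>q'. continuous_on ({0<..} \<times> closed_cube L \<times> closed_cube L) (\<lambda>(t, x, y). q' t x y) \<and>
        (\<forall>t>0. \<forall>y\<in>closed_cube L.
           neumann_laplacian L (\<lambda>x. q t x y) (\<lambda>x. q' t x y) \<and>
           (\<forall>x\<in>closed_cube L. ((\<lambda>s. q s x y) has_real_derivative q' t x y) (at t)))) \<and>
     (\<forall>y\<in>closed_cube L. \<forall>f. continuous_on (closed_cube L) f \<longrightarrow>
        ((\<lambda>t. LINT x:closed_cube L|lborel. q t x y * f x) \<longlongrightarrow> f y) (at_right 0))"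


definition borel_of :: "'a topology \<Rightarrow> 'a measure" where
  "borel_of X = sigma (topspace X) {U. openin X U}"

text \<open>Weak topology on the Borel probability measures of a topological space.\<close>

definition weak_topology :: "'a topology \<Rightarrow> 'a measure topology" where
  "weak_topology X = topology_generated_by
     {{\<mu> \<in> space (prob_algebra (borel_of X)). (\<integral>x. f x \<partial>\<mu>) \<in> U} | f U.
        continuous_map X euclideanreal f \<and> bounded (f ` topspace X) \<and> open (U :: real set)}"

text \<open>
  Continuous paths \<open>I \<rightarrow> S\<close> (with value \<^const>\<open>undefined\<close> off \<open>I\<close>) with uniform convergence on compact
  subsets of \<open>I\<close>.
\<close>

definition path_topology :: "real set \<Rightarrow> 'a::metric_space set \<Rightarrow> (real \<Rightarrow> 'a) topology" where
  "path_topology I S =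
     (let C = {\<gamma> \<in> I \<rightarrow>\<^sub>E S. continuous_on I \<gamma>}
      in topology_generated_by
           {{\<gamma> \<in> C. \<forall>t\<in>K. dist (\<gamma> t) (\<gamma>0 t) < e} | \<gamma>0 K e.
              \<gamma>0 \<in> C \<and> compact K \<and> K \<subseteq> I \<and> e > 0})"

definition loop_topology :: "real \<Rightarrow> real \<Rightarrow> (real \<Rightarrow> real ^ 'n) topology" where
  "loop_topology L T = subtopology (path_topology {0..T} (closed_cube L)) {\<omega>. \<omega> 0 = \<omega> T}"

definition mark_path_topology :: "(real \<Rightarrow> real ^ 'n) topology" where
  "mark_path_topology = path_topology UNIV (closed_cube 1)"


definition transition_product ::
    "(real \<Rightarrow> real ^ 'n \<Rightarrow> real ^ 'n \<Rightarrow> real) \<Rightarrow> nat \<Rightarrow> (nat \<Rightarrow> real) \<Rightarrow> (nat \<Rightarrow> real ^ 'n) \<Rightarrow> real" where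
  "transition_product q k t x = (\<Prod>i<k. q (t (Suc i) - t i) (x i) (x (Suc i)))"

text \<open>
  \<open>B a\<close> is the law of the bridge of duration \<open>T\<close> from \<open>a\<close> to \<open>a\<close> of the Markov process on the closed
  cube of side \<open>L\<close> with transition density \<open>q\<close>.  The finite-dimensional distributions are taken at
  the \<open>k + 1\<close> times \<open>t 0 < \<dots> < t k\<close>.
\<close>

definition bridge_kernel ::
    "real \<Rightarrow> (real \<Rightarrow> real ^ 'n \<Rightarrow> real ^ 'n \<Rightarrow> real) \<Rightarrow> real \<Rightarrow> (real ^ 'n \<Rightarrow> (real \<Rightarrow> real ^ 'n) measure) \<Rightarrow> bool"
  where
  "bridge_kernel L q T B \<longleftrightarrow>
     B \<in> restrict_space lborel (open_cube L) \<rightarrow>\<^sub>M prob_algebra (borel_of (loop_topology L T)) \<and>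
     (\<forall>a\<in>open_cube L.
        (AE \<omega> in B a. \<omega> 0 = a \<and> \<omega> T = a) \<and>
        (\<forall>k t. strict_mono_on {..k} t \<and> 0 < t 0 \<and> t k < T \<longrightarrow>
           distributed (B a) (\<Pi>\<^sub>M i\<in>{..k}. restrict_space lborel (closed_cube L))
             (\<lambda>\<omega>. \<lambda>i\<in>{..k}. \<omega> (t i))
             (\<lambda>x. ennreal (q (t 0) a (x 0) * transition_product q k t x * q (T - t k) (x k) a / q T a a))))"

definition root_law :: "real \<Rightarrow> (real \<Rightarrow> real ^ 'n \<Rightarrow> real ^ 'n \<Rightarrow> real) \<Rightarrow> real \<Rightarrow> (real ^ 'n) measure" where
  "root_law L q T = density (restrict_space lborel (open_cube L))
     (\<lambda>a. ennreal (q T a a / (LINT z:open_cube L|lborel. q T z z)))"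

definition loop_law ::
    "real \<Rightarrow> (real \<Rightarrow> real ^ 'n \<Rightarrow> real ^ 'n \<Rightarrow> real) \<Rightarrow> real \<Rightarrow> (real ^ 'n \<Rightarrow> (real \<Rightarrow> real ^ 'n) measure) \<Rightarrow>
     (real \<Rightarrow> real ^ 'n) measure" where
  "loop_law L q T B = root_law L q T \<bind> B"


text \<open>Diffusive rescaling of a loop of duration \<open>T\<close>, extended periodically with period \<open>T / L\<^sup>2\<close>.\<close>

definition rescaled_loop :: "real \<Rightarrow> real \<Rightarrow> (real \<Rightarrow> real ^ 'n) \<Rightarrow> real \<Rightarrow> real ^ 'n" where
  "rescaled_loop L T \<omega> = (\<lambda>s. (1 / L) *\<^sub>R \<omega> (L\<^sup>2 * (s rmod (T / L\<^sup>2))))"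

definition shift :: "real \<Rightarrow> (real \<Rightarrow> 'a) \<Rightarrow> real \<Rightarrow> 'a" where
  "shift u \<gamma> = (\<lambda>t. \<gamma> (u + t))"

definition mark :: "real \<Rightarrow> real \<Rightarrow> (real \<Rightarrow> real ^ 'n) \<Rightarrow> (real \<Rightarrow> real ^ 'n) measure" where
  "mark L T \<omega> = uniform_measure lborel {0..T / L\<^sup>2} \<bind>
     (\<lambda>u. return (borel_of mark_path_topology) (shift u (rescaled_loop L T \<omega>)))"

definition mark_law ::
    "real \<Rightarrow> (real \<Rightarrow> real ^ 'n \<Rightarrow> real ^ 'n \<Rightarrow> real) \<Rightarrow> real \<Rightarrow> (real ^ 'n \<Rightarrow> (real \<Rightarrow> real ^ 'n) measure) \<Rightarrow>
     (real \<Rightarrow> real ^ 'n) measure measure" where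
  "mark_law L q T B =
     distr (loop_law L q T B) (borel_of (weak_topology mark_path_topology)) (mark L T)"


text \<open>Law of the two-sided stationary process on the closed unit cube with transition density \<open>p\<close>.\<close>

definition two_sided_stationary_law ::
    "(real \<Rightarrow> real ^ 'n \<Rightarrow> real ^ 'n \<Rightarrow> real) \<Rightarrow> (real \<Rightarrow> real ^ 'n) measure \<Rightarrow> bool" where
  "two_sided_stationary_law p P \<longleftrightarrow>
     P \<in> space (prob_algebra (borel_of mark_path_topology)) \<and>
     (\<forall>k t. strict_mono_on {..k} t \<longrightarrow>
        distributed P (\<Pi>\<^sub>M i\<in>{..k}. restrict_space lborel (closed_cube 1))
          (\<lambda>\<gamma>. \<lambda>i\<in>{..k}. \<gamma> (t i))
          (\<lambda>r. ennreal (transition_product p k t r)))"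

end

theory Submission
  imports Defs
begin

text \<open>
  Testing the classical solutions against products of cosines turns the heat equation into linear
  ordinary differential equations, so the cosine moments of a Neumann heat kernel are explicit; by
  the Stone--Weierstrass theorem they determine the kernel, which is therefore a product of
  one-dimensional theta functions. This yields Brownian scaling and the uniform convergence of the
  unit-cube kernel to \<open>1\<close> at large times.

  Consequently the rescaled loop, restricted to times at distance \<open>D\<close> from both ends of its period,
  has finite-dimensional densities at most \<open>9/2\<close> times those of the stationary process, and this
  domination passes to all nonnegative bounded continuous functionals of that window. No tightness
  argument is needed, since the stationary law already lives on continuous paths. Under the
  stationary law two windows separated by a long gap are nearly independent, so time averages have
  small variance, and by the domination the same holds for the loop. Bounded continuous functionals
  are sandwiched between functionals of finite windows by Lipschitz envelopes, which gives
  convergence of \<open>\<integral>f dm\<close> in \<open>L\<^sup>1\<close>, uniformly in all loops of rescaled duration at least \<open>S\<close> as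
  \<open>S \<rightarrow> \<infinity>\<close>; finally \<open>\<beta> j / L\<^sup>2 \<ge> \<beta> \<delta> L\<^sup>d\<^sup>-\<^sup>2 \<rightarrow> \<infinity>\<close> because \<open>d > 2\<close>.
\<close>

section \<open>Cubes and the Green identity\<close>

text \<open>The kernels \<open>q L\<close> and \<open>p\<close> are given only by their defining
  properties, one per cube and a priori unrelated. The explicit formula ties them together: after
  rescaling, the interior transition factors of a bridge are exactly those of \<open>p\<close>, and
  only the two legs joining the window to the root remain to be estimated. A bound on these legs
  uniform in \<open>L\<close> is available once they last a rescaled time \<open>D\<close>, which is
  why the windows keep that distance from both ends.

  Finite-dimensional densities say nothing directly about a functional of a whole window. Evaluating
  the functional on the Bernstein polynomial through \<open>k + 1\<close> nodes makes it a function
  of finitely many coordinates, and continuity of the functional carries the inequalities to the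
  limit.

  Upper bounds suffice throughout. What is transferred from the stationary process to the loop is a
  squared deviation, hence nonnegative; under the stationary law an upper bound on the second moment
  becomes a variance bound because the mean of a time average is known exactly.\<close>

lemma mem_closed_cube: "x \<in> closed_cube L \<longleftrightarrow> (\<forall>i. 0 \<le> x $ i \<and> x $ i \<le> L)"
  by (simp add: closed_cube_def mem_box_cart)

lemma mem_open_cube: "x \<in> open_cube L \<longleftrightarrow> (\<forall>i. 0 < x $ i \<and> x $ i < L)"
  by (simp add: open_cube_def mem_box_cart)

lemma compact_closed_cube [simp, intro]: "compact (closed_cube L)"
  by (simp add: closed_cube_def)

lemma convex_closed_cube [simp, intro]: "convex (closed_cube L)"
  by (simp add: closed_cube_def)

lemma closed_cube_sets [measurable]: "closed_cube L \<in> sets borel"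
  by (simp add: closed_cube_def)

lemma open_cube_sets [measurable]: "open_cube L \<in> sets borel"
  by (simp add: open_cube_def)

lemma open_cube_subset: "open_cube L \<subseteq> closed_cube L"
  by (auto simp: mem_open_cube mem_closed_cube less_imp_le)

lemma prod_Basis_vec:
  fixes f :: "real ^ 'n \<Rightarrow> 'a::comm_monoid_mult"
  shows "(\<Prod>b\<in>Basis. f b) = (\<Prod>i\<in>UNIV. f (axis i 1))"
proof -
  have "inj (\<lambda>i::'n. axis i (1::real))"
    by (simp add: inj_def axis_eq_axis)
  moreover have "Basis = range (\<lambda>i::'n. axis i (1::real))"
    by (auto simp: Basis_vec_def)
  ultimately show ?thesis
    by (metis (no_types, lifting) comp_apply prod.cong prod.reindex)
qed

section \<open>Volumes of cubes, and Lebesgue measure as a product measure\<close>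

lemma emeasure_closed_cube:
  assumes "0 \<le> L"
  shows "emeasure lborel (closed_cube L :: (real ^ 'n) set) = ennreal (L ^ CARD('n))"
proof -
  have "(\<forall>b\<in>Basis. 0 \<bullet> b \<le> vec L \<bullet> (b :: real ^ 'n))"
    using assms by (auto simp: Basis_vec_def inner_axis)
  then show ?thesis
    using assms by (simp add: closed_cube_def emeasure_lborel_cbox_eq prod_Basis_vec inner_axis)
qed

lemma emeasure_open_cube:
  assumes "0 \<le> L"
  shows "emeasure lborel (open_cube L :: (real ^ 'n) set) = ennreal (L ^ CARD('n))"
proof -
  have "(\<forall>b\<in>Basis. 0 \<bullet> b \<le> vec L \<bullet> (b :: real ^ 'n))"
    using assms by (auto simp: Basis_vec_def inner_axis)
  then show ?thesis
    using assms by (simp add: open_cube_def emeasure_lborel_box_eq prod_Basis_vec inner_axis)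
qed

lemma measurable_vec_lambda [measurable]:
  "(\<lambda>f. \<chi> i. f i) \<in> (\<Pi>\<^sub>M i\<in>(UNIV::'n::finite set). lborel) \<rightarrow>\<^sub>M (borel :: (real ^ 'n) measure)"
proof (subst borel_measurable_euclidean_space, rule ballI)
  fix b :: "real ^ 'n" assume "b \<in> Basis"
  then obtain i where b: "b = axis i 1"
    by (auto simp: Basis_vec_def)
  show "(\<lambda>f. (\<chi> i. f i) \<bullet> b) \<in> borel_measurable (\<Pi>\<^sub>M i\<in>UNIV. lborel)"
    unfolding b by (simp add: inner_axis)
qed

text \<open>Fubini in a single coordinate and factorisation of product integrands are theorems about
  \<open>PiM\<close>; this identity carries them over to the cube. Agreement on boxes is
  enough.\<close>

lemma lborel_vec: "(lborel :: (real ^ 'n) measure) = distr (\<Pi>\<^sub>M i\<in>UNIV. lborel) borel (\<lambda>f. \<chi> i. f i)"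
proof (rule lborel_eqI)
  fix l u :: "real ^ 'n" assume le: "\<And>b. b \<in> Basis \<Longrightarrow> l \<bullet> b \<le> u \<bullet> b"
  have le': "l $ i \<le> u $ i" for i
    using le[of "axis i 1"] by (auto simp: Basis_vec_def inner_axis)
  interpret product_sigma_finite "\<lambda>_::'n. lborel :: real measure" ..
  have "(\<lambda>f. \<chi> i. f i) -` box l u \<inter> space (\<Pi>\<^sub>M i\<in>(UNIV::'n set). lborel) = (\<Pi>\<^sub>E i\<in>UNIV. {l $ i<..<u $ i})"
    by (auto simp: space_PiM mem_box_cart PiE_def Pi_def)
  then have "emeasure (distr (\<Pi>\<^sub>M i\<in>UNIV. lborel) borel (\<lambda>f. \<chi> i. f i)) (box l u)
      = emeasure (\<Pi>\<^sub>M i\<in>UNIV. lborel) (\<Pi>\<^sub>E i\<in>UNIV. {l $ i<..<u $ i})"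
    by (subst emeasure_distr) auto
  also have "\<dots> = (\<Prod>i\<in>UNIV. ennreal (u $ i - l $ i))"
    using le' by (subst emeasure_PiM) auto
  also have "\<dots> = (\<Prod>b\<in>Basis. (u - l) \<bullet> b)"
    using le' by (simp add: prod_Basis_vec inner_axis prod_ennreal)
  finally show "emeasure (distr (\<Pi>\<^sub>M i\<in>UNIV. lborel) borel (\<lambda>f. \<chi> i. f i)) (box l u) = (\<Prod>b\<in>Basis. (u - l) \<bullet> b)" .
qed simp

lemma set_integral_continuous_cube:
  fixes f :: "real ^ 'n \<Rightarrow> real"
  assumes "continuous_on (closed_cube L) f"
  shows "set_integrable lborel (closed_cube L) f"
    and "(LINT x:closed_cube L|lborel. f x) = integral (cbox 0 (vec L)) f"
proof -
  show 1: "set_integrable lborel (closed_cube L) f"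
    unfolding set_integrable_def by (rule borel_integrable_compact[OF _ assms]) simp
  show "(LINT x:closed_cube L|lborel. f x) = integral (cbox 0 (vec L)) f"
    using set_borel_integral_eq_integral(2)[OF 1] by (simp add: closed_cube_def)
qed

section \<open>Integration by parts along one coordinate, and the cosine modes\<close>

definition vec_upd :: "real ^ 'n \<Rightarrow> 'n \<Rightarrow> real \<Rightarrow> real ^ 'n" where
  "vec_upd x i y = (\<chi> j. if j = i then y else x $ j)"

lemma vec_upd_nth [simp]: "vec_upd x i y $ j = (if j = i then y else x $ j)"
  by (simp add: vec_upd_def)

lemma vec_upd_same [simp]: "vec_upd x i (x $ i) = x"
  by (simp add: vec_eq_iff)

lemma vec_upd_eq: "vec_upd x i y = x + (y - x $ i) *\<^sub>R axis i 1"
  by (simp add: vec_eq_iff axis_def)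

text \<open>Divergence theorem in one coordinate: Fubini isolates coordinate \<open>i\<close>, and
  on each line the fundamental theorem of calculus leaves two boundary values, which vanish by
  \<open>z\<close>. Only the derivative of \<open>F\<close> along the line is used, one-sided at the
  faces, as in the definition of the Neumann Laplacian.\<close>

lemma integral_partial_derivative_cube:
  fixes F G :: "real ^ 'n \<Rightarrow> real"
  assumes L: "0 < L" and G: "continuous_on (closed_cube L) G"
    and d: "\<And>x. x \<in> closed_cube L \<Longrightarrow> ((\<lambda>y. F (vec_upd x i y)) has_real_derivative G x) (at (x $ i) within {0..L})"
    and z: "\<And>x. x \<in> closed_cube L \<Longrightarrow> x $ i = 0 \<or> x $ i = L \<Longrightarrow> F x = 0"
  shows "(LINT x:closed_cube L|lborel. G x) = 0"
proof -
  interpret product_sigma_finite "\<lambda>_::'n. lborel :: real measure" ..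
  let ?f = "\<lambda>x. indicator (closed_cube L) x *\<^sub>R G x"
  let ?h = "\<lambda>z. ?f (\<chi> j. z j)"
  have int: "integrable lborel ?f"
    using G by (intro borel_integrable_compact) auto
  have inth: "integrable (\<Pi>\<^sub>M i\<in>UNIV. lborel) ?h"
    using int by (subst (asm) lborel_vec) (rule integrable_distr[OF measurable_vec_lambda])
  have U: "insert i (UNIV - {i}) = UNIV" by auto
  have "(LINT x:closed_cube L|lborel. G x) = (LINT x|lborel. ?f x)"
    by (simp add: set_lebesgue_integral_def)
  also have "\<dots> = (LINT z|(\<Pi>\<^sub>M i\<in>insert i (UNIV - {i}). lborel). ?h z)"
    unfolding U using int by (subst lborel_vec) (simp add: integral_distr borel_measurable_integrable)
  also have "\<dots> = (LINT x|(\<Pi>\<^sub>M i\<in>UNIV - {i}. lborel). LINT y|lborel. ?h (x(i := y)))"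
    using inth by (subst product_integral_insert) (auto simp: U)
  also have "\<dots> = 0"
  proof -
    have "(LINT y|lborel. ?h (x(i := y))) = 0" for x
    \<comment> \<open>If some other coordinate lies outside \<open>{0..L}\<close>, the whole line
      misses the cube.\<close>
    proof (cases "\<forall>j. j \<noteq> i \<longrightarrow> 0 \<le> x j \<and> x j \<le> L")
      case False
      then have "(\<chi> j. (x(i := y)) j) \<notin> closed_cube L" for y
        by (auto simp: mem_closed_cube)
      then show ?thesis by simp
    next
      case True
      define \<gamma> where "\<gamma> y = (\<chi> j. (x(i := y)) j)" for y
      have \<gamma>: "\<gamma> y \<in> closed_cube L \<longleftrightarrow> y \<in> {0..L}" for y
        using True by (auto simp: \<gamma>_def mem_closed_cube)
      have \<gamma>i: "\<gamma> y $ i = y" for y by (simp add: \<gamma>_def)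
      have upd: "vec_upd (\<gamma> y) i z = \<gamma> z" for y z
        by (simp add: \<gamma>_def vec_eq_iff)
      have cg: "continuous_on {0..L} \<gamma>"
        unfolding \<gamma>_def
      proof (rule continuous_on_vec_lambda)
        fix j show "continuous_on {0..L} (\<lambda>y. (x(i := y)) j)"
          by (cases "j = i") auto
      qed
      have "(LINT y|lborel. ?h (x(i := y))) = (LINT y|lborel. indicator {0..L} y *\<^sub>R G (\<gamma> y))"
        using \<gamma> by (intro Bochner_Integration.integral_cong) (auto simp: \<gamma>_def indicator_def)
      also have "\<dots> = F (\<gamma> L) - F (\<gamma> 0)"
      proof (rule integral_FTC_atLeastAtMost)
        show "0 \<le> L" using L by simp
        show "continuous_on {0..L} (\<lambda>y. G (\<gamma> y))"
          by (rule continuous_on_compose2[OF G cg]) (simp add: image_subset_iff \<gamma>)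
        fix y assume "0 \<le> y" "y \<le> L"
        then have "\<gamma> y \<in> closed_cube L" by (simp add: \<gamma>)
        from d[OF this] show "((\<lambda>y. F (\<gamma> y)) has_vector_derivative G (\<gamma> y)) (at y within {0..L})"
          by (simp add: upd \<gamma>i has_real_derivative_iff_has_vector_derivative)
      qed
      also have "\<dots> = 0"
      proof -
        have "\<gamma> L \<in> closed_cube L" "\<gamma> 0 \<in> closed_cube L" using L by (simp_all add: \<gamma>)
        then have "F (\<gamma> L) = 0" "F (\<gamma> 0) = 0" using z \<gamma>i by blast+
        then show ?thesis by simp
      qed
      finally show ?thesis .
    qed
    then show ?thesis by simp
  qed
  finally show ?thesis .
qed

lemma has_derivative_vec_upd:
  fixes f :: "real ^ 'n \<Rightarrow> 'b::real_normed_vector"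
  assumes f: "(f has_derivative f') (at x within closed_cube L)" and x: "x \<in> closed_cube L"
  shows "((\<lambda>y. f (vec_upd x i y)) has_vector_derivative f' (axis i 1)) (at (x $ i) within {0..L})"
proof -
  have "((\<lambda>y. vec_upd x i y) has_derivative (\<lambda>h. h *\<^sub>R axis i 1)) (at (x $ i) within {0..L})"
    unfolding vec_upd_eq by (auto intro!: derivative_eq_intros)
  moreover have "(f has_derivative f') (at (vec_upd x i (x $ i)) within vec_upd x i ` {0..L})"
    using x by (auto intro!: has_derivative_subset[OF f] simp: mem_closed_cube)
  ultimately have "((\<lambda>y. f (vec_upd x i y)) has_derivative (\<lambda>h. f' (h *\<^sub>R axis i 1))) (at (x $ i) within {0..L})"
    by (rule has_derivative_in_compose)
  moreover have "f' (h *\<^sub>R axis i 1) = h *\<^sub>R f' (axis i 1)" for h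
    using has_derivative_bounded_linear[OF f] by (simp add: linear_cmul bounded_linear.linear)
  ultimately show ?thesis
    by (simp add: has_vector_derivative_def)
qed

text \<open>These are the Neumann eigenfunctions of the cube. Integer rather than natural
  frequencies allow an index to be lowered by 1 without a case distinction in the product-to-sum
  formula.\<close>

definition cosine_mode :: "real \<Rightarrow> ('n \<Rightarrow> int) \<Rightarrow> real ^ 'n \<Rightarrow> real" where
  "cosine_mode L k x = (\<Prod>i\<in>UNIV. cos (pi * of_int (k i) * (x $ i / L)))"

lemma continuous_on_cosine_mode [continuous_intros]:
  fixes f :: "'a::t2_space \<Rightarrow> real ^ 'n"
  shows "continuous_on A f \<Longrightarrow> L \<noteq> 0 \<Longrightarrow> continuous_on A (\<lambda>x. cosine_mode L k (f x))"
  unfolding cosine_mode_def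
  by (intro continuous_on_prod continuous_on_cos continuous_on_mult continuous_on_const
      continuous_on_divide continuous_on_component) auto

lemma cosine_mode_split:
  "cosine_mode L k (vec_upd x i y) =
    cos (pi * of_int (k i) * (y / L)) * (\<Prod>j\<in>UNIV - {i}. cos (pi * of_int (k j) * (x $ j / L)))"
proof -
  have "cosine_mode L k (vec_upd x i y) = cos (pi * of_int (k i) * (vec_upd x i y $ i / L)) *
      (\<Prod>j\<in>UNIV - {i}. cos (pi * of_int (k j) * (vec_upd x i y $ j / L)))"
    unfolding cosine_mode_def by (subst prod.remove[of _ i]) auto
  also have "\<dots> = cos (pi * of_int (k i) * (y / L)) * (\<Prod>j\<in>UNIV - {i}. cos (pi * of_int (k j) * (x $ j / L)))"
    by (intro arg_cong2[where f="(*)"] prod.cong) auto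
  finally show ?thesis .
qed

lemma sin_pi_of_int [simp]: "sin (pi * of_int k) = 0"
  by (metis Ints_of_int mult.commute sin_times_pi_eq_0)

text \<open>Both integrations by parts are done at once, on the flux \<open>F\<close> = (derivative
  of u) * (mode) - u * (derivative of mode) in direction \<open>i\<close>. It vanishes on the faces:
  the first product by the Neumann condition \<open>N\<close>, the second because the sine of an
  integer multiple of \<open>pi\<close> is 0.\<close>

lemma integral_second_partial_cosine_mode:
  fixes u :: "real ^ 'n \<Rightarrow> real"
  assumes L: "0 < L" and H: "continuous_on (closed_cube L) H"
    and u: "\<And>x. x \<in> closed_cube L \<Longrightarrow> (u has_derivative (\<lambda>h. D x \<bullet> h)) (at x within closed_cube L)"
    and D: "\<And>x. x \<in> closed_cube L \<Longrightarrow> (D has_derivative (\<lambda>h. H x *v h)) (at x within closed_cube L)"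
    and N: "\<And>x. x \<in> closed_cube L \<Longrightarrow> x $ i = 0 \<or> x $ i = L \<Longrightarrow> D x $ i = 0"
  shows "(LINT x:closed_cube L|lborel. H x $ i $ i * cosine_mode L k x) =
    - (pi * of_int (k i) / L)\<^sup>2 * (LINT x:closed_cube L|lborel. u x * cosine_mode L k x)"
proof -
  let ?c = "pi * of_int (k i) / L"
  define r where "r x = (\<Prod>j\<in>UNIV - {i}. cos (pi * of_int (k j) * (x $ j / L)))" for x :: "real ^ 'n"
  \<comment> \<open>\<open>s\<close> is the partial derivative of the mode in direction
    \<open>i\<close>; \<open>r\<close> collects the factors that do not see that coordinate.\<close>
  define s where "s x = - (?c * sin (?c * x $ i)) * r x" for x
  have rupd: "r (vec_upd x i y) = r x" for x y
    unfolding r_def by (intro prod.cong) auto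
  have eupd: "cosine_mode L k (vec_upd x i y) = cos (?c * y) * r x" for x y
    unfolding cosine_mode_split r_def by (simp add: field_simps)
  have supd: "s (vec_upd x i y) = - (?c * sin (?c * y)) * r x" for x y
    by (simp add: s_def rupd)
  have e: "cosine_mode L k x = cos (?c * x $ i) * r x" for x
    using eupd[of x "x $ i"] by simp
  have cu: "continuous_on (closed_cube L) u"
    using u by (auto simp: continuous_on_eq_continuous_within intro: has_derivative_continuous)
  define F where "F x = D x $ i * cosine_mode L k x - u x * s x" for x
  define G where "G x = H x $ i $ i * cosine_mode L k x + ?c\<^sup>2 * (u x * cosine_mode L k x)" for x
  have c1: "continuous_on (closed_cube L) (\<lambda>x. H x $ i $ i * cosine_mode L k x)"
    using H L by (auto intro!: continuous_on_mult continuous_on_component continuous_on_cosine_mode continuous_on_id)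
  have c2: "continuous_on (closed_cube L) (\<lambda>x. u x * cosine_mode L k x)"
    using cu L by (auto intro!: continuous_on_mult continuous_on_cosine_mode continuous_on_id)
  have "(LINT x:closed_cube L|lborel. G x) = 0"
  proof (rule integral_partial_derivative_cube[OF L, where F = F and i = i])
    show "continuous_on (closed_cube L) G"
      unfolding G_def by (intro continuous_on_add continuous_on_mult[OF continuous_on_const] c1 c2)
  next
    fix x :: "real ^ 'n" assume x: "x \<in> closed_cube L"
    have 1: "((\<lambda>y. u (vec_upd x i y)) has_real_derivative D x $ i) (at (x $ i) within {0..L})"
      using has_derivative_vec_upd[OF u[OF x] x, of i]
      by (simp add: has_real_derivative_iff_has_vector_derivative inner_axis)
    have "((\<lambda>y. D (vec_upd x i y)) has_vector_derivative H x *v axis i 1) (at (x $ i) within {0..L})"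
      using has_derivative_vec_upd[OF D[OF x] x, of i] .
    from bounded_linear.has_vector_derivative[OF bounded_linear_vec_nth[of i] this]
    have 2: "((\<lambda>y. D (vec_upd x i y) $ i) has_real_derivative H x $ i $ i) (at (x $ i) within {0..L})"
      by (simp add: has_real_derivative_iff_has_vector_derivative matrix_vector_mul_component inner_axis)
    show "((\<lambda>y. F (vec_upd x i y)) has_real_derivative G x) (at (x $ i) within {0..L})"
      unfolding F_def eupd supd
      by (rule derivative_eq_intros 1 2 refl | simp)+
         (simp add: G_def e s_def power2_eq_square algebra_simps)
  next
    fix x :: "real ^ 'n" assume x: "x \<in> closed_cube L" "x $ i = 0 \<or> x $ i = L"
    have "s x = 0"
      using x(2) L by (auto simp: s_def)
    then show "F x = 0"
      using N[OF x] by (simp add: F_def)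
  qed
  then have "(LINT x:closed_cube L|lborel. H x $ i $ i * cosine_mode L k x) +
      ?c\<^sup>2 * (LINT x:closed_cube L|lborel. u x * cosine_mode L k x) = 0"
    unfolding G_def
    using set_integral_continuous_cube(1)[OF c1] set_integral_continuous_cube(1)[OF c2]
    by (subst (asm) set_integral_add) auto
  then show ?thesis by simp
qed

section \<open>The Neumann heat kernel as a product of theta functions\<close>

lemma integrable_on_closed_cube:
  fixes f :: "real ^ 'n \<Rightarrow> real"
  shows "continuous_on (closed_cube L) f \<Longrightarrow> f integrable_on closed_cube L"
  by (simp add: closed_cube_def integrable_continuous)

lemma set_integral_cube_eq:
  fixes f :: "real ^ 'n \<Rightarrow> real"
  shows "continuous_on (closed_cube L) f \<Longrightarrow> (LINT x:closed_cube L|lborel. f x) = integral (closed_cube L) f"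
  using set_integral_continuous_cube(2)[of L f] by (simp add: closed_cube_def)

section \<open>Cosine moments determine the kernel\<close>

lemma neumann_heat_kernelD:
  assumes "neumann_heat_kernel L q"
  shows "continuous_on ({0<..} \<times> closed_cube L \<times> closed_cube L) (\<lambda>(t, x, y). q t x y)"
    and "\<And>t x y. 0 < t \<Longrightarrow> x \<in> closed_cube L \<Longrightarrow> y \<in> closed_cube L \<Longrightarrow> 0 \<le> q t x y"
    and "\<And>y f. y \<in> closed_cube L \<Longrightarrow> continuous_on (closed_cube L) f \<Longrightarrow>
        ((\<lambda>t. LINT x:closed_cube L|lborel. q t x y * f x) \<longlongrightarrow> f y) (at_right 0)"
  using assms unfolding neumann_heat_kernel_def by blast+

text \<open>The moment \<open>m\<close> satisfies \<open>m' = - lam * m\<close>: differentiate under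
  the integral, replace the time derivative by the trace of the Hessian, and move each second
  derivative onto the mode. The initial value is read off from the Dirac condition, with the mode
  itself as test function.\<close>

lemma heat_kernel_cosine_moment:
  fixes q :: "real \<Rightarrow> real ^ 'n \<Rightarrow> real ^ 'n \<Rightarrow> real"
  assumes L: "0 < L" and K: "neumann_heat_kernel L q" and t: "0 < t" and y: "y \<in> closed_cube L"
  shows "integral (closed_cube L) (\<lambda>x. q t x y * cosine_mode L k x) =
    exp (- (\<Sum>i\<in>UNIV. (pi * of_int (k i) / L)\<^sup>2) * t) * cosine_mode L k y"
proof -
  let ?e = "cosine_mode L k :: real ^ 'n \<Rightarrow> real"
  define lam where "lam = (\<Sum>i\<in>UNIV. (pi * of_int (k i) / L)\<^sup>2)"
  have ce: "continuous_on (closed_cube L) ?e"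
    using L by (intro continuous_on_cosine_mode continuous_on_id) auto
  from K obtain q' where
      q': "continuous_on ({0<..} \<times> closed_cube L \<times> closed_cube L) (\<lambda>(t, x, y). q' t x y)"
    and lap: "\<And>t. 0 < t \<Longrightarrow> neumann_laplacian L (\<lambda>x. q t x y) (\<lambda>x. q' t x y)"
    and der: "\<And>t x. 0 < t \<Longrightarrow> x \<in> closed_cube L \<Longrightarrow> ((\<lambda>s. q s x y) has_real_derivative q' t x y) (at t)"
    using y unfolding neumann_heat_kernel_def by blast
  define m where "m t = integral (closed_cube L) (\<lambda>x. q t x y * ?e x)" for t
  have cq: "continuous_on (closed_cube L) (\<lambda>x. q t x y * ?e x)" if "0 < t" for t
  proof (rule continuous_on_mult[OF _ ce])
    show "continuous_on (closed_cube L) (\<lambda>x. q t x y)"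
    proof -
      have "continuous_on (closed_cube L) (\<lambda>x. (t, x, y))"
        by (intro continuous_intros)
      from continuous_on_compose2[OF neumann_heat_kernelD(1)[OF K] this] show ?thesis
        using that y by auto
    qed
  qed
  have dm: "(m has_real_derivative - lam * m t) (at t within {0<..})" if t: "0 < t" for t
  proof -
    have "((\<lambda>t. integral (cbox 0 (vec L)) (\<lambda>x. q t x y * ?e x)) has_real_derivative
        integral (cbox 0 (vec L)) (\<lambda>x. q' t x y * ?e x)) (at t within {0<..})"
    proof (rule leibniz_rule_field_derivative)
      fix s :: real and x :: "real ^ 'n" assume "s \<in> {0<..}" "x \<in> cbox 0 (vec L)"
      then have "((\<lambda>s. q s x y) has_real_derivative q' s x y) (at s within {0<..})"
        using der[of s x] by (auto simp: closed_cube_def intro: has_field_derivative_at_within)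
      then show "((\<lambda>s. q s x y * ?e x) has_real_derivative q' s x y * ?e x) (at s within {0<..})"
        by (auto intro!: derivative_eq_intros)
    next
      fix s :: real assume "s \<in> {0<..}"
      then show "(\<lambda>x. q s x y * ?e x) integrable_on cbox 0 (vec L)"
        using integrable_on_closed_cube[OF cq[of s]] by (simp add: closed_cube_def)
    next
      have c': "continuous_on ({0<..} \<times> closed_cube L) (\<lambda>z. q' (fst z) (snd z) y)"
      proof -
        have "continuous_on ({0<..} \<times> closed_cube L) (\<lambda>z. (fst z, snd z, y))"
          by (intro continuous_intros)
        moreover have "(\<lambda>z. (fst z, snd z, y)) ` ({0<..} \<times> closed_cube L) \<subseteq> {0<..} \<times> closed_cube L \<times> closed_cube L"
          using y by auto
        ultimately show ?thesis
          using continuous_on_compose2[OF q'] by fastforce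
      qed
      have "continuous_on ({0<..} \<times> closed_cube L) (\<lambda>z. q' (fst z) (snd z) y * ?e (snd z))"
        using L by (intro continuous_on_mult c' continuous_on_cosine_mode continuous_intros) auto
      then show "continuous_on ({0<..} \<times> cbox 0 (vec L)) (\<lambda>(s, x). q' s x y * ?e x)"
        by (simp add: closed_cube_def case_prod_beta')
    qed (use t in auto)
    moreover have "integral (closed_cube L) (\<lambda>x. q' t x y * ?e x) = - lam * m t"
    proof -
      from lap[OF t] obtain D :: "real ^ 'n \<Rightarrow> real ^ 'n" and H :: "real ^ 'n \<Rightarrow> real ^ 'n ^ 'n" where
          cH: "continuous_on (closed_cube L) H"
        and D1: "\<And>x. x \<in> closed_cube L \<Longrightarrow> ((\<lambda>x. q t x y) has_derivative (\<lambda>h. D x \<bullet> h)) (at x within closed_cube L)"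
        and D2: "\<And>x. x \<in> closed_cube L \<Longrightarrow> (D has_derivative (\<lambda>h. H x *v h)) (at x within closed_cube L)"
        and N: "\<And>x i. x \<in> closed_cube L \<Longrightarrow> x $ i = 0 \<or> x $ i = L \<Longrightarrow> D x $ i = 0"
        and tr: "\<And>x. x \<in> closed_cube L \<Longrightarrow> q' t x y = trace (H x)"
        unfolding neumann_laplacian_def by blast
      have cHi: "continuous_on (closed_cube L) (\<lambda>x. H x $ i $ i * ?e x)" for i
        using cH ce by (intro continuous_on_mult continuous_on_component)
      have "integral (closed_cube L) (\<lambda>x. q' t x y * ?e x)
          = integral (closed_cube L) (\<lambda>x. \<Sum>i\<in>UNIV. H x $ i $ i * ?e x)"
        by (rule integral_cong) (simp add: tr trace_def sum_distrib_right)
      also have "\<dots> = (\<Sum>i\<in>UNIV. integral (closed_cube L) (\<lambda>x. H x $ i $ i * ?e x))"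
        by (rule integral_sum) (auto intro: integrable_on_closed_cube cHi)
      also have "\<dots> = (\<Sum>i\<in>UNIV. - (pi * of_int (k i) / L)\<^sup>2 * m t)"
        using integral_second_partial_cosine_mode[OF L cH D1 D2 N, of _ k]
        by (simp add: m_def set_integral_cube_eq cHi cq[OF t])
      also have "\<dots> = - lam * m t"
        by (simp add: lam_def sum_distrib_right sum_negf)
      finally show ?thesis .
    qed
    ultimately show ?thesis
      unfolding m_def by (simp add: closed_cube_def)
  qed
  \<comment> \<open>Integrating factor. The equation holds only on the open half-line, so the
    constant must be found by a limit at 0 from the right.\<close>
  have "\<exists>c. \<forall>s\<in>{0<..}. m s * exp (lam * s) = c"
  proof (rule has_field_derivative_zero_constant)
    fix s :: real assume "s \<in> {0<..}"
    then have dms: "(m has_real_derivative - lam * m s) (at s within {0<..})"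
      using dm[of s] by simp
    show "((\<lambda>s. m s * exp (lam * s)) has_real_derivative 0) (at s within {0<..})"
      by (rule derivative_eq_intros dms refl | simp)+
  qed simp
  then obtain c where c: "\<And>s. 0 < s \<Longrightarrow> m s * exp (lam * s) = c" by auto
  have "((\<lambda>s. m s * exp (lam * s)) \<longlongrightarrow> ?e y * exp (lam * 0)) (at_right 0)"
  proof (intro tendsto_intros)
    have "eventually (\<lambda>s. (LINT x:closed_cube L|lborel. q s x y * ?e x) = m s) (at_right 0)"
      using eventually_at_right_less[of "0::real"] by eventually_elim (simp add: m_def set_integral_cube_eq cq)
    then show "(m \<longlongrightarrow> ?e y) (at_right 0)"
      using neumann_heat_kernelD(3)[OF K y ce] by (simp add: tendsto_cong)
  qed
  moreover have "((\<lambda>s. m s * exp (lam * s)) \<longlongrightarrow> c) (at_right 0)"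
    by (rule tendsto_eventually) (use eventually_at_right_less[of "0::real"] c in \<open>auto elim: eventually_mono\<close>)
  ultimately have "c = ?e y"
    using tendsto_unique[of "at_right (0::real)"] by fastforce
  with c[OF t] have "m t * exp (lam * t) = ?e y" by simp
  then have "m t = exp (- lam * t) * ?e y"
    by (simp add: exp_minus field_simps)
  then show ?thesis by (simp add: m_def lam_def)
qed

lemma cos_mult_cosine_mode:
  "cos (pi * (x $ i / L)) * cosine_mode L k x =
    (cosine_mode L (k(i := k i + 1)) x + cosine_mode L (k(i := k i - 1)) x) / 2"
proof -
  define r where "r = (\<Prod>j\<in>UNIV - {i}. cos (pi * of_int (k j) * (x $ j / L)))"
  have s: "cosine_mode L (k(i := a)) x = cos (pi * of_int a * (x $ i / L)) * r" for a
    using cosine_mode_split[of L "k(i := a)" x i "x $ i"] by (auto simp: r_def intro!: prod.cong)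
  have "cosine_mode L k x = cos (pi * of_int (k i) * (x $ i / L)) * r"
    using s[of "k i"] by simp
  then show ?thesis
    using cos_times_cos[of "pi * of_int (k i) * (x $ i / L)" "pi * (x $ i / L)"]
    by (simp add: s algebra_simps add_divide_distrib diff_divide_distrib)
qed

text \<open>
  The continuous functions with vanishing cosine moments are stable under multiplication by each
  coordinate cosine; hence the multipliers preserving them form an algebra to which the
  Stone--Weierstrass theorem applies.
\<close>

lemma cosine_moments_unique:
  fixes w :: "real ^ 'n \<Rightarrow> real"
  assumes L: "0 < L" and cw: "continuous_on (closed_cube L) w"
    and mom: "\<And>k. integral (closed_cube L) (\<lambda>x. w x * cosine_mode L k x) = 0"
    and x: "x \<in> closed_cube L"
  shows "w x = 0"
proof -
  let ?I = "integral (closed_cube L) :: (real ^ 'n \<Rightarrow> real) \<Rightarrow> real"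
  define W where "W w \<longleftrightarrow> continuous_on (closed_cube L) w \<and> (\<forall>k. ?I (\<lambda>x. w x * cosine_mode L k x) = 0)"
    for w :: "real ^ 'n \<Rightarrow> real"
  define P where "P f \<longleftrightarrow> continuous_on (closed_cube L) f \<and> (\<forall>w. W w \<longrightarrow> W (\<lambda>x. w x * f x))"
    for f :: "real ^ 'n \<Rightarrow> real"
  have ce: "continuous_on (closed_cube L) (cosine_mode L k :: real ^ 'n \<Rightarrow> real)" for k
    using L by (intro continuous_on_cosine_mode continuous_on_id) auto
  have int: "(\<lambda>x. w x * cosine_mode L k x) integrable_on closed_cube L" if "W w" for w k
    using that ce by (intro integrable_on_closed_cube continuous_on_mult) (auto simp: W_def)
  have Wadd: "W (\<lambda>x. w x + v x)" if "W w" "W v" for w v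
    using that int[OF that(1)] int[OF that(2)]
    by (auto simp: W_def distrib_right Henstock_Kurzweil_Integration.integral_add intro!: continuous_on_add)
  have Wcmul: "W (\<lambda>x. w x * c)" if "W w" for w c
  proof -
    have "?I (\<lambda>x. w x * c * cosine_mode L k x) = c * ?I (\<lambda>x. w x * cosine_mode L k x)" for k
      by (simp flip: Henstock_Kurzweil_Integration.integral_mult_right add: algebra_simps)
    then show ?thesis
      using that by (auto simp: W_def intro!: continuous_on_mult continuous_on_const)
  qed
  have Ww: "W w" using cw mom by (simp add: W_def)
  have Pcos: "P (\<lambda>x. cos (pi * (x $ i / L)))" for i
    unfolding P_def
  proof safe
    show c: "continuous_on (closed_cube L) (\<lambda>x. cos (pi * ((x :: real ^ 'n) $ i / L)))"
      using L by (intro continuous_intros) auto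
    fix w assume w: "W w"
    have "?I (\<lambda>x. w x * cos (pi * (x $ i / L)) * cosine_mode L k x) = 0" for k
    proof -
      have "?I (\<lambda>x. w x * cos (pi * (x $ i / L)) * cosine_mode L k x) =
         ?I (\<lambda>x. (w x * cosine_mode L (k(i := k i + 1)) x + w x * cosine_mode L (k(i := k i - 1)) x) * (1 / 2))"
        by (rule integral_cong) (simp only: mult.assoc cos_mult_cosine_mode, simp add: algebra_simps)
      also have "\<dots> = 0"
        unfolding integral_mult_left
        using w int[OF w] by (subst Henstock_Kurzweil_Integration.integral_add) (auto simp: W_def)
      finally show ?thesis .
    qed
    with w c show "W (\<lambda>x. w x * cos (pi * (x $ i / L)))"
      by (auto simp: W_def intro!: continuous_on_mult)
  qed
  have SW: "\<exists>g. P g \<and> (\<forall>x\<in>closed_cube L. \<bar>w x - g x\<bar> < e)" if "0 < e" for e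
  proof (rule Stone_Weierstrass_HOL[OF compact_closed_cube _ _ _ _ _ cw that])
    show "P (\<lambda>x. c)" for c
      using Wcmul by (auto simp: P_def)
    show "P f \<Longrightarrow> continuous_on (closed_cube L) f" for f
      by (simp add: P_def)
    show "P (\<lambda>x. f x + g x)" if "P f \<and> P g" for f g
      using that Wadd by (auto simp: P_def distrib_left intro!: continuous_on_add)
    show "P (\<lambda>x. f x * g x)" if "P f \<and> P g" for f g
      using that by (auto simp: P_def mult.assoc[symmetric] intro!: continuous_on_mult)
    fix x y :: "real ^ 'n" assume xy: "x \<in> closed_cube L \<and> y \<in> closed_cube L \<and> x \<noteq> y"
    then obtain i where i: "x $ i \<noteq> y $ i" by (auto simp: vec_eq_iff)
    have "cos (pi * (x $ i / L)) \<noteq> cos (pi * (y $ i / L))"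
    proof
      assume "cos (pi * (x $ i / L)) = cos (pi * (y $ i / L))"
      moreover have "0 \<le> pi * (z $ i / L)" "pi * (z $ i / L) \<le> pi" if "z \<in> closed_cube L" for z :: "real ^ 'n"
        using that L by (auto simp: mem_closed_cube pos_divide_le_eq)
      ultimately have "pi * (x $ i / L) = pi * (y $ i / L)"
        using xy cos_inj_pi by blast
      then show False using i L by simp
    qed
    then show "\<exists>f. P f \<and> f x \<noteq> f y"
      by (intro exI[of _ "\<lambda>x. cos (pi * (x $ i / L))"] conjI Pcos)
  qed
  have cw2: "continuous_on (closed_cube L) (\<lambda>x. w x * w x)"
    using cw by (intro continuous_on_mult)
  \<comment> \<open>The multiplier \<open>g\<close> approximates \<open>w\<close> itself. Since
    \<open>w * g\<close> stays in \<open>W\<close>, testing it against the mode of frequency 0,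
    which is constantly 1, shows that the integral of \<open>w * g\<close> is 0; what remains of the
    integral of \<open>w * w\<close> is small.\<close>
  have le: "?I (\<lambda>x. w x * w x) \<le> e * ?I (\<lambda>x. \<bar>w x\<bar>)" if e: "0 < e" for e
  proof -
    obtain g where g: "P g" and ge: "\<And>x. x \<in> closed_cube L \<Longrightarrow> \<bar>w x - g x\<bar> < e"
      using SW[OF e] by auto
    have cg: "continuous_on (closed_cube L) (\<lambda>x. w x * g x)"
      using g cw by (auto simp: P_def intro: continuous_on_mult)
    have "W (\<lambda>x. w x * g x)" using g Ww by (simp add: P_def)
    then have "?I (\<lambda>x. w x * g x * cosine_mode L (\<lambda>_. 0) x) = 0" by (simp only: W_def)
    then have z: "?I (\<lambda>x. w x * g x) = 0"
      by (simp add: cosine_mode_def)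
    have "?I (\<lambda>x. w x * w x) = ?I (\<lambda>x. w x * w x - w x * g x)"
      using z integrable_on_closed_cube[OF cw2] integrable_on_closed_cube[OF cg]
      by (simp add: Henstock_Kurzweil_Integration.integral_diff)
    also have "\<dots> \<le> ?I (\<lambda>x. e * \<bar>w x\<bar>)"
    proof (rule integral_le)
      show "(\<lambda>x. w x * w x - w x * g x) integrable_on closed_cube L"
        using cw2 cg by (intro integrable_on_closed_cube continuous_on_diff)
      show "(\<lambda>x. e * \<bar>w x\<bar>) integrable_on closed_cube L"
        using cw by (intro integrable_on_closed_cube continuous_intros)
      fix x :: "real ^ 'n" assume "x \<in> closed_cube L"
      have "w x * w x - w x * g x \<le> \<bar>w x * (w x - g x)\<bar>"
        by (simp add: algebra_simps)
      also have "\<dots> \<le> e * \<bar>w x\<bar>"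
        using mult_left_mono[OF less_imp_le[OF ge[OF \<open>x \<in> closed_cube L\<close>]], of "\<bar>w x\<bar>"]
        by (simp add: abs_mult mult.commute)
      finally show "w x * w x - w x * g x \<le> e * \<bar>w x\<bar>" .
    qed
    finally show ?thesis by simp
  qed
  have "?I (\<lambda>x. w x * w x) \<le> 0"
  proof (rule field_le_epsilon)
    fix e :: real assume e: "0 < e"
    define A where "A = ?I (\<lambda>x. \<bar>w x\<bar>)"
    have A: "0 \<le> A" unfolding A_def
      by (rule Henstock_Kurzweil_Integration.integral_nonneg)
         (use cw in \<open>auto intro!: integrable_on_closed_cube continuous_intros\<close>)
    have "?I (\<lambda>x. w x * w x) \<le> e / (A + 1) * A"
      using le[of "e / (A + 1)"] e A by (simp add: A_def)
    also have "\<dots> \<le> e" using e A by (simp add: field_simps)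
    finally show "?I (\<lambda>x. w x * w x) \<le> 0 + e" by simp
  qed
  moreover have "0 \<le> ?I (\<lambda>x. w x * w x)"
    by (rule Henstock_Kurzweil_Integration.integral_nonneg) (auto intro!: integrable_on_closed_cube cw2)
  ultimately have "((\<lambda>x. w x * w x) has_integral 0) (closed_cube L)"
    using integrable_integral[OF integrable_on_closed_cube[OF cw2]] by simp
  then have "w x * w x = 0"
    using x cw2 L unfolding closed_cube_def
    by (intro has_integral_0_cbox_imp_0[where f="\<lambda>x. w x * w x"]) (auto simp: interval_ne_empty_cart)
  then show ?thesis by simp
qed


section \<open>The theta function: Neumann heat kernel of the unit interval, zero mode split
  off\<close>

definition theta :: "real \<Rightarrow> real \<Rightarrow> real \<Rightarrow> real" where
  "theta s a b = 1 + 2 * (\<Sum>n. exp (- (pi * real (Suc n))\<^sup>2 * s) * cos (pi * real (Suc n) * a) * cos (pi * real (Suc n) * b))"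

text \<open>\<open>(pi * m)^2\<close> is at least \<open>m\<close> for natural \<open>m\<close>, so
  Gaussian decay is replaced by a geometric series of ratio \<open>exp (- s)\<close>. This gives
  uniform convergence and a closed bound that tends to 0 for large \<open>s\<close>.\<close>

lemma theta_term_bound:
  assumes "0 \<le> s"
  shows "\<bar>exp (- (pi * real (Suc n))\<^sup>2 * s) * cos (pi * real (Suc n) * a) * cos (pi * real (Suc n) * b)\<bar> \<le> exp (- s) ^ Suc n"
proof -
  have "1 \<le> pi * 1" using pi_ge_two by simp
  also have "pi * 1 \<le> pi * real (Suc n)" by (intro mult_left_mono) auto
  finally have "1 * real (Suc n) \<le> (pi * real (Suc n)) * (pi * real (Suc n))"
    using pi_ge_two by (intro mult_mono) (auto intro: order_trans[of _ "1 * real (Suc n)"] mult_right_mono)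
  then have "real (Suc n) * s \<le> (pi * real (Suc n))\<^sup>2 * s"
    using assms by (intro mult_right_mono) (auto simp: power2_eq_square)
  then have "exp (- (pi * real (Suc n))\<^sup>2 * s) \<le> exp (real (Suc n) * (- s))"
    by simp
  also have "\<dots> = exp (- s) ^ Suc n"
    by (rule exp_of_nat_mult)
  finally have 1: "exp (- (pi * real (Suc n))\<^sup>2 * s) \<le> exp (- s) ^ Suc n" .
  have "\<bar>cos (pi * real (Suc n) * a) * cos (pi * real (Suc n) * b)\<bar> \<le> 1 * 1"
    unfolding abs_mult by (intro mult_mono) auto
  then have "exp (- (pi * real (Suc n))\<^sup>2 * s) * \<bar>cos (pi * real (Suc n) * a) * cos (pi * real (Suc n) * b)\<bar> \<le> exp (- s) ^ Suc n * 1"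
    using 1 by (intro mult_mono) auto
  then show ?thesis by (simp add: abs_mult mult.assoc)
qed

lemma summable_exp_powers: "0 < s \<Longrightarrow> summable (\<lambda>n. exp (- s :: real) ^ Suc n)"
  by (intro summable_ignore_initial_segment[of _ 1, simplified] summable_geometric) auto

lemma theta_uniform_limit:
  assumes "0 < s"
  shows "uniform_limit A (\<lambda>N a. \<Sum>n<N. exp (- (pi * real (Suc n))\<^sup>2 * s) * cos (pi * real (Suc n) * a) * cos (pi * real (Suc n) * b))
    (\<lambda>a. \<Sum>n. exp (- (pi * real (Suc n))\<^sup>2 * s) * cos (pi * real (Suc n) * a) * cos (pi * real (Suc n) * b)) sequentially"
  using theta_term_bound[of s] assms
  by (intro Weierstrass_m_test[where M="\<lambda>n. exp (- s) ^ Suc n"] summable_exp_powers) auto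

lemma continuous_on_theta: "0 < s \<Longrightarrow> continuous_on A (\<lambda>a. theta s a b)"
  unfolding theta_def
  by (intro continuous_intros uniform_limit_theorem[OF _ theta_uniform_limit] always_eventually allI) auto

lemma theta_minus_one_bound:
  assumes "0 < s"
  shows "\<bar>theta s a b - 1\<bar> \<le> 2 * (exp (- s) / (1 - exp (- s)))"
proof -
  let ?f = "\<lambda>n. exp (- (pi * real (Suc n))\<^sup>2 * s) * cos (pi * real (Suc n) * a) * cos (pi * real (Suc n) * b)"
  have 1: "norm (exp (- s)) < 1" using assms by simp
  have "norm (suminf ?f) \<le> (\<Sum>n. exp (- s) ^ Suc n)"
    using theta_term_bound[of s] assms
    by (intro norm_suminf_le summable_exp_powers) auto
  also have "\<dots> = exp (- s) / (1 - exp (- s))"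
    using suminf_mult[OF summable_geometric[OF 1], of "exp (- s)"] suminf_geometric[OF 1] by simp
  finally show ?thesis by (simp add: theta_def)
qed

lemma has_integral_cos_mode:
  assumes "0 < L"
  shows "((\<lambda>a. cos (pi * of_int j * (a / L))) has_integral (if j = 0 then L else 0)) {0..L}"
proof (cases "j = 0")
  case True
  then show ?thesis using has_integral_const_real[of "1::real" 0 L] assms by simp
next
  case False
  have "((\<lambda>a. cos (pi * of_int j * (a / L))) has_integral
      (L / (pi * of_int j) * sin (pi * of_int j * (L / L)) - L / (pi * of_int j) * sin (pi * of_int j * (0 / L)))) {0..L}"
    using assms False
    by (intro fundamental_theorem_of_calculus)
       (auto simp: has_real_derivative_iff_has_vector_derivative[symmetric] intro!: derivative_eq_intros)
  then show ?thesis using assms False by simp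
qed

lemma has_integral_cos_cos:
  assumes L: "0 < L" and n: "0 < n"
  shows "((\<lambda>a. cos (pi * real n * (a / L)) * cos (pi * of_int m * (a / L))) has_integral
     (if int n = \<bar>m\<bar> then L / 2 else 0)) {0..L}"
proof -
  have "((\<lambda>a. (cos (pi * of_int (int n - m) * (a / L)) + cos (pi * of_int (int n + m) * (a / L))) / 2) has_integral
     ((if int n - m = 0 then L else 0) + (if int n + m = 0 then L else 0)) / 2) {0..L}"
    by (intro has_integral_divide has_integral_add has_integral_cos_mode L)
  also have "(\<lambda>a. (cos (pi * of_int (int n - m) * (a / L)) + cos (pi * of_int (int n + m) * (a / L))) / 2) =
      (\<lambda>a. cos (pi * real n * (a / L)) * cos (pi * of_int m * (a / L)))"
    unfolding cos_times_cos by (simp add: algebra_simps add_divide_distrib diff_divide_distrib)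
  \<comment> \<open>\<open>n > 0\<close> prevents both frequencies \<open>n - m\<close> and
    \<open>n + m\<close> from vanishing together.\<close>
  also have "((if int n - m = 0 then L else 0) + (if int n + m = 0 then L else 0)) / 2 = (if int n = \<bar>m\<bar> then L / 2 else 0)"
    using n by auto
  finally show ?thesis .
qed

text \<open>Uniform convergence permits termwise integration, and orthogonality keeps one term: the
  constant 1 if \<open>m = 0\<close>, otherwise the term with \<open>Suc n = \<bar>m\<bar>\<close>,
  where the factor 2 in \<open>theta\<close> compensates the \<open>L / 2\<close>. The two cases
  merge into one formula.\<close>

lemma theta_moment:
  assumes L: "0 < L" and s: "0 < s"
  shows "integral {0..L} (\<lambda>a. theta s (a / L) b * cos (pi * of_int m * (a / L))) =
    L * exp (- (pi * of_int m)\<^sup>2 * s) * cos (pi * of_int m * b)"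
proof -
  define c where "c n = exp (- (pi * real (Suc n))\<^sup>2 * s) * cos (pi * real (Suc n) * b)" for n
  define g where "g a = (\<Sum>n. exp (- (pi * real (Suc n))\<^sup>2 * s) * cos (pi * real (Suc n) * a) * cos (pi * real (Suc n) * b))" for a
  have ul: "uniform_limit {0..L} (\<lambda>N a. (\<Sum>n<N. exp (- (pi * real (Suc n))\<^sup>2 * s) * cos (pi * real (Suc n) * (a / L)) * cos (pi * real (Suc n) * b)))
      (\<lambda>a. g (a / L)) sequentially"
    using uniform_limit_compose'[OF theta_uniform_limit[OF s, where A=UNIV and b=b], where h="\<lambda>a. a / L" and B="{0..L}"]
    by (simp add: g_def)
  have "bounded ((\<lambda>a. g (a / L)) ` {0..L})"
  proof -
    have "continuous_on {0..L} (\<lambda>a. g (a / L))"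
      by (rule uniform_limit_theorem[OF _ ul]) (use L in \<open>auto intro!: continuous_intros always_eventually\<close>)
    then show ?thesis by (simp add: compact_continuous_image compact_imp_bounded)
  qed
  then have ul2: "uniform_limit {0..L} (\<lambda>N a. (\<Sum>n<N. exp (- (pi * real (Suc n))\<^sup>2 * s) * cos (pi * real (Suc n) * (a / L)) * cos (pi * real (Suc n) * b))
         * cos (pi * of_int m * (a / L)))
      (\<lambda>a. g (a / L) * cos (pi * of_int m * (a / L))) sequentially"
  proof (intro bounded_bilinear.bounded_uniform_limit[OF bounded_bilinear_mult ul] uniform_limit_const)
    show "bounded ((\<lambda>a. cos (pi * of_int m * (a / L))) ` {0..L})"
      by (auto simp: bounded_iff intro!: exI[of _ 1])
  qed
  obtain I J where
      I: "\<And>N. ((\<lambda>a. (\<Sum>n<N. exp (- (pi * real (Suc n))\<^sup>2 * s) * cos (pi * real (Suc n) * (a / L)) * cos (pi * real (Suc n) * b))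
         * cos (pi * of_int m * (a / L))) has_integral I N) {0..L}"
    and J: "((\<lambda>a. g (a / L) * cos (pi * of_int m * (a / L))) has_integral J) {0..L}" and IJ: "I \<longlonglongrightarrow> J"
    by (rule uniform_limit_integral[OF ul2]) (use L in \<open>auto intro!: continuous_intros\<close>)
  have I_eq: "I N = (\<Sum>n<N. c n * (if int (Suc n) = \<bar>m\<bar> then L / 2 else 0))" for N
  proof (rule has_integral_unique[OF I])
    have "((\<lambda>a. \<Sum>n<N. c n * (cos (pi * real (Suc n) * (a / L)) * cos (pi * of_int m * (a / L)))) has_integral
        (\<Sum>n<N. c n * (if int (Suc n) = \<bar>m\<bar> then L / 2 else 0))) {0..L}"
      by (intro has_integral_sum has_integral_mult_right has_integral_cos_cos L) auto
    then show "((\<lambda>a. (\<Sum>n<N. exp (- (pi * real (Suc n))\<^sup>2 * s) * cos (pi * real (Suc n) * (a / L)) * cos (pi * real (Suc n) * b))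
         * cos (pi * of_int m * (a / L))) has_integral (\<Sum>n<N. c n * (if int (Suc n) = \<bar>m\<bar> then L / 2 else 0))) {0..L}"
      by (simp add: c_def sum_distrib_right sum_distrib_left mult_ac)
  qed
  have J_eq: "J = (if m = 0 then 0 else L / 2 * exp (- (pi * of_int m)\<^sup>2 * s) * cos (pi * of_int m * b))"
  proof (rule LIMSEQ_unique[OF IJ])
    \<comment> \<open>The partial integrals are constant once the only contributing index,
      \<open>\<bar>m\<bar> - 1\<close>, has been passed.\<close>
    have ev: "I N = (if m = 0 then 0 else L / 2 * exp (- (pi * of_int m)\<^sup>2 * s) * cos (pi * of_int m * b))"
      if N: "nat \<bar>m\<bar> \<le> N" for N
    proof (cases "m = 0")
      case True
      then show ?thesis by (simp add: I_eq)
    next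
      case False
      define k where "k = nat \<bar>m\<bar> - 1"
      have k: "int (Suc n) = \<bar>m\<bar> \<longleftrightarrow> n = k" for n
        using False by (auto simp: k_def)
      have kN: "k < N" using N False by (auto simp: k_def)
      have mk: "real (Suc k) = \<bar>of_int m\<bar>"
        using k[of k] by (metis of_int_abs of_int_of_nat_eq)
      have "I N = (\<Sum>n<N. if n = k then c k * (L / 2) else 0)"
        unfolding I_eq k by (intro sum.cong) auto
      also have "\<dots> = c k * (L / 2)" using kN by simp
      also have "\<dots> = L / 2 * exp (- (pi * of_int m)\<^sup>2 * s) * cos (pi * of_int m * b)"
        unfolding c_def mk by (cases "m \<ge> 0") (auto simp: power_mult_distrib)
      finally show ?thesis using False by simp
    qed
    show "I \<longlonglongrightarrow> (if m = 0 then 0 else L / 2 * exp (- (pi * of_int m)\<^sup>2 * s) * cos (pi * of_int m * b))"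
      by (rule tendsto_eventually, rule eventually_sequentiallyI[of "nat \<bar>m\<bar>"]) (rule ev)
  qed
  have "((\<lambda>a. cos (pi * of_int m * (a / L)) + 2 * (g (a / L) * cos (pi * of_int m * (a / L)))) has_integral
      ((if m = 0 then L else 0) + 2 * J)) {0..L}"
    by (intro has_integral_add has_integral_cos_mode has_integral_mult_right J L)
  then have "((\<lambda>a. theta s (a / L) b * cos (pi * of_int m * (a / L))) has_integral
      ((if m = 0 then L else 0) + 2 * J)) {0..L}"
    by (simp add: theta_def g_def algebra_simps)
  from integral_unique[OF this] show ?thesis
    unfolding J_eq by auto
qed

section \<open>The product kernel: identification, scaling and large times\<close>

definition neumann_kernel :: "real \<Rightarrow> real ^ 'n \<Rightarrow> real ^ 'n \<Rightarrow> real" where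
  "neumann_kernel s x y = (\<Prod>i\<in>UNIV. theta s (x $ i) (y $ i))"

lemma continuous_on_neumann_kernel:
  assumes "0 < s" "L \<noteq> 0"
  shows "continuous_on A (\<lambda>x. neumann_kernel s ((1 / L) *\<^sub>R x) y)"
  unfolding neumann_kernel_def
proof (rule continuous_on_prod)
  fix i
  show "continuous_on A (\<lambda>x. theta s (((1 / L) *\<^sub>R x) $ i) (y $ i))"
    using assms
    by (intro continuous_on_compose2[OF continuous_on_theta[of s UNIV]] continuous_intros) auto
qed

text \<open>The integrand factorises over the coordinates, so this is a product of
  \<open>theta_moment\<close>s. The power of \<open>L\<close> collected here is the normalisation
  that reappears in \<open>neumann_heat_kernel_eq\<close>.\<close>

lemma neumann_kernel_moment:
  fixes y :: "real ^ 'n"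
  assumes L: "0 < L" and s: "0 < s"
  shows "integral (closed_cube L) (\<lambda>x. neumann_kernel s ((1 / L) *\<^sub>R x) y * cosine_mode L k x) =
    L ^ CARD('n) * (exp (- (\<Sum>i\<in>UNIV. (pi * of_int (k i))\<^sup>2) * s) * cosine_mode 1 k y)"
proof -
  interpret product_sigma_finite "\<lambda>_::'n. lborel :: real measure" ..
  define f where "f i a = indicator {0..L} a * (theta s (a / L) (y $ i) * cos (pi * of_int (k i) * (a / L)))"
    for i :: 'n and a :: real
  have cf: "continuous_on {0..L} (\<lambda>a. theta s (a / L) (y $ i) * cos (pi * of_int (k i) * (a / L)))" for i
    using L by (intro continuous_intros continuous_on_compose2[OF continuous_on_theta[OF s, of UNIV]]) auto
  have intf: "integrable lborel (f i)" for i
    using borel_integrable_compact[OF _ cf[of i]] unfolding f_def by simp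
  have eqf: "(LINT a|lborel. f i a) = L * exp (- (pi * of_int (k i))\<^sup>2 * s) * cos (pi * of_int (k i) * y $ i)" for i
  proof -
    have "set_integrable lborel {0..L} (\<lambda>a. theta s (a / L) (y $ i) * cos (pi * of_int (k i) * (a / L)))"
      by (rule borel_integrable_atLeastAtMost'[OF cf])
    from set_borel_integral_eq_integral(2)[OF this] show ?thesis
      unfolding theta_moment[OF L s] by (simp add: set_lebesgue_integral_def f_def)
  qed
  let ?G = "\<lambda>x. neumann_kernel s ((1 / L) *\<^sub>R x) y * cosine_mode L k x"
  have cG: "continuous_on (closed_cube L) ?G"
    using L s by (intro continuous_on_mult continuous_on_neumann_kernel continuous_on_cosine_mode continuous_on_id) auto
  have int: "integrable lborel (\<lambda>x. indicator (closed_cube L) x *\<^sub>R ?G x)"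
    using cG by (intro borel_integrable_compact) auto
  have "integral (closed_cube L) ?G = (LINT x|lborel. indicator (closed_cube L) x *\<^sub>R ?G x)"
    using set_integral_cube_eq[OF cG] by (simp add: set_lebesgue_integral_def)
  also have "\<dots> = (LINT z|(\<Pi>\<^sub>M i\<in>UNIV. lborel). indicator (closed_cube L) (\<chi> j. z j) *\<^sub>R ?G (\<chi> j. z j))"
    using int by (subst lborel_vec) (simp add: integral_distr borel_measurable_integrable)
  also have "\<dots> = (LINT z|(\<Pi>\<^sub>M i\<in>UNIV. lborel). (\<Prod>i\<in>UNIV. f i (z i)))"
  proof (rule Bochner_Integration.integral_cong[OF refl])
    fix z :: "'n \<Rightarrow> real"
    have "indicator (closed_cube L) (\<chi> j. z j) = (\<Prod>i\<in>UNIV. indicator {0..L} (z i) :: real)"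
      by (auto simp: indicator_def mem_closed_cube)
    then show "indicator (closed_cube L) (\<chi> j. z j) *\<^sub>R ?G (\<chi> j. z j) = (\<Prod>i\<in>UNIV. f i (z i))"
      by (simp add: f_def neumann_kernel_def cosine_mode_def prod.distrib)
  qed
  also have "\<dots> = (\<Prod>i\<in>UNIV. L * exp (- (pi * of_int (k i))\<^sup>2 * s) * cos (pi * of_int (k i) * y $ i))"
    by (subst product_integral_prod) (simp_all add: intf eqf)
  also have "\<dots> = L ^ CARD('n) * (exp (- (\<Sum>i\<in>UNIV. (pi * of_int (k i))\<^sup>2) * s) * cosine_mode 1 k y)"
    by (simp add: prod.distrib exp_sum[symmetric] sum_distrib_right sum_negf[symmetric] cosine_mode_def)
  finally show ?thesis .
qed

text \<open>For fixed \<open>t\<close> and \<open>y\<close>, both sides are continuous in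
  \<open>x\<close> and have the same cosine moments. The result is Brownian scaling: kernels of all
  cubes are expressed through the single function \<open>neumann_kernel\<close>, which does not
  involve \<open>L\<close>.\<close>

theorem neumann_heat_kernel_eq:
  fixes q :: "real \<Rightarrow> real ^ 'n \<Rightarrow> real ^ 'n \<Rightarrow> real"
  assumes L: "0 < L" and K: "neumann_heat_kernel L q" and t: "0 < t"
    and x: "x \<in> closed_cube L" and y: "y \<in> closed_cube L"
  shows "q t x y = neumann_kernel (t / L\<^sup>2) ((1 / L) *\<^sub>R x) ((1 / L) *\<^sub>R y) / L ^ CARD('n)"
proof -
  let ?c = "1 / L ^ CARD('n)"
  define h where "h x = neumann_kernel (t / L\<^sup>2) ((1 / L) *\<^sub>R x) ((1 / L) *\<^sub>R y)" for x :: "real ^ 'n"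
  have ce: "continuous_on (closed_cube L) (cosine_mode L k :: real ^ 'n \<Rightarrow> real)" for k
    using L by (intro continuous_on_cosine_mode continuous_on_id) auto
  have ch: "continuous_on (closed_cube L) h"
    using L t unfolding h_def by (intro continuous_on_neumann_kernel) auto
  have cq: "continuous_on (closed_cube L) (\<lambda>x. q t x y)"
  proof -
    have "continuous_on (closed_cube L) (\<lambda>x. (t, x, y))"
      by (intro continuous_intros)
    from continuous_on_compose2[OF neumann_heat_kernelD(1)[OF K] this] show ?thesis
      using t y by auto
  qed
  have "q t x y - ?c * h x = 0"
  proof (rule cosine_moments_unique[OF L _ _ x, where w="\<lambda>x. q t x y - ?c * h x"])
    show "continuous_on (closed_cube L) (\<lambda>x. q t x y - ?c * h x)"
      by (intro continuous_on_diff continuous_on_mult continuous_on_const cq ch)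
    fix k
    let ?e = "cosine_mode L k :: real ^ 'n \<Rightarrow> real"
    have "integral (closed_cube L) (\<lambda>x. (q t x y - ?c * h x) * ?e x)
        = integral (closed_cube L) (\<lambda>x. q t x y * ?e x - ?c * (h x * ?e x))"
      by (simp add: algebra_simps)
    also have "\<dots> = integral (closed_cube L) (\<lambda>x. q t x y * ?e x) - integral (closed_cube L) (\<lambda>x. ?c * (h x * ?e x))"
      by (intro Henstock_Kurzweil_Integration.integral_diff integrable_on_closed_cube continuous_on_mult continuous_on_const cq ch ce)
    also have "integral (closed_cube L) (\<lambda>x. ?c * (h x * ?e x)) = ?c * integral (closed_cube L) (\<lambda>x. h x * ?e x)"
      by (rule Henstock_Kurzweil_Integration.integral_mult_right)
    also have "\<dots> = exp (- (\<Sum>i\<in>UNIV. (pi * of_int (k i))\<^sup>2) * (t / L\<^sup>2)) * cosine_mode 1 k ((1 / L) *\<^sub>R y)"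
      using L t unfolding h_def by (subst neumann_kernel_moment) auto
    also have "\<dots> = exp (- (\<Sum>i\<in>UNIV. (pi * of_int (k i) / L)\<^sup>2) * t) * ?e y"
      by (simp add: cosine_mode_def power_divide sum_divide_distrib[symmetric])
    finally show "integral (closed_cube L) (\<lambda>x. (q t x y - ?c * h x) * ?e x) = 0"
      by (simp add: heat_kernel_cosine_moment[OF L K t y])
  qed
  then show ?thesis by (simp add: h_def)
qed

text \<open>Every one-dimensional factor lies between \<open>1 - c s\<close> and
  \<open>1 + c s\<close> with \<open>c s\<close> tending to 0, so the product is squeezed to 1
  uniformly in both points. The uniformity in the points is what makes the resulting
  \<open>D\<close> usable for all cubes.\<close>

lemma neumann_kernel_ergodic:
  assumes "0 < \<eta>"
  shows "\<exists>D>0. \<forall>s\<ge>D. \<forall>x y :: real ^ 'n. \<bar>neumann_kernel s x y - 1\<bar> \<le> \<eta>"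
proof -
  define c where "c s = 2 * (exp (- s) / (1 - exp (- s)))" for s :: real
  have c0: "(c \<longlongrightarrow> 2 * (0 / (1 - 0))) at_top"
    unfolding c_def
    by (intro tendsto_intros filterlim_compose[OF exp_at_bot filterlim_uminus_at_bot_at_top]) auto
  have "((\<lambda>s. (1 + c s) ^ CARD('n)) \<longlongrightarrow> (1 + 0) ^ CARD('n)) at_top"
    using c0 by (intro tendsto_intros) simp
  then have e1: "eventually (\<lambda>s. (1 + c s) ^ CARD('n) < 1 + \<eta>) at_top"
    by (rule order_tendstoD) (use assms in simp)
  have "((\<lambda>s. (1 - c s) ^ CARD('n)) \<longlongrightarrow> (1 - 0) ^ CARD('n)) at_top"
    using c0 by (intro tendsto_intros) simp
  then have e2: "eventually (\<lambda>s. 1 - \<eta> < (1 - c s) ^ CARD('n)) at_top"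
    by (rule order_tendstoD) (use assms in simp)
  \<comment> \<open>Makes the lower bounds of the factors nonnegative, as monotonicity of the
    product requires.\<close>
  have e3: "eventually (\<lambda>s. c s < 1) at_top"
    using c0 by (rule order_tendstoD) simp
  have "eventually (\<lambda>s. \<forall>x y :: real ^ 'n. \<bar>neumann_kernel s x y - 1\<bar> \<le> \<eta>) at_top"
    using e1 e2 e3 eventually_gt_at_top[of 0]
  proof eventually_elim
    case (elim s)
    have th: "1 - c s \<le> theta s a b" "theta s a b \<le> 1 + c s" for a b
      using theta_minus_one_bound[OF elim(4), of a b] by (auto simp: c_def abs_le_iff)
    have "(1 - c s) ^ CARD('n) \<le> neumann_kernel s x y \<and> neumann_kernel s x y \<le> (1 + c s) ^ CARD('n)" for x y :: "real ^ 'n"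
    proof
      have "(\<Prod>i\<in>(UNIV::'n set). 1 - c s) \<le> neumann_kernel s x y"
        unfolding neumann_kernel_def using th elim(3) by (intro prod_mono) auto
      then show "(1 - c s) ^ CARD('n) \<le> neumann_kernel s x y" by simp
      have "neumann_kernel s x y \<le> (\<Prod>i\<in>(UNIV::'n set). 1 + c s)"
        unfolding neumann_kernel_def
        by (intro prod_mono conjI th order_trans[OF _ th(1)]) (use elim(3) in auto)
      then show "neumann_kernel s x y \<le> (1 + c s) ^ CARD('n)" by simp
    qed
    with elim(1,2) show ?case by (smt (verit) abs_le_iff)
  qed
  then obtain D where "\<And>s. D \<le> s \<Longrightarrow> \<forall>x y :: real ^ 'n. \<bar>neumann_kernel s x y - 1\<bar> \<le> \<eta>"
    by (auto simp: eventually_at_top_linorder)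
  then show ?thesis
    by (intro exI[of _ "max D 1"]) auto
qed

section \<open>Path spaces\<close>

definition path_space :: "real set \<Rightarrow> 'a::metric_space set \<Rightarrow> (real \<Rightarrow> 'a) set" where
  "path_space I S = {\<gamma> \<in> I \<rightarrow>\<^sub>E S. continuous_on I \<gamma>}"

lemma path_topology_eq:
  "path_topology I S = topology_generated_by
     {{\<gamma> \<in> path_space I S. \<forall>t\<in>K. dist (\<gamma> t) (\<gamma>0 t) < e} | \<gamma>0 K e.
       \<gamma>0 \<in> path_space I S \<and> compact K \<and> K \<subseteq> I \<and> e > 0}"
  by (simp add: path_topology_def path_space_def Let_def)

lemma openin_path_ball:
  assumes "\<gamma>0 \<in> path_space I S" "compact K" "K \<subseteq> I" "0 < e"
  shows "openin (path_topology I S) {\<gamma> \<in> path_space I S. \<forall>t\<in>K. dist (\<gamma> t) (\<gamma>0 t) < e}"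
  unfolding path_topology_eq using assms by (intro topology_generated_by_Basis) blast

lemma topspace_path_topology: "topspace (path_topology I S) = path_space I S"
proof -
  have "path_space I S \<subseteq> topspace (path_topology I S)"
  proof
    fix \<gamma>0 assume "\<gamma>0 \<in> path_space I S"
    then have "openin (path_topology I S) {\<gamma> \<in> path_space I S. \<forall>t\<in>{}. dist (\<gamma> t) (\<gamma>0 t) < 1}"
      by (intro openin_path_ball) auto
    then show "\<gamma>0 \<in> topspace (path_topology I S)"
      using \<open>\<gamma>0 \<in> path_space I S\<close> by (auto dest: openin_subset)
  qed
  then show ?thesis
    by (auto simp: path_topology_eq topology_generated_by_topspace)
qed

text \<open>The generating balls have arbitrary centres. A ball can be recentred at any of its
  members because the distance to the old centre attains its maximum on the compact set and thus
  stays strictly below the radius; intersections are treated by uniting the compact sets.\<close>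

lemma openin_path_topologyD:
  assumes "openin (path_topology I S) U" "\<gamma> \<in> U"
  shows "\<exists>K e. compact K \<and> K \<subseteq> I \<and> 0 < e \<and> {\<gamma>' \<in> path_space I S. \<forall>t\<in>K. dist (\<gamma>' t) (\<gamma> t) < e} \<subseteq> U"
proof -
  have "generate_topology_on {{\<gamma> \<in> path_space I S. \<forall>t\<in>K. dist (\<gamma> t) (\<gamma>0 t) < e} | \<gamma>0 K e.
       \<gamma>0 \<in> path_space I S \<and> compact K \<and> K \<subseteq> I \<and> e > 0} U"
    using assms(1) by (simp add: path_topology_eq openin_topology_generated_by_iff)
  then show ?thesis using assms(2)
  proof (induction arbitrary: \<gamma>)
    case Empty
    then show ?case by simp
  next
    case (Int a b)
    obtain K1 e1 where K1: "compact K1" "K1 \<subseteq> I" "0 < e1"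
      "{\<gamma>' \<in> path_space I S. \<forall>t\<in>K1. dist (\<gamma>' t) (\<gamma> t) < e1} \<subseteq> a"
      using Int.IH(1)[of \<gamma>] Int.prems by blast
    obtain K2 e2 where K2: "compact K2" "K2 \<subseteq> I" "0 < e2"
      "{\<gamma>' \<in> path_space I S. \<forall>t\<in>K2. dist (\<gamma>' t) (\<gamma> t) < e2} \<subseteq> b"
      using Int.IH(2)[of \<gamma>] Int.prems by blast
    have "{\<gamma>' \<in> path_space I S. \<forall>t\<in>K1 \<union> K2. dist (\<gamma>' t) (\<gamma> t) < min e1 e2} \<subseteq>
        {\<gamma>' \<in> path_space I S. \<forall>t\<in>K1. dist (\<gamma>' t) (\<gamma> t) < e1} \<inter> {\<gamma>' \<in> path_space I S. \<forall>t\<in>K2. dist (\<gamma>' t) (\<gamma> t) < e2}"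
      by auto
    also have "\<dots> \<subseteq> a \<inter> b" using K1(4) K2(4) by (rule Int_mono)
    finally show ?case
      using K1(1-3) K2(1-3) by (intro exI[of _ "K1 \<union> K2"] exI[of _ "min e1 e2"] conjI compact_Un Un_least) auto
  next
    case (UN k)
    then obtain k' where "k' \<in> k" "\<gamma> \<in> k'" by auto
    with UN(2)[of k' \<gamma>] show ?case by (meson Union_upper order_trans)
  next
    case (Basis s)
    then obtain \<gamma>0 K e where s: "s = {\<gamma> \<in> path_space I S. \<forall>t\<in>K. dist (\<gamma> t) (\<gamma>0 t) < e}"
      and *: "\<gamma>0 \<in> path_space I S" "compact K" "K \<subseteq> I" "0 < e" by auto
    show ?case
    proof (cases "K = {}")
      case True
      then show ?thesis using s by (intro exI[of _ "{}"] exI[of _ 1]) auto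
    next
      case False
      have "continuous_on K (\<lambda>t. dist (\<gamma> t) (\<gamma>0 t))"
        using Basis(2) * s by (auto simp: path_space_def intro!: continuous_on_dist elim: continuous_on_subset)
      then obtain t0 where t0: "t0 \<in> K" "\<And>t. t \<in> K \<Longrightarrow> dist (\<gamma> t) (\<gamma>0 t) \<le> dist (\<gamma> t0) (\<gamma>0 t0)"
        using continuous_attains_sup[OF *(2) False] by blast
      have lt: "dist (\<gamma> t0) (\<gamma>0 t0) < e" using Basis(2) s t0 by auto
      have "{\<gamma>' \<in> path_space I S. \<forall>t\<in>K. dist (\<gamma>' t) (\<gamma> t) < e - dist (\<gamma> t0) (\<gamma>0 t0)} \<subseteq> s"
      proof safe
        fix \<gamma>' assume a: "\<gamma>' \<in> path_space I S" "\<forall>t\<in>K. dist (\<gamma>' t) (\<gamma> t) < e - dist (\<gamma> t0) (\<gamma>0 t0)"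
        have "dist (\<gamma>' t) (\<gamma>0 t) < e" if "t \<in> K" for t
          using dist_triangle[of "\<gamma>' t" "\<gamma>0 t" "\<gamma> t"] a(2) t0(2) that by fastforce
        then show "\<gamma>' \<in> s" using a s by auto
      qed
      then show ?thesis using * lt by (intro exI[of _ K] exI[of _ "e - dist (\<gamma> t0) (\<gamma>0 t0)"]) auto
    qed
  qed
qed

text \<open>A countable exhaustion by compact sets gives countable neighbourhood bases, so openness
  can be tested on sequences. Later continuity proofs thereby become statements about sequential
  limits, where dominated convergence applies.\<close>

lemma openin_path_topology_seq:
  fixes K :: "nat \<Rightarrow> real set"
  assumes K: "\<And>m. compact (K m)" "\<And>m. K m \<subseteq> I" "incseq K"
    and ex: "\<And>K'. compact K' \<Longrightarrow> K' \<subseteq> I \<Longrightarrow> \<exists>m. K' \<subseteq> K m"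
  shows "openin (path_topology I S) U \<longleftrightarrow> U \<subseteq> path_space I S \<and>
    (\<forall>\<gamma>\<in>U. \<forall>\<gamma>s. (\<forall>n. \<gamma>s n \<in> path_space I S) \<and> (\<forall>m. uniform_limit (K m) \<gamma>s \<gamma> sequentially) \<longrightarrow>
       (\<forall>\<^sub>F n in sequentially. \<gamma>s n \<in> U))" (is "?L \<longleftrightarrow> ?R")
proof
  assume L: ?L
  show ?R
  proof (intro conjI ballI allI impI)
    show "U \<subseteq> path_space I S" using openin_subset[OF L] by (simp add: topspace_path_topology)
    fix \<gamma> \<gamma>s assume \<gamma>: "\<gamma> \<in> U"
      and *: "(\<forall>n. \<gamma>s n \<in> path_space I S) \<and> (\<forall>m. uniform_limit (K m) \<gamma>s \<gamma> sequentially)"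
    obtain K' e where K': "compact K'" "K' \<subseteq> I" "0 < e"
      "{\<gamma>' \<in> path_space I S. \<forall>t\<in>K'. dist (\<gamma>' t) (\<gamma> t) < e} \<subseteq> U"
      using openin_path_topologyD[OF L \<gamma>] by blast
    obtain m where m: "K' \<subseteq> K m" using ex K' by blast
    have "\<forall>\<^sub>F n in sequentially. \<forall>t\<in>K m. dist (\<gamma>s n t) (\<gamma> t) < e"
      using * K'(3) by (auto simp: uniform_limit_iff)
    then show "\<forall>\<^sub>F n in sequentially. \<gamma>s n \<in> U"
      by eventually_elim (rule subsetD[OF K'(4)], use m * in auto)
  qed
next
  assume R: ?R
  show ?L
  proof (subst openin_subopen, intro ballI)
    fix \<gamma> assume \<gamma>: "\<gamma> \<in> U"
    then have \<gamma>C: "\<gamma> \<in> path_space I S" using R by auto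
    have "\<exists>n. {\<gamma>' \<in> path_space I S. \<forall>t\<in>K n. dist (\<gamma>' t) (\<gamma> t) < 1 / Suc n} \<subseteq> U"
    proof (rule ccontr)
      assume "\<nexists>n. {\<gamma>' \<in> path_space I S. \<forall>t\<in>K n. dist (\<gamma>' t) (\<gamma> t) < 1 / Suc n} \<subseteq> U"
      then have "\<forall>n. \<exists>\<gamma>'. \<gamma>' \<in> path_space I S \<and> (\<forall>t\<in>K n. dist (\<gamma>' t) (\<gamma> t) < 1 / Suc n) \<and> \<gamma>' \<notin> U"
        by blast
      then obtain \<gamma>s where \<gamma>s: "\<And>n. \<gamma>s n \<in> path_space I S"
        "\<And>n t. t \<in> K n \<Longrightarrow> dist (\<gamma>s n t) (\<gamma> t) < 1 / Suc n" "\<And>n. \<gamma>s n \<notin> U"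
        by metis
      have "uniform_limit (K m) \<gamma>s \<gamma> sequentially" for m
      proof (rule uniform_limitI)
        fix e :: real assume "0 < e"
        then obtain N :: nat where N: "1 / Suc N < e"
          using nat_approx_posE by blast
        show "\<forall>\<^sub>F n in sequentially. \<forall>x\<in>K m. dist (\<gamma>s n x) (\<gamma> x) < e"
        proof (rule eventually_sequentiallyI[of "max m N"], intro ballI)
          fix n x assume n: "max m N \<le> n" and x: "x \<in> K m"
          have "x \<in> K n" using n x incseqD[OF K(3), of m n] by auto
          then have "dist (\<gamma>s n x) (\<gamma> x) < 1 / Suc n" by (rule \<gamma>s(2))
          also have "\<dots> \<le> 1 / Suc N" using n by (intro divide_left_mono) auto
          finally show "dist (\<gamma>s n x) (\<gamma> x) < e" using N by simp
        qed
      qed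
      then have "\<forall>\<^sub>F n in sequentially. \<gamma>s n \<in> U" using R \<gamma> \<gamma>s(1) by blast
      then have "\<forall>\<^sub>F n in sequentially. False" by eventually_elim (use \<gamma>s(3) in auto)
      then show False by simp
    qed
    then obtain n where n: "{\<gamma>' \<in> path_space I S. \<forall>t\<in>K n. dist (\<gamma>' t) (\<gamma> t) < 1 / Suc n} \<subseteq> U" ..
    show "\<exists>V. openin (path_topology I S) V \<and> \<gamma> \<in> V \<and> V \<subseteq> U"
      using openin_path_ball[OF \<gamma>C K(1) K(2), of "1 / Suc n" n] n \<gamma>C
      by (intro exI[of _ "{\<gamma>' \<in> path_space I S. \<forall>t\<in>K n. dist (\<gamma>' t) (\<gamma> t) < 1 / Suc n}"]) auto
  qed
qed

section \<open>Borel sigma-algebras of abstract topologies\<close>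

lemma space_borel_of [simp]: "space (borel_of X) = topspace X"
  by (simp add: borel_of_def space_measure_of_conv)

lemma sets_borel_of: "sets (borel_of X) = sigma_sets (topspace X) {U. openin X U}"
  unfolding borel_of_def by (rule sets_measure_of) (auto dest: openin_subset)

lemma openin_sets_borel_of: "openin X U \<Longrightarrow> U \<in> sets (borel_of X)"
  by (auto simp: sets_borel_of)

lemma measurable_borel_of:
  assumes "f \<in> space M \<rightarrow> topspace X" and "\<And>U. openin X U \<Longrightarrow> f -` U \<inter> space M \<in> sets M"
  shows "f \<in> M \<rightarrow>\<^sub>M borel_of X"
  by (rule measurable_sigma_sets[OF sets_borel_of]) (use assms in \<open>auto dest: openin_subset\<close>)

lemma continuous_map_measurable_borel_of:
  assumes "continuous_map X Y f"
  shows "f \<in> borel_of X \<rightarrow>\<^sub>M borel_of Y"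
proof (rule measurable_borel_of)
  show "f \<in> space (borel_of X) \<rightarrow> topspace Y"
    using assms by (auto simp: continuous_map_def)
  fix U assume "openin Y U"
  then have "openin X {x \<in> topspace X. f x \<in> U}"
    using assms by (simp add: continuous_map_def)
  moreover have "{x \<in> topspace X. f x \<in> U} = f -` U \<inter> space (borel_of X)" by auto
  ultimately show "f -` U \<inter> space (borel_of X) \<in> sets (borel_of X)"
    by (simp add: openin_sets_borel_of)
qed

lemma borel_measurable_continuous_map:
  assumes "continuous_map X euclideanreal f"
  shows "f \<in> borel_measurable (borel_of X)"
proof (rule borel_measurableI)
  fix U :: "real set" assume "open U"
  then have "openin X {x \<in> topspace X. f x \<in> U}"
    using assms by (simp add: continuous_map_def)
  moreover have "{x \<in> topspace X. f x \<in> U} = f -` U \<inter> space (borel_of X)" by auto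
  ultimately show "f -` U \<inter> space (borel_of X) \<in> sets (borel_of X)"
    by (simp add: openin_sets_borel_of)
qed

section \<open>Mark paths: sequential convergence and time shifts\<close>

abbreviation mark_paths :: "(real \<Rightarrow> real ^ 'n) set" where
  "mark_paths \<equiv> path_space UNIV (closed_cube 1)"

lemma mem_mark_paths: "\<gamma> \<in> mark_paths \<longleftrightarrow> (\<forall>t. \<gamma> t \<in> closed_cube 1) \<and> continuous_on UNIV \<gamma>"
  by (auto simp: path_space_def PiE_def)

lemma topspace_mark_path [simp]: "topspace mark_path_topology = mark_paths"
  by (simp add: mark_path_topology_def topspace_path_topology)

definition path_tendsto :: "(nat \<Rightarrow> real \<Rightarrow> 'a::metric_space) \<Rightarrow> (real \<Rightarrow> 'a) \<Rightarrow> bool" where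
  "path_tendsto \<gamma>s \<gamma> \<longleftrightarrow> (\<forall>r. uniform_limit {-r..r} \<gamma>s \<gamma> sequentially)"

lemma openin_mark_path_iff:
  fixes U :: "(real \<Rightarrow> real ^ 'n) set"
  shows "openin mark_path_topology U \<longleftrightarrow> U \<subseteq> mark_paths \<and>
    (\<forall>\<gamma>\<in>U. \<forall>\<gamma>s. (\<forall>n. \<gamma>s n \<in> mark_paths) \<and> path_tendsto \<gamma>s \<gamma> \<longrightarrow> (\<forall>\<^sub>F n in sequentially. \<gamma>s n \<in> U))"
proof -
  have ex: "\<exists>m. K' \<subseteq> {- real m..real m}" if K': "compact K'" for K' :: "real set"
  proof -
    obtain a where a: "\<forall>x\<in>K'. \<bar>x\<bar> \<le> a"
      using compact_imp_bounded[OF K'] by (auto simp: bounded_iff)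
    obtain m where "a \<le> real m" using real_arch_simple by blast
    have "K' \<subseteq> {- real m..real m}"
    proof
      fix x assume "x \<in> K'"
      with a have "\<bar>x\<bar> \<le> a" by blast
      with \<open>a \<le> real m\<close> show "x \<in> {- real m..real m}" by (simp add: abs_le_iff)
    qed
    then show ?thesis ..
  qed
  have pt: "path_tendsto \<gamma>s \<gamma> \<longleftrightarrow> (\<forall>m. uniform_limit {- real m..real m} \<gamma>s \<gamma> sequentially)"
    for \<gamma>s and \<gamma> :: "real \<Rightarrow> real ^ 'n"
    unfolding path_tendsto_def by (metis ex compact_Icc uniform_limit_on_subset)
  show ?thesis
    unfolding mark_path_topology_def pt
    by (rule openin_path_topology_seq) (auto simp: incseq_def ex)
qed

lemma continuous_map_mark_path_iff:
  fixes g :: "(real \<Rightarrow> real ^ 'n) \<Rightarrow> real"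
  shows "continuous_map mark_path_topology euclideanreal g \<longleftrightarrow>
    (\<forall>\<gamma>\<in>mark_paths. \<forall>\<gamma>s. (\<forall>n. \<gamma>s n \<in> mark_paths) \<and> path_tendsto \<gamma>s \<gamma> \<longrightarrow> (\<lambda>n. g (\<gamma>s n)) \<longlonglongrightarrow> g \<gamma>)"
    (is "?L \<longleftrightarrow> ?R")
proof
  assume L: ?L
  show ?R
  proof (intro ballI allI impI topological_tendstoI)
    fix \<gamma> :: "real \<Rightarrow> real ^ 'n" and \<gamma>s U
    assume *: "\<gamma> \<in> mark_paths" "(\<forall>n. \<gamma>s n \<in> mark_paths) \<and> path_tendsto \<gamma>s \<gamma>" "open U" "g \<gamma> \<in> U"
    have "openin mark_path_topology {x \<in> mark_paths. g x \<in> U}"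
      using L *(3) by (simp add: continuous_map_def)
    with * have "\<forall>\<^sub>F n in sequentially. \<gamma>s n \<in> {x \<in> mark_paths. g x \<in> U}"
      unfolding openin_mark_path_iff by blast
    then show "\<forall>\<^sub>F n in sequentially. g (\<gamma>s n) \<in> U" by eventually_elim simp
  qed
next
  assume R: ?R
  show ?L
    unfolding continuous_map_def
  proof (intro conjI allI impI)
    fix U :: "real set" assume "openin euclideanreal U"
    then have U: "open U" by simp
    have "openin mark_path_topology {x \<in> mark_paths. g x \<in> U}"
      unfolding openin_mark_path_iff
    proof (intro conjI ballI allI impI)
      fix \<gamma> \<gamma>s assume *: "\<gamma> \<in> {x \<in> mark_paths. g x \<in> U}" "(\<forall>n. \<gamma>s n \<in> mark_paths) \<and> path_tendsto \<gamma>s \<gamma>"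
      then have "(\<lambda>n. g (\<gamma>s n)) \<longlonglongrightarrow> g \<gamma>" using R by blast
      then have "\<forall>\<^sub>F n in sequentially. g (\<gamma>s n) \<in> U"
        using U * by (auto dest: topological_tendstoD)
      then show "\<forall>\<^sub>F n in sequentially. \<gamma>s n \<in> {x \<in> mark_paths. g x \<in> U}"
        using *(2) by (auto elim!: eventually_mono)
    qed auto
    then show "openin mark_path_topology {x \<in> topspace mark_path_topology. g x \<in> U}" by simp
  qed auto
qed

lemma continuous_map_mark_pathD:
  fixes g :: "(real \<Rightarrow> real ^ 'n) \<Rightarrow> real"
  assumes "continuous_map mark_path_topology euclideanreal g" "\<gamma> \<in> mark_paths"
    and "\<And>n. \<gamma>s n \<in> mark_paths" "path_tendsto \<gamma>s \<gamma>"
  shows "(\<lambda>n. g (\<gamma>s n)) \<longlonglongrightarrow> g \<gamma>"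
  using assms unfolding continuous_map_mark_path_iff by blast

lemma continuous_map_mark_pathI:
  fixes g :: "(real \<Rightarrow> real ^ 'n) \<Rightarrow> real"
  assumes "\<And>\<gamma> \<gamma>s. \<gamma> \<in> mark_paths \<Longrightarrow> (\<And>n. \<gamma>s n \<in> mark_paths) \<Longrightarrow> path_tendsto \<gamma>s \<gamma> \<Longrightarrow> (\<lambda>n. g (\<gamma>s n)) \<longlonglongrightarrow> g \<gamma>"
  shows "continuous_map mark_path_topology euclideanreal g"
  using assms unfolding continuous_map_mark_path_iff by blast

lemma shift_mark_paths: "\<gamma> \<in> mark_paths \<Longrightarrow> shift u \<gamma> \<in> mark_paths"
  unfolding mem_mark_paths shift_def
  by (auto intro!: continuous_on_compose2[of UNIV \<gamma>] continuous_intros)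

lemma path_tendsto_shift:
  assumes "path_tendsto \<gamma>s \<gamma>"
  shows "path_tendsto (\<lambda>n. shift u (\<gamma>s n)) (shift u \<gamma>)"
  unfolding path_tendsto_def
proof
  fix r
  have "uniform_limit {- (r + \<bar>u\<bar>)..r + \<bar>u\<bar>} \<gamma>s \<gamma> sequentially"
    using assms unfolding path_tendsto_def by blast
  then show "uniform_limit {- r..r} (\<lambda>n. shift u (\<gamma>s n)) (shift u \<gamma>) sequentially"
    unfolding shift_def by (rule uniform_limit_compose') auto
qed

lemma path_tendsto_shift_time:
  assumes \<gamma>: "continuous_on UNIV \<gamma>" and u: "us \<longlonglongrightarrow> u"
  shows "path_tendsto (\<lambda>n. shift (us n) \<gamma>) (shift u \<gamma>)"
  unfolding path_tendsto_def
proof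
  fix r
  \<comment> \<open>One unit of slack on both sides keeps \<open>us n + t\<close> inside
    \<open>?J\<close> as soon as \<open>us n\<close> is within 1 of \<open>u\<close>.\<close>
  let ?J = "{u - 1 - r..u + 1 + r}"
  have "uniformly_continuous_on ?J \<gamma>"
    using \<gamma> by (intro compact_uniformly_continuous) (auto elim: continuous_on_subset)
  show "uniform_limit {- r..r} (\<lambda>n. shift (us n) \<gamma>) (shift u \<gamma>) sequentially"
  proof (rule uniform_limitI)
    fix e :: real assume "0 < e"
    then obtain d where d: "0 < d" "\<And>x y. x \<in> ?J \<Longrightarrow> y \<in> ?J \<Longrightarrow> dist y x < d \<Longrightarrow> dist (\<gamma> y) (\<gamma> x) < e"
      using \<open>uniformly_continuous_on ?J \<gamma>\<close> unfolding uniformly_continuous_on_def by meson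
    have "\<forall>\<^sub>F n in sequentially. dist (us n) u < min d 1"
      using tendstoD[OF u, of "min d 1"] d(1) by simp
    then show "\<forall>\<^sub>F n in sequentially. \<forall>t\<in>{- r..r}. dist (shift (us n) \<gamma> t) (shift u \<gamma> t) < e"
      by eventually_elim (auto simp: shift_def dist_real_def intro!: d(2))
  qed
qed

lemma measurable_shift_time:
  fixes \<gamma> :: "real \<Rightarrow> real ^ 'n"
  assumes "\<gamma> \<in> mark_paths"
  shows "(\<lambda>u. shift u \<gamma>) \<in> borel \<rightarrow>\<^sub>M borel_of mark_path_topology"
proof (rule measurable_borel_of)
  show "(\<lambda>u. shift u \<gamma>) \<in> space borel \<rightarrow> topspace mark_path_topology"
    using shift_mark_paths[OF assms] by auto
  fix U assume U: "openin mark_path_topology (U :: (real \<Rightarrow> real ^ 'n) set)"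
  have "open ((\<lambda>u. shift u \<gamma>) -` U)"
  proof (rule ccontr)
    assume "\<not> open ((\<lambda>u. shift u \<gamma>) -` U)"
    then obtain us u where us: "us \<longlonglongrightarrow> u" "shift u \<gamma> \<in> U" "\<And>n. shift (us n) \<gamma> \<notin> U"
      by (auto simp: open_closed closed_sequential_limits)
    have "\<forall>\<^sub>F n in sequentially. shift (us n) \<gamma> \<in> U"
      using U us(2) path_tendsto_shift_time[OF _ us(1), of \<gamma>] shift_mark_paths[OF assms] assms
      unfolding openin_mark_path_iff by (auto simp: mem_mark_paths)
    then have "\<forall>\<^sub>F n in sequentially. False" by eventually_elim (use us(3) in auto)
    then show False by simp
  qed
  then show "(\<lambda>u. shift u \<gamma>) -` U \<inter> space borel \<in> sets borel" by simp
qed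

lemma continuous_map_shift:
  assumes "continuous_map mark_path_topology euclideanreal f"
  shows "continuous_map mark_path_topology euclideanreal (\<lambda>\<gamma>. f (shift u \<gamma>))"
  by (intro continuous_map_mark_pathI continuous_map_mark_pathD[OF assms] path_tendsto_shift shift_mark_paths)

text \<open>Fubini needs measurability for the product sigma-algebra, whereas joint continuity would
  speak about Borel sets of the product topology. Rounding the time down to a multiple of
  \<open>1 / Suc m\<close> leaves countably many measurable sections, and continuity of the path in
  time recovers the limit.\<close>

lemma borel_measurable_shift_pair:
  fixes f :: "(real \<Rightarrow> real ^ 'n) \<Rightarrow> real"
  assumes f: "continuous_map mark_path_topology euclideanreal f"
  shows "(\<lambda>z. f (shift (fst z) (snd z))) \<in> borel_measurable (borel \<Otimes>\<^sub>M borel_of mark_path_topology)"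
proof (rule borel_measurable_LIMSEQ_real)
  fix m :: nat
  have "(\<lambda>z. f (shift (of_int i / Suc m) (snd z))) \<in> borel_measurable (borel \<Otimes>\<^sub>M borel_of mark_path_topology)" for i :: int
    using borel_measurable_continuous_map[OF continuous_map_shift[OF f]]
    by (rule measurable_compose[OF measurable_snd])
  moreover have "(\<lambda>z. \<lfloor>real (Suc m) * fst z\<rfloor>) \<in> (borel :: real measure) \<Otimes>\<^sub>M borel_of mark_path_topology \<rightarrow>\<^sub>M count_space UNIV"
    by measurable
  ultimately show "(\<lambda>z. f (shift (real_of_int \<lfloor>real (Suc m) * fst z\<rfloor> / Suc m) (snd z))) \<in> borel_measurable (borel \<Otimes>\<^sub>M borel_of mark_path_topology)"
    by (rule measurable_compose_countable)
next
  fix z :: "real \<times> (real \<Rightarrow> real ^ 'n)"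
  assume "z \<in> space (borel \<Otimes>\<^sub>M borel_of mark_path_topology)"
  then have z: "snd z \<in> mark_paths" by (auto simp: space_pair_measure)
  have "(\<lambda>m. real_of_int \<lfloor>real (Suc m) * fst z\<rfloor> / Suc m) \<longlonglongrightarrow> fst z"
  proof (rule Lim_null_comparison[THEN LIM_zero_cancel])
    show "\<forall>\<^sub>F m in sequentially. norm (real_of_int \<lfloor>real (Suc m) * fst z\<rfloor> / Suc m - fst z) \<le> 1 / Suc m"
    proof (rule always_eventually, rule allI)
      fix m
      have "real_of_int \<lfloor>real (Suc m) * fst z\<rfloor> / Suc m - fst z = (real_of_int \<lfloor>real (Suc m) * fst z\<rfloor> - real (Suc m) * fst z) / Suc m"
        by (simp add: field_simps)
      moreover have "\<bar>real_of_int \<lfloor>real (Suc m) * fst z\<rfloor> - real (Suc m) * fst z\<bar> \<le> 1" by linarith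
      ultimately show "norm (real_of_int \<lfloor>real (Suc m) * fst z\<rfloor> / Suc m - fst z) \<le> 1 / Suc m"
        by (simp add: divide_right_mono del: of_nat_Suc)
    qed
    show "(\<lambda>m. 1 / real (Suc m)) \<longlonglongrightarrow> 0" by (rule LIMSEQ_Suc[OF lim_1_over_n])
  qed
  with z show "(\<lambda>m. f (shift (real_of_int \<lfloor>real (Suc m) * fst z\<rfloor> / Suc m) (snd z))) \<longlonglongrightarrow> f (shift (fst z) (snd z))"
    by (intro continuous_map_mark_pathD[OF f] path_tendsto_shift_time shift_mark_paths)
       (auto simp: mem_mark_paths)
qed

lemma borel_measurable_shift_time:
  fixes f :: "(real \<Rightarrow> real ^ 'n) \<Rightarrow> real"
  assumes "continuous_map mark_path_topology euclideanreal f" "\<gamma> \<in> mark_paths"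
  shows "(\<lambda>u. f (shift u \<gamma>)) \<in> borel_measurable borel"
  using measurable_compose[OF measurable_shift_time[OF assms(2)] borel_measurable_continuous_map[OF assms(1)]] .

text \<open>Since sequences decide continuity on mark paths, dominated convergence in the time
  variable is enough.\<close>

lemma continuous_map_time_integral:
  fixes f :: "(real \<Rightarrow> real ^ 'n) \<Rightarrow> real"
  assumes U: "finite_measure U" "sets U = sets borel"
    and f: "continuous_map mark_path_topology euclideanreal f"
    and b: "\<And>\<gamma>. \<gamma> \<in> mark_paths \<Longrightarrow> \<bar>f \<gamma>\<bar> \<le> M"
  shows "continuous_map mark_path_topology euclideanreal (\<lambda>\<gamma>. \<integral>u. f (shift u \<gamma>) \<partial>U)"
proof (rule continuous_map_mark_pathI)
  interpret finite_measure U by fact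
  fix \<gamma> and \<gamma>s :: "nat \<Rightarrow> real \<Rightarrow> real ^ 'n"
  assume \<gamma>: "\<gamma> \<in> mark_paths" and \<gamma>s: "\<And>n. \<gamma>s n \<in> mark_paths" and lim: "path_tendsto \<gamma>s \<gamma>"
  have m: "(\<lambda>u. f (shift u \<gamma>)) \<in> borel_measurable U" if "\<gamma> \<in> mark_paths" for \<gamma>
    using borel_measurable_shift_time[OF f that] U(2) by (simp cong: measurable_cong_sets)
  show "(\<lambda>n. \<integral>u. f (shift u (\<gamma>s n)) \<partial>U) \<longlonglongrightarrow> (\<integral>u. f (shift u \<gamma>) \<partial>U)"
  proof (rule integral_dominated_convergence[where w="\<lambda>_. M"])
    show "AE u in U. (\<lambda>n. f (shift u (\<gamma>s n))) \<longlonglongrightarrow> f (shift u \<gamma>)"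
      by (intro AE_I2 continuous_map_mark_pathD[OF f] path_tendsto_shift lim shift_mark_paths \<gamma> \<gamma>s)
    show "AE u in U. norm (f (shift u (\<gamma>s n))) \<le> M" for n
      using b[OF shift_mark_paths[OF \<gamma>s]] by simp
  qed (auto intro: m \<gamma> \<gamma>s)
qed

section \<open>Functionals of finite windows\<close>

definition window_functional :: "real set \<Rightarrow> ((real \<Rightarrow> real ^ 'n) \<Rightarrow> 'b) \<Rightarrow> bool" where
  "window_functional I G \<longleftrightarrow>
     (\<forall>\<gamma>\<in>mark_paths. \<forall>\<gamma>'\<in>mark_paths. (\<forall>t\<in>I. \<gamma> t = \<gamma>' t) \<longrightarrow> G \<gamma> = G \<gamma>')"

lemma window_functionalD:
  assumes "window_functional I G" "\<gamma> \<in> mark_paths" "\<gamma>' \<in> mark_paths" "\<And>t. t \<in> I \<Longrightarrow> \<gamma> t = \<gamma>' t"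
  shows "G \<gamma> = G \<gamma>'"
  using assms unfolding window_functional_def by blast

section \<open>Bernstein reconstruction of a path from finitely many values\<close>

definition bernstein_path :: "real \<Rightarrow> real \<Rightarrow> nat \<Rightarrow> (nat \<Rightarrow> real ^ 'n) \<Rightarrow> real \<Rightarrow> real ^ 'n" where
  "bernstein_path a b k x t = (\<Sum>i\<le>k. Bernstein k i ((max a (min b t) - a) / (b - a)) *\<^sub>R x i)"

definition node :: "real \<Rightarrow> real \<Rightarrow> nat \<Rightarrow> nat \<Rightarrow> real" where
  "node a b k i = a + real i / real k * (b - a)"

lemma clamp_unit:
  "a < b \<Longrightarrow> 0 \<le> (max a (min b t) - a) / (b - a) \<and> (max a (min b t) - a) / (b - a) \<le> (1::real)"
  by (auto simp: divide_simps)

lemma node_strict_mono: "a < b \<Longrightarrow> 0 < k \<Longrightarrow> strict_mono_on {..k} (node a b k)"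
  by (intro strict_mono_onI) (auto simp: node_def divide_simps)

lemma node_0 [simp]: "node a b k 0 = a"
  by (simp add: node_def)

lemma node_last [simp]: "0 < k \<Longrightarrow> node a b k k = b"
  by (simp add: node_def)

lemma node_mem: "a < b \<Longrightarrow> 0 < k \<Longrightarrow> i \<le> k \<Longrightarrow> node a b k i \<in> {a..b}"
proof -
  assume *: "a < b" "0 < k" "i \<le> k"
  then have "real i / real k * (b - a) \<le> 1 * (b - a)"
    by (intro mult_right_mono) auto
  moreover have "0 \<le> real i / real k * (b - a)" using * by auto
  ultimately show ?thesis by (simp add: node_def)
qed

lemma Bernstein_le_one:
  assumes "0 \<le> r" "r \<le> 1" "i \<le> k"
  shows "Bernstein k i r \<le> 1"
proof -
  have "Bernstein k i r \<le> (\<Sum>i\<le>k. Bernstein k i r)"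
    using assms by (intro member_le_sum) (auto intro: Bernstein_nonneg)
  then show ?thesis by simp
qed

text \<open>Bernstein weights are nonnegative and sum to 1, so the reconstructed path stays in the
  convex cube. This is why Bernstein polynomials are chosen here: Lagrange interpolation could leave
  the cube.\<close>

lemma bernstein_path_mark_paths:
  assumes ab: "a < b" and x: "\<And>i. i \<le> k \<Longrightarrow> x i \<in> closed_cube 1"
  shows "bernstein_path a b k x \<in> mark_paths"
  unfolding mem_mark_paths
proof (intro conjI allI)
  show "bernstein_path a b k x t \<in> closed_cube 1" for t
    unfolding bernstein_path_def using clamp_unit[OF ab, of t] x
    by (intro convex_sum) (auto intro: Bernstein_nonneg)
  show "continuous_on UNIV (bernstein_path a b k x)"
    unfolding bernstein_path_def[abs_def] Bernstein_def using ab by (intro continuous_intros) auto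
qed

lemma clamp_mark_paths:
  assumes "\<gamma> \<in> mark_paths"
  shows "(\<lambda>t. \<gamma> (max a (min b t))) \<in> mark_paths"
  using assms unfolding mem_mark_paths
  by (auto intro!: continuous_on_compose2[of UNIV \<gamma>] continuous_intros)

lemma bernstein_path_tendsto:
  fixes \<gamma> :: "real \<Rightarrow> real ^ 'n"
  assumes ab: "a < b" and \<gamma>: "\<gamma> \<in> mark_paths"
  shows "path_tendsto (\<lambda>k. bernstein_path a b (Suc k) (\<lambda>i. \<gamma> (node a b (Suc k) i))) (\<lambda>t. \<gamma> (max a (min b t)))"
  unfolding path_tendsto_def
proof (intro allI uniform_limitI)
  fix r e :: real assume e: "0 < e"
  \<comment> \<open>Accuracy per coordinate; the norm is at most the sum over the
    \<open>CARD('n)\<close> coordinates.\<close>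
  define e' where "e' = e / CARD('n)"
  have e': "0 < e'" using e by (simp add: e'_def)
  have "\<exists>N. \<forall>n x. N \<le> n \<and> x \<in> {0..1} \<longrightarrow>
      \<bar>\<gamma> (a + x * (b - a)) $ j - (\<Sum>i\<le>n. \<gamma> (a + real i / real n * (b - a)) $ j * Bernstein n i x)\<bar> < e'" for j
  proof (rule Bernstein_Weierstrass[OF _ e', where f="\<lambda>x. \<gamma> (a + x * (b - a)) $ j"])
    show "continuous_on {0..1} (\<lambda>x. \<gamma> (a + x * (b - a)) $ j)"
    proof (rule continuous_on_component)
      have 1: "continuous_on UNIV \<gamma>" using \<gamma> by (simp add: mem_mark_paths)
      have 2: "continuous_on {0..1} (\<lambda>x. a + x * (b - a))" by (intro continuous_intros)
      show "continuous_on {0..1} (\<lambda>x. \<gamma> (a + x * (b - a)))"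
        by (rule continuous_on_compose2[OF 1 2]) simp
    qed
  qed
  then have "\<forall>j. \<exists>N. \<forall>n x. N \<le> n \<and> x \<in> {0..1} \<longrightarrow>
      \<bar>\<gamma> (a + x * (b - a)) $ j - (\<Sum>i\<le>n. \<gamma> (a + real i / real n * (b - a)) $ j * Bernstein n i x)\<bar> < e'"
    by blast
  from choice[OF this] obtain N where N: "\<And>j n x. N j \<le> n \<Longrightarrow> x \<in> {0..1} \<Longrightarrow>
      \<bar>\<gamma> (a + x * (b - a)) $ j - (\<Sum>i\<le>n. \<gamma> (a + real i / real n * (b - a)) $ j * Bernstein n i x)\<bar> < e'"
    by blast
  show "\<forall>\<^sub>F k in sequentially. \<forall>t\<in>{- r..r}.
      dist (bernstein_path a b (Suc k) (\<lambda>i. \<gamma> (node a b (Suc k) i)) t) (\<gamma> (max a (min b t))) < e"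
  proof (rule eventually_sequentiallyI[of "Max (range N)"], intro ballI)
    fix k t assume k: "Max (range N) \<le> k"
    define x where "x = (max a (min b t) - a) / (b - a)"
    have x: "x \<in> {0..1}" using clamp_unit[OF ab, of t] by (simp add: x_def)
    have ax: "a + x * (b - a) = max a (min b t)" using ab by (simp add: x_def)
    let ?v = "\<gamma> (max a (min b t)) - bernstein_path a b (Suc k) (\<lambda>i. \<gamma> (node a b (Suc k) i)) t"
    have comp: "\<bar>?v $ j\<bar> < e'" for j
    proof -
      have "N j \<le> Max (range N)" by (intro Max_ge) auto
      then have "N j \<le> Suc k" using k by linarith
      from N[OF this x] show ?thesis
        unfolding ax by (simp add: bernstein_path_def node_def x_def[symmetric] mult.commute)
    qed
    have "norm ?v \<le> (\<Sum>j\<in>UNIV. \<bar>?v $ j\<bar>)" by (rule norm_le_l1_cart)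
    also have "\<dots> < (\<Sum>j\<in>(UNIV::'n set). e')" by (intro sum_strict_mono comp) auto
    also have "\<dots> = e" by (simp add: e'_def)
    finally show "dist (bernstein_path a b (Suc k) (\<lambda>i. \<gamma> (node a b (Suc k) i)) t) (\<gamma> (max a (min b t))) < e"
      by (simp add: dist_norm norm_minus_commute)
  qed
qed

text \<open>The approximants converge to the path clamped to \<open>[a, b]\<close>, not to
  \<open>\<gamma>\<close>. The two agree on the window, which is all that \<open>G\<close>
  sees.\<close>

lemma bernstein_functional_tendsto:
  fixes \<gamma> :: "real \<Rightarrow> real ^ 'n"
  assumes ab: "a < b" and G: "continuous_map mark_path_topology euclideanreal G"
    and w: "window_functional {a..b} G" and \<gamma>: "\<gamma> \<in> mark_paths"
  shows "(\<lambda>k. G (bernstein_path a b (Suc k) (\<lambda>i. \<gamma> (node a b (Suc k) i)))) \<longlonglongrightarrow> G \<gamma>"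
proof -
  have "(\<lambda>k. G (bernstein_path a b (Suc k) (\<lambda>i. \<gamma> (node a b (Suc k) i)))) \<longlonglongrightarrow> G (\<lambda>t. \<gamma> (max a (min b t)))"
    using \<gamma> by (intro continuous_map_mark_pathD[OF G] clamp_mark_paths bernstein_path_tendsto ab bernstein_path_mark_paths)
      (auto simp: mem_mark_paths)
  also have "G (\<lambda>t. \<gamma> (max a (min b t))) = G \<gamma>"
    by (rule window_functionalD[OF w clamp_mark_paths[OF \<gamma>] \<gamma>]) simp
  finally show ?thesis .
qed

abbreviation cube_measure :: "(real ^ 'n) measure" where
  "cube_measure \<equiv> restrict_space lborel (closed_cube 1)"

text \<open>The value depends continuously on the points at the nodes, for the product topology on
  all of \<open>nat \<Rightarrow> real ^ 'n\<close>. Padding the indices beyond \<open>k\<close>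
  with 0, a point of the cube, embeds the finite product there and leaves the path
  unchanged.\<close>

lemma borel_measurable_bernstein_functional:
  fixes G :: "(real \<Rightarrow> real ^ 'n) \<Rightarrow> real"
  assumes ab: "a < b" and G: "continuous_map mark_path_topology euclideanreal G"
  shows "(\<lambda>x. G (bernstein_path a b k x)) \<in> borel_measurable (\<Pi>\<^sub>M i\<in>{..k}. cube_measure)"
proof -
  let ?A = "{x :: nat \<Rightarrow> real ^ 'n. \<forall>i. x i \<in> closed_cube 1}"
  let ?E = "\<lambda>x i. if i \<le> k then x i else (0 :: real ^ 'n)"
  have "continuous_on ?A (\<lambda>x. G (bernstein_path a b k x))"
  proof (rule continuous_on_sequentiallyI)
    fix xs :: "nat \<Rightarrow> nat \<Rightarrow> real ^ 'n" and x
    assume xs: "\<forall>n. xs n \<in> ?A" and x: "x \<in> ?A" and lim: "xs \<longlonglongrightarrow> x"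
    have limi: "(\<lambda>n. xs n i) \<longlonglongrightarrow> x i" for i
    proof -
      have "continuous_on UNIV (\<lambda>x :: nat \<Rightarrow> real ^ 'n. x i)" by simp
      from continuous_on_tendsto_compose[OF this lim] show ?thesis by simp
    qed
    have "path_tendsto (\<lambda>n. bernstein_path a b k (xs n)) (bernstein_path a b k x)"
      unfolding path_tendsto_def
    proof (intro allI uniform_limitI)
      fix r e :: real assume e: "0 < e"
      have "(\<lambda>n. \<Sum>i\<le>k. norm (xs n i - x i)) \<longlonglongrightarrow> (\<Sum>i\<le>k. norm (x i - x i))"
        by (intro tendsto_intros limi)
      then have "\<forall>\<^sub>F n in sequentially. (\<Sum>i\<le>k. norm (xs n i - x i)) < e"
        using e by (intro order_tendstoD(2)[where y="\<Sum>i\<le>k. norm (x i - x i)"]) auto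
      then show "\<forall>\<^sub>F n in sequentially. \<forall>t\<in>{- r..r}. dist (bernstein_path a b k (xs n) t) (bernstein_path a b k x t) < e"
      proof eventually_elim
        case (elim n)
        show ?case
        proof
          fix t
          have "dist (bernstein_path a b k (xs n) t) (bernstein_path a b k x t) =
              norm (\<Sum>i\<le>k. Bernstein k i ((max a (min b t) - a) / (b - a)) *\<^sub>R (xs n i - x i))"
            by (simp add: dist_norm bernstein_path_def sum_subtractf[symmetric] scaleR_diff_right)
          also have "\<dots> \<le> (\<Sum>i\<le>k. norm (xs n i - x i))"
          proof (rule sum_norm_le)
            fix i assume "i \<in> {..k}"
            then have "\<bar>Bernstein k i ((max a (min b t) - a) / (b - a))\<bar> \<le> 1"
              using clamp_unit[OF ab, of t] Bernstein_le_one[of _ i k] Bernstein_nonneg by fastforce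
            then show "norm (Bernstein k i ((max a (min b t) - a) / (b - a)) *\<^sub>R (xs n i - x i)) \<le> norm (xs n i - x i)"
              by (simp add: mult_left_le_one_le)
          qed
          finally show "dist (bernstein_path a b k (xs n) t) (bernstein_path a b k x t) < e"
            using elim by simp
        qed
      qed
    qed
    then show "(\<lambda>n. G (bernstein_path a b k (xs n))) \<longlonglongrightarrow> G (bernstein_path a b k x)"
      using xs x by (intro continuous_map_mark_pathD[OF G] bernstein_path_mark_paths ab) auto
  qed
  then have 1: "(\<lambda>x. G (bernstein_path a b k x)) \<in> borel_measurable (restrict_space borel ?A)"
    by (rule borel_measurable_continuous_on_restrict)
  have z: "(0 :: real ^ 'n) \<in> closed_cube 1" by (simp add: mem_closed_cube)
  have "?E \<in> (\<Pi>\<^sub>M i\<in>{..k}. cube_measure) \<rightarrow>\<^sub>M (\<Pi>\<^sub>M i\<in>UNIV. borel)"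
  proof (rule measurable_PiM_single')
    fix i :: nat
    show "(\<lambda>x. ?E x i) \<in> (\<Pi>\<^sub>M i\<in>{..k}. cube_measure) \<rightarrow>\<^sub>M borel"
    proof (cases "i \<le> k")
      case True
      have "(\<lambda>x. x i) \<in> (\<Pi>\<^sub>M i\<in>{..k}. cube_measure) \<rightarrow>\<^sub>M cube_measure"
        using True by (intro measurable_component_singleton) auto
      then have "(\<lambda>x. x i) \<in> (\<Pi>\<^sub>M i\<in>{..k}. cube_measure) \<rightarrow>\<^sub>M borel"
        by (subst (asm) measurable_restrict_space2_iff) auto
      then show ?thesis using True by simp
    qed simp
  qed auto
  then have "?E \<in> borel_measurable (\<Pi>\<^sub>M i\<in>{..k}. cube_measure)"
    by (simp cong: measurable_cong_sets add: sets_PiM_equal_borel)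
  then have 2: "?E \<in> (\<Pi>\<^sub>M i\<in>{..k}. cube_measure) \<rightarrow>\<^sub>M restrict_space borel ?A"
    by (rule measurable_restrict_space2[rotated])
       (auto simp: space_PiM space_restrict_space PiE_def Pi_def z)
  have "bernstein_path a b k (?E x) = bernstein_path a b k x" for x
    by (intro ext) (simp add: bernstein_path_def)
  with measurable_compose[OF 2 1] show ?thesis by simp
qed

section \<open>Lipschitz envelopes that depend on a finite window\<close>

definition window_dist :: "real \<Rightarrow> (real \<Rightarrow> real ^ 'n) \<Rightarrow> (real \<Rightarrow> real ^ 'n) \<Rightarrow> real" where
  "window_dist n \<gamma> \<gamma>' = (SUP t\<in>{-n..n}. dist (\<gamma> t) (\<gamma>' t))"

lemma window_dist_bdd:
  fixes \<gamma> \<gamma>' :: "real \<Rightarrow> real ^ 'n"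
  assumes "\<gamma> \<in> mark_paths" "\<gamma>' \<in> mark_paths"
  shows "bdd_above ((\<lambda>t. dist (\<gamma> t) (\<gamma>' t)) ` A)"
proof (rule bdd_aboveI2)
  fix t
  show "dist (\<gamma> t) (\<gamma>' t) \<le> diameter (closed_cube 1 :: (real ^ 'n) set)"
    using assms by (intro diameter_bounded_bound compact_imp_bounded compact_closed_cube) (auto simp: mem_mark_paths)
qed

lemma window_dist_ge:
  assumes "\<gamma> \<in> mark_paths" "\<gamma>' \<in> mark_paths" "t \<in> {-n..n}"
  shows "dist (\<gamma> t) (\<gamma>' t) \<le> window_dist n \<gamma> \<gamma>'"
  unfolding window_dist_def using assms by (intro cSUP_upper window_dist_bdd)

lemma window_dist_le:
  assumes "0 \<le> n" "\<And>t. t \<in> {-n..n} \<Longrightarrow> dist (\<gamma> t) (\<gamma>' t) \<le> e"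
  shows "window_dist n \<gamma> \<gamma>' \<le> e"
  unfolding window_dist_def using assms by (intro cSUP_least) auto

lemma window_dist_nonneg:
  assumes "0 \<le> n" "\<gamma> \<in> mark_paths" "\<gamma>' \<in> mark_paths"
  shows "0 \<le> window_dist n \<gamma> \<gamma>'"
  by (rule order_trans[OF zero_le_dist window_dist_ge[OF assms(2,3), of 0 n]]) (use assms(1) in simp)

text \<open>The Pasch-Hausdorff envelope (inf-convolution) of \<open>f\<close> for the pseudometric
  \<open>window_dist n\<close>. The number \<open>n\<close> is both the Lipschitz constant and the
  radius of the window, so that a single parameter tending to infinity removes both
  restrictions.\<close>

definition lower_envelope :: "((real \<Rightarrow> real ^ 'n) \<Rightarrow> real) \<Rightarrow> nat \<Rightarrow> (real \<Rightarrow> real ^ 'n) \<Rightarrow> real" where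
  "lower_envelope f n \<gamma> = (INF \<gamma>'\<in>mark_paths. f \<gamma>' + real n * window_dist n \<gamma> \<gamma>')"

context
  fixes f :: "(real \<Rightarrow> real ^ 'n) \<Rightarrow> real" and M :: real
  assumes b: "\<And>\<gamma>. \<gamma> \<in> mark_paths \<Longrightarrow> \<bar>f \<gamma>\<bar> \<le> M"
begin

lemma lower_envelope_bdd:
  assumes "\<gamma> \<in> mark_paths"
  shows "bdd_below ((\<lambda>\<gamma>'. f \<gamma>' + real n * window_dist n \<gamma> \<gamma>') ` mark_paths)"
proof (rule bdd_belowI2)
  fix \<gamma>' :: "real \<Rightarrow> real ^ 'n" assume "\<gamma>' \<in> mark_paths"
  then show "- M \<le> f \<gamma>' + real n * window_dist n \<gamma> \<gamma>'"
    using b[of \<gamma>'] window_dist_nonneg[of n \<gamma> \<gamma>'] assms by (smt (verit) mult_nonneg_nonneg of_nat_0_le_iff)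
qed

lemma lower_envelope_le:
  assumes "\<gamma> \<in> mark_paths"
  shows "lower_envelope f n \<gamma> \<le> f \<gamma>"
proof -
  have "window_dist n \<gamma> \<gamma> \<le> 0" by (rule window_dist_le) auto
  then have "real n * window_dist n \<gamma> \<gamma> \<le> 0" by (simp add: mult_nonneg_nonpos)
  moreover have "lower_envelope f n \<gamma> \<le> f \<gamma> + real n * window_dist n \<gamma> \<gamma>"
    unfolding lower_envelope_def using assms by (intro cINF_lower lower_envelope_bdd)
  ultimately show ?thesis by simp
qed

lemma lower_envelope_ge:
  assumes "\<gamma> \<in> mark_paths"
  shows "- M \<le> lower_envelope f n \<gamma>"
  unfolding lower_envelope_def
proof (rule cINF_greatest)
  show "(mark_paths :: (real \<Rightarrow> real ^ 'n) set) \<noteq> {}" using assms by auto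
  fix \<gamma>' :: "real \<Rightarrow> real ^ 'n" assume "\<gamma>' \<in> mark_paths"
  then show "- M \<le> f \<gamma>' + real n * window_dist n \<gamma> \<gamma>'"
    using b[of \<gamma>'] window_dist_nonneg[of n \<gamma> \<gamma>'] assms by (smt (verit) mult_nonneg_nonneg of_nat_0_le_iff)
qed

lemma lower_envelope_abs_le: "\<gamma> \<in> mark_paths \<Longrightarrow> \<bar>lower_envelope f n \<gamma>\<bar> \<le> M"
  using lower_envelope_le[of \<gamma> n] lower_envelope_ge[of \<gamma> n] b[of \<gamma>] by linarith

lemma lower_envelope_Lipschitz:
  assumes "\<gamma>1 \<in> mark_paths" "\<gamma>2 \<in> mark_paths"
  shows "lower_envelope f n \<gamma>1 \<le> lower_envelope f n \<gamma>2 + real n * window_dist n \<gamma>1 \<gamma>2"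
proof -
  have "lower_envelope f n \<gamma>1 - real n * window_dist n \<gamma>1 \<gamma>2 \<le> lower_envelope f n \<gamma>2"
    unfolding lower_envelope_def[of f n \<gamma>2]
  proof (rule cINF_greatest)
    show "(mark_paths :: (real \<Rightarrow> real ^ 'n) set) \<noteq> {}" using assms by auto
    fix \<gamma> :: "real \<Rightarrow> real ^ 'n" assume \<gamma>: "\<gamma> \<in> mark_paths"
    have "window_dist n \<gamma>1 \<gamma> \<le> window_dist n \<gamma>1 \<gamma>2 + window_dist n \<gamma>2 \<gamma>"
    proof (rule window_dist_le)
      fix t assume t: "t \<in> {- real n..real n}"
      show "dist (\<gamma>1 t) (\<gamma> t) \<le> window_dist n \<gamma>1 \<gamma>2 + window_dist n \<gamma>2 \<gamma>"
        using window_dist_ge[OF assms t] window_dist_ge[OF assms(2) \<gamma> t] dist_triangle[of "\<gamma>1 t" "\<gamma> t" "\<gamma>2 t"]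
        by linarith
    qed simp
    then have "real n * window_dist n \<gamma>1 \<gamma> \<le> real n * (window_dist n \<gamma>1 \<gamma>2 + window_dist n \<gamma>2 \<gamma>)"
      by (intro mult_left_mono) auto
    moreover have "lower_envelope f n \<gamma>1 \<le> f \<gamma> + real n * window_dist n \<gamma>1 \<gamma>"
      unfolding lower_envelope_def using assms \<gamma> by (intro cINF_lower lower_envelope_bdd)
    ultimately show "lower_envelope f n \<gamma>1 - real n * window_dist n \<gamma>1 \<gamma>2 \<le> f \<gamma> + real n * window_dist n \<gamma>2 \<gamma>"
      by (simp add: distrib_left)
  qed
  then show ?thesis by simp
qed

lemma continuous_map_lower_envelope: "continuous_map mark_path_topology euclideanreal (lower_envelope f n)"
proof (rule continuous_map_mark_pathI)
  fix \<gamma> and \<gamma>s :: "nat \<Rightarrow> real \<Rightarrow> real ^ 'n"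
  assume \<gamma>: "\<gamma> \<in> mark_paths" and \<gamma>s: "\<And>n. \<gamma>s n \<in> mark_paths" and lim: "path_tendsto \<gamma>s \<gamma>"
  show "(\<lambda>k. lower_envelope f n (\<gamma>s k)) \<longlonglongrightarrow> lower_envelope f n \<gamma>"
  proof (rule tendstoI)
    fix e :: real assume e: "0 < e"
    define d where "d = e / (real n + 1)"
    have d: "0 < d" "real n * d < e" using e by (auto simp: d_def field_simps)
    have "\<forall>\<^sub>F k in sequentially. \<forall>t\<in>{- real n..real n}. dist (\<gamma>s k t) (\<gamma> t) < d"
      using lim d(1) unfolding path_tendsto_def uniform_limit_iff by blast
    then show "\<forall>\<^sub>F k in sequentially. dist (lower_envelope f n (\<gamma>s k)) (lower_envelope f n \<gamma>) < e"
    proof eventually_elim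
      case (elim k)
      have "window_dist n (\<gamma>s k) \<gamma> \<le> d" "window_dist n \<gamma> (\<gamma>s k) \<le> d"
        using elim by (auto intro!: window_dist_le simp: less_imp_le dist_commute)
      then have "real n * window_dist n (\<gamma>s k) \<gamma> \<le> real n * d" "real n * window_dist n \<gamma> (\<gamma>s k) \<le> real n * d"
        by (auto intro: mult_left_mono)
      with lower_envelope_Lipschitz[OF \<gamma>s[of k] \<gamma>, of n] lower_envelope_Lipschitz[OF \<gamma> \<gamma>s[of k], of n] d(2)
      show ?case by (auto simp: dist_real_def abs_less_iff)
    qed
  qed
qed

lemma window_functional_lower_envelope: "window_functional {- real n..real n} (lower_envelope f n)"
  unfolding window_functional_def
proof (intro ballI impI)
  fix \<gamma> \<gamma>' :: "real \<Rightarrow> real ^ 'n" assume *: "\<forall>t\<in>{- real n..real n}. \<gamma> t = \<gamma>' t"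
  then have "window_dist n \<gamma> = window_dist n \<gamma>'"
    unfolding window_dist_def by (intro ext) (auto intro!: SUP_cong)
  then show "lower_envelope f n \<gamma> = lower_envelope f n \<gamma>'"
    by (simp add: lower_envelope_def)
qed

text \<open>Competitors that are \<open>d\<close>-close to \<open>\<gamma>\<close> on the window are
  controlled by continuity of \<open>f\<close>; for all others the penalty \<open>n * d\<close> is
  at least \<open>2 * M\<close>, more than \<open>f\<close> can gain. \<open>N1\<close> makes the
  window cover the compact set from continuity, \<open>N2\<close> makes the penalty large
  enough.\<close>

lemma lower_envelope_tendsto:
  assumes f: "continuous_map mark_path_topology euclideanreal f" and \<gamma>: "\<gamma> \<in> mark_paths"
  shows "(\<lambda>n. lower_envelope f n \<gamma>) \<longlonglongrightarrow> f \<gamma>"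
proof (rule tendstoI)
  fix e :: real assume e: "0 < e"
  have "openin mark_path_topology {\<gamma>' \<in> topspace mark_path_topology. f \<gamma>' \<in> {f \<gamma> - e / 2<..}}"
    by (rule openin_continuous_map_preimage[OF f]) simp
  then have "openin (path_topology UNIV (closed_cube 1)) {\<gamma>' \<in> mark_paths. f \<gamma>' \<in> {f \<gamma> - e / 2<..}}"
    by (simp only: topspace_mark_path) (simp only: mark_path_topology_def)
  from openin_path_topologyD[OF this, of \<gamma>] \<gamma> e obtain K d where K: "compact K" "0 < d"
    "{\<gamma>' \<in> mark_paths. \<forall>t\<in>K. dist (\<gamma>' t) (\<gamma> t) < d} \<subseteq> {\<gamma>' \<in> mark_paths. f \<gamma>' \<in> {f \<gamma> - e / 2<..}}"
    by auto
  obtain a where a: "\<forall>x\<in>K. \<bar>x\<bar> \<le> a"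
    using compact_imp_bounded[OF K(1)] by (auto simp: bounded_iff)
  obtain N1 :: nat where N1: "a \<le> real N1" using real_arch_simple by blast
  obtain N2 :: nat where N2: "2 * M / d \<le> real N2" using real_arch_simple by blast
  show "\<forall>\<^sub>F n in sequentially. dist (lower_envelope f n \<gamma>) (f \<gamma>) < e"
  proof (rule eventually_sequentiallyI[of "max N1 N2"])
    fix n assume n: "max N1 N2 \<le> n"
    have nd: "2 * M \<le> real n * d"
    proof -
      have "2 * M \<le> real N2 * d" using N2 K(2) by (simp add: field_simps)
      also have "\<dots> \<le> real n * d" using n K(2) by (intro mult_right_mono) auto
      finally show ?thesis .
    qed
    have "f \<gamma> - e / 2 \<le> lower_envelope f n \<gamma>"
      unfolding lower_envelope_def
    proof (rule cINF_greatest)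
      show "(mark_paths :: (real \<Rightarrow> real ^ 'n) set) \<noteq> {}" using \<gamma> by auto
      fix \<gamma>' :: "real \<Rightarrow> real ^ 'n" assume \<gamma>': "\<gamma>' \<in> mark_paths"
      have nn: "0 \<le> real n * window_dist n \<gamma> \<gamma>'"
        using window_dist_nonneg[OF _ \<gamma> \<gamma>', of n] by simp
      show "f \<gamma> - e / 2 \<le> f \<gamma>' + real n * window_dist n \<gamma> \<gamma>'"
      proof (cases "window_dist n \<gamma> \<gamma>' < d")
        case True
        have "dist (\<gamma>' t) (\<gamma> t) < d" if "t \<in> K" for t
        proof -
          have "\<bar>t\<bar> \<le> real n" using a N1 n that by fastforce
          then have "dist (\<gamma> t) (\<gamma>' t) \<le> window_dist n \<gamma> \<gamma>'"
            by (intro window_dist_ge \<gamma> \<gamma>') (auto simp: abs_le_iff)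
          with True show ?thesis by (simp add: dist_commute)
        qed
        then have "f \<gamma> - e / 2 < f \<gamma>'" using K(3) \<gamma>' by auto
        with nn show ?thesis by simp
      next
        case False
        then have "real n * d \<le> real n * window_dist n \<gamma> \<gamma>'" by (intro mult_left_mono) auto
        with nd b[OF \<gamma>] b[OF \<gamma>'] e show ?thesis by linarith
      qed
    qed
    with lower_envelope_le[OF \<gamma>, of n] e show "dist (lower_envelope f n \<gamma>) (f \<gamma>) < e"
      by (simp add: dist_real_def)
  qed
qed

end

text \<open>Dominated convergence under \<open>P\<close> along the envelopes. Minorants are enough:
  a majorant of \<open>f\<close> arises by applying this to \<open>- f\<close>.\<close>

lemma envelope_integral_approx:
  fixes f :: "(real \<Rightarrow> real ^ 'n) \<Rightarrow> real"
  assumes f: "continuous_map mark_path_topology euclideanreal f"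
    and b: "\<And>\<gamma>. \<gamma> \<in> mark_paths \<Longrightarrow> \<bar>f \<gamma>\<bar> \<le> M"
    and P: "P \<in> space (prob_algebra (borel_of mark_path_topology))" and e: "0 < e"
  shows "\<exists>(n::nat) g. continuous_map mark_path_topology euclideanreal g \<and> window_functional {- real n..real n} g \<and>
    (\<forall>\<gamma>\<in>mark_paths. \<bar>g \<gamma>\<bar> \<le> M \<and> g \<gamma> \<le> f \<gamma>) \<and> (\<integral>\<gamma>. f \<gamma> \<partial>P) - (\<integral>\<gamma>. g \<gamma> \<partial>P) < e"
proof -
  interpret P: prob_space P using P by (simp add: space_prob_algebra)
  have sets: "sets P = sets (borel_of mark_path_topology)" using P by (simp add: space_prob_algebra)
  have sp: "space P = mark_paths" using sets_eq_imp_space_eq[OF sets] by simp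
  have m: "g \<in> borel_measurable P" if "continuous_map mark_path_topology euclideanreal g" for g
    using borel_measurable_continuous_map[OF that] sets by (simp cong: measurable_cong_sets)
  have "(\<lambda>n. \<integral>\<gamma>. lower_envelope f n \<gamma> \<partial>P) \<longlonglongrightarrow> (\<integral>\<gamma>. f \<gamma> \<partial>P)"
  proof (rule integral_dominated_convergence[where w="\<lambda>_. M"])
    show "f \<in> borel_measurable P" using m[OF f] .
    show "lower_envelope f n \<in> borel_measurable P" for n
      using m[OF continuous_map_lower_envelope[OF b]] .
    show "AE \<gamma> in P. (\<lambda>n. lower_envelope f n \<gamma>) \<longlonglongrightarrow> f \<gamma>"
      using lower_envelope_tendsto[OF b f] by (intro AE_I2) (simp add: sp)
    show "AE \<gamma> in P. norm (lower_envelope f n \<gamma>) \<le> M" for n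
      using lower_envelope_abs_le[OF b] by (intro AE_I2) (simp add: sp)
  qed simp
  then have "\<forall>\<^sub>F n in sequentially. (\<integral>\<gamma>. f \<gamma> \<partial>P) - e < (\<integral>\<gamma>. lower_envelope f n \<gamma> \<partial>P)"
    by (rule order_tendstoD) (use e in simp)
  then obtain n where n: "(\<integral>\<gamma>. f \<gamma> \<partial>P) - e < (\<integral>\<gamma>. lower_envelope f n \<gamma> \<partial>P)"
    by (auto simp: eventually_sequentially)
  show ?thesis
  proof (intro exI conjI ballI)
    show "continuous_map mark_path_topology euclideanreal (lower_envelope f n)"
      by (rule continuous_map_lower_envelope[OF b])
    show "window_functional {- real n..real n} (lower_envelope f n)"
      by (rule window_functional_lower_envelope[OF b])
    show "\<bar>lower_envelope f n \<gamma>\<bar> \<le> M" if "\<gamma> \<in> mark_paths" for \<gamma>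
      by (rule lower_envelope_abs_le[OF b that])
    show "lower_envelope f n \<gamma> \<le> f \<gamma>" if "\<gamma> \<in> mark_paths" for \<gamma>
      by (rule lower_envelope_le[OF b that])
    show "(\<integral>\<gamma>. f \<gamma> \<partial>P) - (\<integral>\<gamma>. lower_envelope f n \<gamma> \<partial>P) < e" using n by simp
  qed
qed

section \<open>The stationary process\<close>

lemma prob_space_cube_measure: "prob_space (cube_measure :: (real ^ 'n) measure)"
proof
  show "emeasure (cube_measure :: (real ^ 'n) measure) (space cube_measure) = 1"
    by (simp add: space_restrict_space emeasure_restrict_space emeasure_closed_cube)
qed

lemma space_cube_measure_PiM: "x \<in> space (\<Pi>\<^sub>M i\<in>I. cube_measure) \<Longrightarrow> i \<in> I \<Longrightarrow> x i \<in> closed_cube 1"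
  by (auto simp: space_PiM space_restrict_space PiE_def Pi_def)

lemma bernstein_path_restrict: "bernstein_path a b k (\<lambda>i\<in>{..k}. x i) = bernstein_path a b k x"
  by (intro ext) (simp add: bernstein_path_def)

lemma transition_product_cong:
  assumes "\<And>i. i \<le> k \<Longrightarrow> x i = y i"
  shows "transition_product q k t x = transition_product q k t y"
  unfolding transition_product_def by (intro prod.cong) (auto simp: assms)

lemma prod_lessThan_add:
  fixes f :: "nat \<Rightarrow> 'a::comm_monoid_mult"
  shows "(\<Prod>i<a + b. f i) = (\<Prod>i<a. f i) * (\<Prod>i<b. f (a + i))"
  by (induction b) (simp_all add: mult.assoc)

text \<open>Two disjoint blocks of \<open>k + 1\<close> coordinates are independent under the
  product measure: Fubini over the two index sets, then relabelling of the second block. The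
  restrictions keep the arguments extensional, as elements of \<open>PiM\<close> must be.\<close>

lemma nn_integral_two_blocks:
  fixes F G :: "(nat \<Rightarrow> real ^ 'n) \<Rightarrow> ennreal"
  assumes F: "F \<in> borel_measurable (\<Pi>\<^sub>M i\<in>{..k}. cube_measure)"
    and G: "G \<in> borel_measurable (\<Pi>\<^sub>M i\<in>{..k}. cube_measure)"
  shows "(\<lambda>x. F (\<lambda>i\<in>{..k}. x i) * G (\<lambda>i\<in>{..k}. x (Suc k + i))) \<in>
      borel_measurable (\<Pi>\<^sub>M i\<in>{..Suc k + k}. cube_measure)" (is ?m)
    and "(\<integral>\<^sup>+x. F (\<lambda>i\<in>{..k}. x i) * G (\<lambda>i\<in>{..k}. x (Suc k + i)) \<partial>(\<Pi>\<^sub>M i\<in>{..Suc k + k}. cube_measure)) =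
     (\<integral>\<^sup>+x. F x \<partial>(\<Pi>\<^sub>M i\<in>{..k}. cube_measure)) * (\<integral>\<^sup>+x. G x \<partial>(\<Pi>\<^sub>M i\<in>{..k}. cube_measure))" (is ?e)
proof -
  interpret C: prob_space "cube_measure :: (real ^ 'n) measure" by (rule prob_space_cube_measure)
  interpret product_sigma_finite "\<lambda>_::nat. cube_measure :: (real ^ 'n) measure" ..
  have r1: "(\<lambda>x. \<lambda>i\<in>{..k}. x i) \<in> (\<Pi>\<^sub>M i\<in>{..Suc k + k}. cube_measure) \<rightarrow>\<^sub>M (\<Pi>\<^sub>M i\<in>{..k}. cube_measure :: (real ^ 'n) measure)"
    by (intro measurable_restrict measurable_component_singleton) auto
  have r2: "(\<lambda>x. \<lambda>i\<in>{..k}. x (Suc k + i)) \<in> (\<Pi>\<^sub>M i\<in>{..Suc k + k}. cube_measure) \<rightarrow>\<^sub>M (\<Pi>\<^sub>M i\<in>{..k}. cube_measure :: (real ^ 'n) measure)"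
    by (intro measurable_restrict measurable_component_singleton) auto
  have r3: "(\<lambda>x. \<lambda>i\<in>{..k}. x (Suc k + i)) \<in> (\<Pi>\<^sub>M i\<in>{Suc k..Suc k + k}. cube_measure) \<rightarrow>\<^sub>M (\<Pi>\<^sub>M i\<in>{..k}. cube_measure :: (real ^ 'n) measure)"
    by (intro measurable_restrict measurable_component_singleton) auto
  show m: ?m
    using measurable_compose[OF r1 F] measurable_compose[OF r2 G] by (rule borel_measurable_times_ennreal)
  have U: "{..Suc k + k} = {..k} \<union> {Suc k..Suc k + k}" by auto
  let ?J = "\<Pi>\<^sub>M i\<in>{Suc k..Suc k + k}. cube_measure :: (real ^ 'n) measure"
  let ?I = "\<Pi>\<^sub>M i\<in>{..k}. cube_measure :: (real ^ 'n) measure"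
  have "(\<integral>\<^sup>+x. F (\<lambda>i\<in>{..k}. x i) * G (\<lambda>i\<in>{..k}. x (Suc k + i)) \<partial>(\<Pi>\<^sub>M i\<in>{..Suc k + k}. cube_measure)) =
     (\<integral>\<^sup>+x. (\<integral>\<^sup>+y. F (\<lambda>i\<in>{..k}. merge {..k} {Suc k..Suc k + k} (x, y) i) *
        G (\<lambda>i\<in>{..k}. merge {..k} {Suc k..Suc k + k} (x, y) (Suc k + i)) \<partial>?J) \<partial>?I)"
    unfolding U by (rule product_nn_integral_fold) (use m[unfolded U] in auto)
  also have "\<dots> = (\<integral>\<^sup>+x. (\<integral>\<^sup>+y. F x * G (\<lambda>i\<in>{..k}. y (Suc k + i)) \<partial>?J) \<partial>?I)"
  proof (intro nn_integral_cong)
    fix x y :: "nat \<Rightarrow> real ^ 'n" assume x: "x \<in> space ?I"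
    have "(\<lambda>i\<in>{..k}. merge {..k} {Suc k..Suc k + k} (x, y) i) = x"
      using x by (auto simp: fun_eq_iff merge_def space_PiM PiE_def extensional_def)
    moreover have "(\<lambda>i\<in>{..k}. merge {..k} {Suc k..Suc k + k} (x, y) (Suc k + i)) = (\<lambda>i\<in>{..k}. y (Suc k + i))"
      by (auto simp: fun_eq_iff merge_def)
    ultimately show "F (\<lambda>i\<in>{..k}. merge {..k} {Suc k..Suc k + k} (x, y) i) *
        G (\<lambda>i\<in>{..k}. merge {..k} {Suc k..Suc k + k} (x, y) (Suc k + i)) = F x * G (\<lambda>i\<in>{..k}. y (Suc k + i))"
      by simp
  qed
  also have "\<dots> = (\<integral>\<^sup>+x. F x * (\<integral>\<^sup>+y. G (\<lambda>i\<in>{..k}. y (Suc k + i)) \<partial>?J) \<partial>?I)"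
    using measurable_compose[OF r3 G] by (intro nn_integral_cong nn_integral_cmult)
  also have "(\<integral>\<^sup>+y. G (\<lambda>i\<in>{..k}. y (Suc k + i)) \<partial>?J) = (\<integral>\<^sup>+y. G y \<partial>distr ?J ?I (\<lambda>y. \<lambda>i\<in>{..k}. y (Suc k + i)))"
    using G r3 by (simp add: nn_integral_distr)
  also have "distr ?J ?I (\<lambda>y. \<lambda>i\<in>{..k}. y (Suc k + i)) = ?I"
    by (rule distr_PiM_reindex[where f="\<lambda>i. Suc k + i" and M="\<lambda>_. cube_measure"])
       (auto simp: prob_space_cube_measure inj_on_def)
  also have "(\<integral>\<^sup>+x. F x * (\<integral>\<^sup>+y. G y \<partial>?I) \<partial>?I) = (\<integral>\<^sup>+x. F x \<partial>?I) * (\<integral>\<^sup>+y. G y \<partial>?I)"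
    using F by (rule nn_integral_multc)
  finally show ?e .
qed

text \<open>Dominated convergence, for an arbitrary random path \<open>Z\<close> because it serves
  both the shifted stationary process and the rescaled loop. Measurability is assumed for the
  approximants; that of \<open>G (Z \<omega>)\<close> follows as a pointwise limit.\<close>

lemma integral_bernstein_tendsto:
  fixes Z :: "'a \<Rightarrow> real \<Rightarrow> real ^ 'n"
  assumes P: "prob_space P" and ab: "a < b" and G: "continuous_map mark_path_topology euclideanreal G"
    and w: "window_functional {a..b} G" and b: "\<And>\<gamma>. \<gamma> \<in> mark_paths \<Longrightarrow> \<bar>G \<gamma>\<bar> \<le> M"
    and Z: "\<And>\<omega>. \<omega> \<in> space P \<Longrightarrow> Z \<omega> \<in> mark_paths"
    and m: "\<And>k. (\<lambda>\<omega>. G (bernstein_path a b (Suc k) (\<lambda>i. Z \<omega> (node a b (Suc k) i)))) \<in> borel_measurable P"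
  shows "(\<lambda>k. \<integral>\<omega>. G (bernstein_path a b (Suc k) (\<lambda>i. Z \<omega> (node a b (Suc k) i))) \<partial>P) \<longlonglongrightarrow> (\<integral>\<omega>. G (Z \<omega>) \<partial>P)"
proof (rule integral_dominated_convergence[where w="\<lambda>_. M"])
  interpret prob_space P by fact
  have lim: "(\<lambda>k. G (bernstein_path a b (Suc k) (\<lambda>i. Z \<omega> (node a b (Suc k) i)))) \<longlonglongrightarrow> G (Z \<omega>)" if "\<omega> \<in> space P" for \<omega>
    by (rule bernstein_functional_tendsto[OF ab G w Z[OF that]])
  show "(\<lambda>\<omega>. G (Z \<omega>)) \<in> borel_measurable P"
    by (rule borel_measurable_LIMSEQ_real[OF lim m])
  show "AE \<omega> in P. (\<lambda>k. G (bernstein_path a b (Suc k) (\<lambda>i. Z \<omega> (node a b (Suc k) i)))) \<longlonglongrightarrow> G (Z \<omega>)"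
    by (intro AE_I2 lim)
  show "AE \<omega> in P. norm (G (bernstein_path a b (Suc k) (\<lambda>i. Z \<omega> (node a b (Suc k) i)))) \<le> M" for k
  proof (intro AE_I2)
    fix \<omega> assume "\<omega> \<in> space P"
    then have "bernstein_path a b (Suc k) (\<lambda>i. Z \<omega> (node a b (Suc k) i)) \<in> mark_paths"
      using Z by (intro bernstein_path_mark_paths ab) (auto simp: mem_mark_paths)
    then show "norm (G (bernstein_path a b (Suc k) (\<lambda>i. Z \<omega> (node a b (Suc k) i)))) \<le> M"
      using b by simp
  qed
  show "integrable P (\<lambda>_. M)" by simp
qed (rule m)

section \<open>Cylinder integrals and time averages\<close>

definition cylinder_density :: "(real \<Rightarrow> real ^ 'n \<Rightarrow> real ^ 'n \<Rightarrow> real) \<Rightarrow> real \<Rightarrow> real \<Rightarrow> nat \<Rightarrow> ((real \<Rightarrow> real ^ 'n) \<Rightarrow> real) \<Rightarrow> (nat \<Rightarrow> real ^ 'n) \<Rightarrow> ennreal" where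
  "cylinder_density p a b k G x =
     ennreal (transition_product p k (node a b k) x) * ennreal (G (bernstein_path a b k x))"

text \<open>The common yardstick of the two laws: for the stationary process it is the exact
  expectation of the discretised functional at every shift, and for the loop it is an upper bound up
  to a constant factor.\<close>

definition cylinder_integral :: "(real \<Rightarrow> real ^ 'n \<Rightarrow> real ^ 'n \<Rightarrow> real) \<Rightarrow> real \<Rightarrow> real \<Rightarrow> nat \<Rightarrow> ((real \<Rightarrow> real ^ 'n) \<Rightarrow> real) \<Rightarrow> ennreal" where
  "cylinder_integral p a b k G = (\<integral>\<^sup>+x. cylinder_density p a b k G x \<partial>(\<Pi>\<^sub>M i\<in>{..k}. cube_measure))"

lemma cylinder_density_restrict: "cylinder_density p a b k G (\<lambda>i\<in>{..k}. x i) = cylinder_density p a b k G x"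
  unfolding cylinder_density_def bernstein_path_restrict
  by (subst transition_product_cong[where y=x]) auto

lemma shift_bernstein: "(\<lambda>i. shift u \<gamma> (node a b k i)) = (\<lambda>i. \<gamma> (u + node a b k i))"
  by (simp add: shift_def)

definition time_average :: "real \<Rightarrow> real \<Rightarrow> ((real \<Rightarrow> real ^ 'n) \<Rightarrow> real) \<Rightarrow> (real \<Rightarrow> real ^ 'n) \<Rightarrow> real" where
  "time_average \<alpha> \<beta> G \<gamma> = (\<integral>u. G (shift u \<gamma>) \<partial>uniform_measure lborel {\<alpha>..\<beta>})"

lemma prob_space_uniform_Icc: "\<alpha> < \<beta> \<Longrightarrow> prob_space (uniform_measure lborel {\<alpha>..\<beta> :: real})"
  by (rule prob_space_uniform_measure) auto

lemma uniform_Icc_integrable: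
  assumes "\<alpha> < \<beta>" "continuous_map mark_path_topology euclideanreal G" "\<And>\<gamma>. \<gamma> \<in> mark_paths \<Longrightarrow> \<bar>G \<gamma>\<bar> \<le> M"
    and "\<gamma> \<in> mark_paths"
  shows "integrable (uniform_measure lborel {\<alpha>..\<beta>}) (\<lambda>u. G (shift u \<gamma>))"
proof -
  interpret prob_space "uniform_measure lborel {\<alpha>..\<beta>}" by (rule prob_space_uniform_Icc) fact
  show ?thesis
    using assms(3)[OF shift_mark_paths[OF assms(4)]] borel_measurable_shift_time[OF assms(2,4)]
    by (intro integrable_const_bound[where B=M] AE_I2) auto
qed

lemma continuous_map_time_average:
  assumes "\<alpha> < \<beta>" "continuous_map mark_path_topology euclideanreal G" "\<And>\<gamma>. \<gamma> \<in> mark_paths \<Longrightarrow> \<bar>G \<gamma>\<bar> \<le> M"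
  shows "continuous_map mark_path_topology euclideanreal (time_average \<alpha> \<beta> G)"
  unfolding time_average_def[abs_def]
  using prob_space_uniform_Icc[OF assms(1)] assms(2,3)
  by (intro continuous_map_time_integral[where M=M] prob_space.finite_measure) auto

lemma time_average_bounds:
  assumes "\<alpha> < \<beta>" "continuous_map mark_path_topology euclideanreal G"
    and "\<And>\<gamma>. \<gamma> \<in> mark_paths \<Longrightarrow> 0 \<le> G \<gamma> \<and> G \<gamma> \<le> M" and \<gamma>: "\<gamma> \<in> mark_paths"
  shows "0 \<le> time_average \<alpha> \<beta> G \<gamma>" and "time_average \<alpha> \<beta> G \<gamma> \<le> M"
    and "ennreal (time_average \<alpha> \<beta> G \<gamma>) = (\<integral>\<^sup>+u. ennreal (G (shift u \<gamma>)) \<partial>uniform_measure lborel {\<alpha>..\<beta>})"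
proof -
  interpret prob_space "uniform_measure lborel {\<alpha>..\<beta>}" by (rule prob_space_uniform_Icc) fact
  have b: "0 \<le> G (shift u \<gamma>) \<and> G (shift u \<gamma>) \<le> M" for u
    using assms(3) shift_mark_paths[OF \<gamma>] by blast
  have int: "integrable (uniform_measure lborel {\<alpha>..\<beta>}) (\<lambda>u. G (shift u \<gamma>))"
    by (rule uniform_Icc_integrable[OF assms(1,2) _ \<gamma>, of M]) (use assms(3) in auto)
  show "0 \<le> time_average \<alpha> \<beta> G \<gamma>"
    unfolding time_average_def using b by (intro integral_nonneg_AE AE_I2) auto
  show "time_average \<alpha> \<beta> G \<gamma> \<le> M"
    unfolding time_average_def using b by (intro integral_le_const int AE_I2) auto
  show "ennreal (time_average \<alpha> \<beta> G \<gamma>) = (\<integral>\<^sup>+u. ennreal (G (shift u \<gamma>)) \<partial>uniform_measure lborel {\<alpha>..\<beta>})"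
    unfolding time_average_def using b by (subst nn_integral_eq_integral[OF int]) auto
qed

context
  fixes p :: "real \<Rightarrow> real ^ 'n \<Rightarrow> real ^ 'n \<Rightarrow> real" and Q :: "(real \<Rightarrow> real ^ 'n) measure"
  assumes K: "neumann_heat_kernel 1 p" and Q: "two_sided_stationary_law p Q"
begin

lemma unit_kernel_eq:
  "0 < t \<Longrightarrow> x \<in> closed_cube 1 \<Longrightarrow> y \<in> closed_cube 1 \<Longrightarrow> p t x y = neumann_kernel t x y"
  using neumann_heat_kernel_eq[OF _ K, of t x y] by simp

lemma stationary_law_space:
  shows "prob_space Q" and "sets Q = sets (borel_of mark_path_topology)" and "space Q = mark_paths"
proof -
  show "prob_space Q" and s: "sets Q = sets (borel_of mark_path_topology)"
    using Q by (auto simp: two_sided_stationary_law_def space_prob_algebra)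
  show "space Q = mark_paths" using sets_eq_imp_space_eq[OF s] by simp
qed

lemma stationary_law_measurable:
  "continuous_map mark_path_topology euclideanreal g \<Longrightarrow> g \<in> borel_measurable Q"
  using borel_measurable_continuous_map stationary_law_space(2) by (simp cong: measurable_cong_sets)

lemma stationary_law_distributed:
  "strict_mono_on {..k} t \<Longrightarrow> distributed Q (\<Pi>\<^sub>M i\<in>{..k}. cube_measure) (\<lambda>\<gamma>. \<lambda>i\<in>{..k}. \<gamma> (t i))
     (\<lambda>r. ennreal (transition_product p k t r))"
  using Q by (simp add: two_sided_stationary_law_def)

lemma transition_product_nonneg:
  assumes t: "strict_mono_on {..k} t" and x: "\<And>i. i \<le> k \<Longrightarrow> x i \<in> closed_cube 1"
  shows "0 \<le> transition_product p k t x"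
  unfolding transition_product_def
proof (rule prod_nonneg)
  fix i assume "i \<in> {..<k}"
  then have "t i < t (Suc i)" using t by (intro strict_mono_onD[OF t]) auto
  then show "0 \<le> p (t (Suc i) - t i) (x i) (x (Suc i))"
    using \<open>i \<in> {..<k}\<close> x by (intro neumann_heat_kernelD(2)[OF K]) auto
qed

lemma cylinder_density_measurable:
  assumes "a < b" "0 < k" "continuous_map mark_path_topology euclideanreal G"
  shows "cylinder_density p a b k G \<in> borel_measurable (\<Pi>\<^sub>M i\<in>{..k}. cube_measure)"
proof -
  have "(\<lambda>x. ennreal (transition_product p k (node a b k) x)) \<in> borel_measurable (\<Pi>\<^sub>M i\<in>{..k}. cube_measure)"
    by (rule distributed_borel_measurable[OF stationary_law_distributed[OF node_strict_mono[OF assms(1,2)]]])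
  then show ?thesis
    unfolding cylinder_density_def[abs_def] using borel_measurable_bernstein_functional[OF assms(1,3)]
    by (intro borel_measurable_times_ennreal measurable_compose[OF borel_measurable_bernstein_functional[OF assms(1,3)] measurable_ennreal])
qed

lemma cylinder_shift:
  assumes ab: "a < b" and k: "0 < k" and G: "continuous_map mark_path_topology euclideanreal G"
  shows "(\<lambda>\<gamma>. G (bernstein_path a b k (\<lambda>i. \<gamma> (u + node a b k i)))) \<in> borel_measurable Q" (is ?m)
    and "(\<integral>\<^sup>+\<gamma>. ennreal (G (bernstein_path a b k (\<lambda>i. \<gamma> (u + node a b k i)))) \<partial>Q) = cylinder_integral p a b k G" (is ?e)
proof -
  have t: "strict_mono_on {..k} (\<lambda>i. u + node a b k i)"
    using node_strict_mono[OF ab k] by (auto simp: strict_mono_on_def)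
  note d = stationary_law_distributed[OF t]
  note mb = borel_measurable_bernstein_functional[OF ab G, of k]
  show ?m
    using measurable_compose[OF distributed_measurable[OF d] mb] by (simp add: bernstein_path_restrict)
  have "(\<lambda>x. ennreal (G (bernstein_path a b k x))) \<in> borel_measurable (\<Pi>\<^sub>M i\<in>{..k}. cube_measure)"
    using mb by simp
  \<comment> \<open>The stationary density involves only time differences, so \<open>u\<close>
    cancels when \<open>transition_product\<close> is unfolded.\<close>
  from distributed_nn_integral[OF d this] show ?e
    by (simp add: bernstein_path_restrict cylinder_integral_def cylinder_density_def transition_product_def)
qed

text \<open>The sequence on the left does not involve \<open>u\<close>. Uniqueness of limits
  therefore yields shift invariance, and the same sequence later passes the bounds for pairs of
  windows and for loops to the limit.\<close>

lemma window_cylinder_limit: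
  assumes ab: "a < b" and G: "continuous_map mark_path_topology euclideanreal G"
    and w: "window_functional {a..b} G" and b: "\<And>\<gamma>. \<gamma> \<in> mark_paths \<Longrightarrow> 0 \<le> G \<gamma> \<and> G \<gamma> \<le> M"
  shows "(\<lambda>k. cylinder_integral p a b (Suc k) G) \<longlonglongrightarrow> ennreal (\<integral>\<gamma>. G (shift u \<gamma>) \<partial>Q)"
proof -
  interpret prob_space Q by (rule stationary_law_space)
  have b': "\<bar>G \<gamma>\<bar> \<le> M" if "\<gamma> \<in> mark_paths" for \<gamma> using b[OF that] by simp
  have Z: "bernstein_path a b (Suc k) (\<lambda>i. \<gamma> (u + node a b (Suc k) i)) \<in> mark_paths" if "\<gamma> \<in> space Q" for \<gamma> k
    using that by (intro bernstein_path_mark_paths ab) (auto simp: stationary_law_space mem_mark_paths)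
  have "(\<lambda>k. \<integral>\<gamma>. G (bernstein_path a b (Suc k) (\<lambda>i. shift u \<gamma> (node a b (Suc k) i))) \<partial>Q) \<longlonglongrightarrow> (\<integral>\<gamma>. G (shift u \<gamma>) \<partial>Q)"
    by (rule integral_bernstein_tendsto[OF stationary_law_space(1) ab G w b'])
       (auto simp: stationary_law_space shift_mark_paths shift_bernstein intro!: cylinder_shift(1)[OF ab _ G])
  then have "(\<lambda>k. ennreal (\<integral>\<gamma>. G (bernstein_path a b (Suc k) (\<lambda>i. \<gamma> (u + node a b (Suc k) i))) \<partial>Q)) \<longlonglongrightarrow> ennreal (\<integral>\<gamma>. G (shift u \<gamma>) \<partial>Q)"
    unfolding shift_bernstein by (rule tendsto_ennrealI)
  moreover have "ennreal (\<integral>\<gamma>. G (bernstein_path a b (Suc k) (\<lambda>i. \<gamma> (u + node a b (Suc k) i))) \<partial>Q) = cylinder_integral p a b (Suc k) G" for k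
  proof -
    have m: "(\<lambda>\<gamma>. G (bernstein_path a b (Suc k) (\<lambda>i. \<gamma> (u + node a b (Suc k) i)))) \<in> borel_measurable Q"
      by (rule cylinder_shift(1)[OF ab _ G]) simp
    have "integrable Q (\<lambda>\<gamma>. G (bernstein_path a b (Suc k) (\<lambda>i. \<gamma> (u + node a b (Suc k) i))))"
      by (rule integrable_const_bound[where B=M]) (use b'[OF Z] m in \<open>auto intro!: AE_I2\<close>)
    from nn_integral_eq_integral[OF this] b[OF Z] show ?thesis
      by (simp add: cylinder_shift(2)[OF ab _ G])
  qed
  ultimately show ?thesis by simp
qed

section \<open>Shift invariance, mixing and the variance of time averages\<close>

lemma stationary_law_shift:
  assumes "a < b" "continuous_map mark_path_topology euclideanreal G"
    and "window_functional {a..b} G" and b: "\<And>\<gamma>. \<gamma> \<in> mark_paths \<Longrightarrow> 0 \<le> G \<gamma> \<and> G \<gamma> \<le> M"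
  shows "(\<integral>\<gamma>. G (shift u \<gamma>) \<partial>Q) = (\<integral>\<gamma>. G \<gamma> \<partial>Q)"
proof -
  have "ennreal (\<integral>\<gamma>. G (shift u \<gamma>) \<partial>Q) = ennreal (\<integral>\<gamma>. G (shift 0 \<gamma>) \<partial>Q)"
    using window_cylinder_limit[OF assms] LIMSEQ_unique by blast
  moreover have "0 \<le> (\<integral>\<gamma>. G (shift v \<gamma>) \<partial>Q)" for v
    using b shift_mark_paths by (intro integral_nonneg_AE AE_I2) (auto simp: stationary_law_space)
  ultimately have "(\<integral>\<gamma>. G (shift u \<gamma>) \<partial>Q) = (\<integral>\<gamma>. G (shift 0 \<gamma>) \<partial>Q)"
    using ennreal_inj by blast
  then show ?thesis
    by (simp add: shift_def)
qed

text \<open>Put the nodes of both windows into one time grid. The joint density is then the product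
  of the two block densities and a single factor across the gap, and this factor is at most
  \<open>1 + \<eta>\<close> because the gap lasts at least \<open>D\<close>.\<close>

lemma cylinder_pair:
  assumes ab: "a < b" and k: "0 < k" and G: "continuous_map mark_path_topology euclideanreal G"
    and \<eta>: "0 \<le> \<eta>" and D: "\<And>s x y :: real ^ 'n. D \<le> s \<Longrightarrow> neumann_kernel s x y \<le> 1 + \<eta>" "0 < D"
    and uv: "D \<le> v + a - (u + b)"
  shows "(\<integral>\<^sup>+\<gamma>. ennreal (G (bernstein_path a b k (\<lambda>i. \<gamma> (u + node a b k i)))) *
        ennreal (G (bernstein_path a b k (\<lambda>i. \<gamma> (v + node a b k i)))) \<partial>Q)
     \<le> ennreal (1 + \<eta>) * (cylinder_integral p a b k G * cylinder_integral p a b k G)"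
proof -
  let ?h = "\<lambda>x. ennreal (G (bernstein_path a b k x))"
  let ?n = "node a b k"
  \<comment> \<open>The two grids concatenated: \<open>Suc k\<close> is the index of the first node
    of the later window, so the gap lies between the indices \<open>k\<close> and
    \<open>Suc k\<close>.\<close>
  define t where "t i = (if i \<le> k then u + ?n i else v + ?n (i - Suc k))" for i
  define H where "H x = ?h (\<lambda>i\<in>{..k}. x i) * ?h (\<lambda>i\<in>{..k}. x (Suc k + i))" for x
  have ns: "strict_mono_on {..k} ?n" by (rule node_strict_mono[OF ab k])
  have t: "strict_mono_on {..Suc k + k} t"
  proof (rule strict_mono_onI)
    fix i j :: nat assume ij: "i \<in> {..Suc k + k}" "j \<in> {..Suc k + k}" "i < j"
    consider "j \<le> k" | "i \<le> k" "k < j" | "k < i" by linarith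
    then show "t i < t j"
    proof cases
      case 1
      then show ?thesis using ij strict_mono_onD[OF ns, of i j] by (simp add: t_def)
    next
      case 2
      have "?n i \<le> b" using node_mem[OF ab k 2(1)] by simp
      moreover have "a \<le> ?n (j - Suc k)" using node_mem[OF ab k, of "j - Suc k"] ij 2 by simp
      ultimately show ?thesis using 2 uv D(2) by (simp add: t_def)
    next
      case 3
      then show ?thesis using ij strict_mono_onD[OF ns, of "i - Suc k" "j - Suc k"] by (simp add: t_def)
    qed
  qed
  note d = stationary_law_distributed[OF t]
  note mb = borel_measurable_bernstein_functional[OF ab G, of k]
  have mh: "?h \<in> borel_measurable (\<Pi>\<^sub>M i\<in>{..k}. cube_measure)" using mb by simp
  have mH: "H \<in> borel_measurable (\<Pi>\<^sub>M i\<in>{..Suc k + k}. cube_measure)"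
    unfolding H_def[abs_def] by (rule nn_integral_two_blocks(1)[OF mh mh])
  let ?F = "cylinder_density p a b k G"
  have mF: "?F \<in> borel_measurable (\<Pi>\<^sub>M i\<in>{..k}. cube_measure)"
    by (rule cylinder_density_measurable[OF ab k G])
  have "H (\<lambda>i\<in>{..Suc k + k}. \<gamma> (t i)) = ?h (\<lambda>i. \<gamma> (u + ?n i)) * ?h (\<lambda>i. \<gamma> (v + ?n i))" for \<gamma>
  proof -
    have "(\<lambda>i\<in>{..k}. (\<lambda>i\<in>{..Suc k + k}. \<gamma> (t i)) i) = (\<lambda>i\<in>{..k}. \<gamma> (u + ?n i))"
      by (auto simp: fun_eq_iff t_def)
    moreover have "(\<lambda>i\<in>{..k}. (\<lambda>i\<in>{..Suc k + k}. \<gamma> (t i)) (Suc k + i)) = (\<lambda>i\<in>{..k}. \<gamma> (v + ?n i))"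
      by (auto simp: fun_eq_iff t_def)
    ultimately show ?thesis
      by (simp only: H_def bernstein_path_restrict)
  qed
  then have "(\<integral>\<^sup>+\<gamma>. ?h (\<lambda>i. \<gamma> (u + ?n i)) * ?h (\<lambda>i. \<gamma> (v + ?n i)) \<partial>Q)
      = (\<integral>\<^sup>+x. ennreal (transition_product p (Suc k + k) t x) * H x \<partial>(\<Pi>\<^sub>M i\<in>{..Suc k + k}. cube_measure))"
    using distributed_nn_integral[OF d mH] by simp
  also have "\<dots> \<le> (\<integral>\<^sup>+x. ennreal (1 + \<eta>) * (?F (\<lambda>i\<in>{..k}. x i) * ?F (\<lambda>i\<in>{..k}. x (Suc k + i)))
      \<partial>(\<Pi>\<^sub>M i\<in>{..Suc k + k}. cube_measure))"
  proof (rule nn_integral_mono)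
    fix x :: "nat \<Rightarrow> real ^ 'n" assume "x \<in> space (\<Pi>\<^sub>M i\<in>{..Suc k + k}. cube_measure)"
    then have x: "x i \<in> closed_cube 1" if "i \<le> Suc k + k" for i
      using that by (intro space_cube_measure_PiM) auto
    let ?T1 = "transition_product p k ?n x" and ?T2 = "transition_product p k ?n (\<lambda>i. x (Suc k + i))"
    let ?g = "p (v + a - (u + b)) (x k) (x (Suc k))"
    \<comment> \<open>Of the \<open>Suc k + k\<close> transition factors, \<open>k\<close> belong to
      each window and the middle one crosses the gap; both shifts cancel inside the windows.\<close>
    have T: "transition_product p (Suc k + k) t x = ?g * (?T1 * ?T2)"
    proof -
      have "transition_product p (Suc k + k) t x =
        (\<Prod>i<k. p (t (Suc i) - t i) (x i) (x (Suc i))) * p (t (Suc k) - t k) (x k) (x (Suc k)) *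
        (\<Prod>i<k. p (t (Suc (Suc k + i)) - t (Suc k + i)) (x (Suc k + i)) (x (Suc (Suc k + i))))"
        unfolding transition_product_def prod_lessThan_add by simp
      also have "(\<Prod>i<k. p (t (Suc i) - t i) (x i) (x (Suc i))) = ?T1"
        unfolding transition_product_def by (intro prod.cong) (auto simp: t_def)
      also have "(\<Prod>i<k. p (t (Suc (Suc k + i)) - t (Suc k + i)) (x (Suc k + i)) (x (Suc (Suc k + i)))) = ?T2"
        unfolding transition_product_def by (intro prod.cong) (auto simp: t_def)
      also have "t (Suc k) - t k = v + a - (u + b)" using k by (simp add: t_def)
      finally show ?thesis by (simp only: mult_ac)
    qed
    have T1: "0 \<le> ?T1" by (rule transition_product_nonneg[OF ns]) (use x in auto)
    have T2: "0 \<le> ?T2" by (rule transition_product_nonneg[OF ns]) (use x in auto)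
    have "?g \<le> 1 + \<eta>"
      using D uv x by (subst unit_kernel_eq) auto
    then have "transition_product p (Suc k + k) t x \<le> (1 + \<eta>) * (?T1 * ?T2)"
      unfolding T using T1 T2 by (intro mult_right_mono) auto
    then have "ennreal (transition_product p (Suc k + k) t x) \<le> ennreal ((1 + \<eta>) * (?T1 * ?T2))"
      by (rule ennreal_leI)
    then have "ennreal (transition_product p (Suc k + k) t x) \<le> ennreal (1 + \<eta>) * (ennreal ?T1 * ennreal ?T2)"
      using T1 T2 \<eta> by (simp add: ennreal_mult del: ennreal_plus)
    then have "ennreal (transition_product p (Suc k + k) t x) * H x \<le> ennreal (1 + \<eta>) * (ennreal ?T1 * ennreal ?T2) * H x"
      by (rule mult_right_mono) simp
    also have "\<dots> = ennreal (1 + \<eta>) * (?F (\<lambda>i\<in>{..k}. x i) * ?F (\<lambda>i\<in>{..k}. x (Suc k + i)))"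
      unfolding H_def bernstein_path_restrict cylinder_density_restrict by (simp add: cylinder_density_def mult_ac)
    finally show "ennreal (transition_product p (Suc k + k) t x) * H x \<le>
        ennreal (1 + \<eta>) * (?F (\<lambda>i\<in>{..k}. x i) * ?F (\<lambda>i\<in>{..k}. x (Suc k + i)))" .
  qed
  also have "\<dots> = ennreal (1 + \<eta>) * (cylinder_integral p a b k G * cylinder_integral p a b k G)"
    unfolding cylinder_integral_def nn_integral_two_blocks(2)[OF mF mF, symmetric]
    by (rule nn_integral_cmult[OF nn_integral_two_blocks(1)[OF mF mF]])
  finally show ?thesis .
qed

text \<open>The bound of \<open>cylinder_pair\<close> survives the limit of fine grids, since the
  products are dominated by \<open>M * M\<close>. Symmetry in \<open>u\<close> and \<open>v\<close>
  reduces to the case where the \<open>v\<close>-window comes later.\<close>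

lemma stationary_law_mixing:
  assumes ab: "a < b" and G: "continuous_map mark_path_topology euclideanreal G"
    and w: "window_functional {a..b} G" and b: "\<And>\<gamma>. \<gamma> \<in> mark_paths \<Longrightarrow> 0 \<le> G \<gamma> \<and> G \<gamma> \<le> M"
    and \<eta>: "0 \<le> \<eta>" and D: "\<And>s x y :: real ^ 'n. D \<le> s \<Longrightarrow> neumann_kernel s x y \<le> 1 + \<eta>" "0 < D"
    and uv: "D + (b - a) \<le> \<bar>v - u\<bar>"
  shows "(\<integral>\<^sup>+\<gamma>. ennreal (G (shift u \<gamma>) * G (shift v \<gamma>)) \<partial>Q) \<le> ennreal ((1 + \<eta>) * (\<integral>\<gamma>. G \<gamma> \<partial>Q)\<^sup>2)"
proof -
  interpret prob_space Q by (rule stationary_law_space)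
  have main: "(\<integral>\<^sup>+\<gamma>. ennreal (G (shift u \<gamma>) * G (shift v \<gamma>)) \<partial>Q) \<le> ennreal ((1 + \<eta>) * (\<integral>\<gamma>. G \<gamma> \<partial>Q)\<^sup>2)"
    if uv: "D \<le> v + a - (u + b)" for u v
  proof -
    let ?B = "\<lambda>k u \<gamma>. G (bernstein_path a b (Suc k) (\<lambda>i. \<gamma> (u + node a b (Suc k) i)))"
    \<comment> \<open>The zero path lies in the cube, so the bounds on \<open>G\<close> cannot be
      vacuous and force \<open>M\<close> to be nonnegative.\<close>
    have M: "0 \<le> M"
      using b[of "\<lambda>_. 0"] by (auto simp: mem_mark_paths mem_closed_cube)
    have Z: "bernstein_path a b (Suc k) (\<lambda>i. \<gamma> (u + node a b (Suc k) i)) \<in> mark_paths" if "\<gamma> \<in> space Q" for \<gamma> k u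
      using that by (intro bernstein_path_mark_paths ab) (auto simp: stationary_law_space mem_mark_paths)
    have mB: "?B k u \<in> borel_measurable Q" for k u
      by (rule cylinder_shift(1)[OF ab _ G]) simp
    have lim: "(\<lambda>k. ?B k u \<gamma>) \<longlonglongrightarrow> G (shift u \<gamma>)" if "\<gamma> \<in> space Q" for u \<gamma>
      using bernstein_functional_tendsto[OF ab G w shift_mark_paths, of \<gamma> u] that
      unfolding shift_bernstein by (simp add: stationary_law_space)
    have limB: "(\<lambda>k. \<integral>\<^sup>+\<gamma>. ennreal (?B k u \<gamma> * ?B k v \<gamma>) \<partial>Q) \<longlonglongrightarrow> (\<integral>\<^sup>+\<gamma>. ennreal (G (shift u \<gamma>) * G (shift v \<gamma>)) \<partial>Q)"
    proof (rule nn_integral_dominated_convergence[where w="\<lambda>_. ennreal (M * M)"])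
      show "(\<lambda>\<gamma>. ennreal (?B k u \<gamma> * ?B k v \<gamma>)) \<in> borel_measurable Q" for k
        using mB by measurable
      show "(\<lambda>\<gamma>. ennreal (G (shift u \<gamma>) * G (shift v \<gamma>))) \<in> borel_measurable Q"
        using stationary_law_measurable[OF continuous_map_shift[OF G]] by measurable
      show "AE \<gamma> in Q. ennreal (?B k u \<gamma> * ?B k v \<gamma>) \<le> ennreal (M * M)" for k
        using b[OF Z] M by (intro AE_I2 ennreal_leI mult_mono) auto
      show "AE \<gamma> in Q. (\<lambda>k. ennreal (?B k u \<gamma> * ?B k v \<gamma>)) \<longlonglongrightarrow> ennreal (G (shift u \<gamma>) * G (shift v \<gamma>))"
        by (intro AE_I2 tendsto_ennrealI tendsto_mult lim)
    qed (auto simp: emeasure_space_1)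
    have c0: "0 \<le> (\<integral>\<gamma>. G \<gamma> \<partial>Q)"
      using b by (intro integral_nonneg_AE AE_I2) (auto simp: stationary_law_space)
    have I: "(\<lambda>k. cylinder_integral p a b (Suc k) G) \<longlonglongrightarrow> ennreal (\<integral>\<gamma>. G \<gamma> \<partial>Q)"
      using window_cylinder_limit[OF ab G w b, of 0] by (simp add: shift_def)
    have "(\<lambda>k. ennreal (1 + \<eta>) * (cylinder_integral p a b (Suc k) G * cylinder_integral p a b (Suc k) G))
        \<longlonglongrightarrow> ennreal (1 + \<eta>) * (ennreal (\<integral>\<gamma>. G \<gamma> \<partial>Q) * ennreal (\<integral>\<gamma>. G \<gamma> \<partial>Q))"
      by (intro ennreal_tendsto_cmult tendsto_mult_ennreal I) auto
    then have "(\<integral>\<^sup>+\<gamma>. ennreal (G (shift u \<gamma>) * G (shift v \<gamma>)) \<partial>Q)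
        \<le> ennreal (1 + \<eta>) * (ennreal (\<integral>\<gamma>. G \<gamma> \<partial>Q) * ennreal (\<integral>\<gamma>. G \<gamma> \<partial>Q))"
    proof (rule LIMSEQ_le[OF limB])
      have "(\<integral>\<^sup>+\<gamma>. ennreal (?B k u \<gamma> * ?B k v \<gamma>) \<partial>Q) = (\<integral>\<^sup>+\<gamma>. ennreal (?B k u \<gamma>) * ennreal (?B k v \<gamma>) \<partial>Q)" for k
        using b[OF Z] by (intro nn_integral_cong ennreal_mult) auto
      then show "\<exists>N. \<forall>k\<ge>N. (\<integral>\<^sup>+\<gamma>. ennreal (?B k u \<gamma> * ?B k v \<gamma>) \<partial>Q) \<le>
          ennreal (1 + \<eta>) * (cylinder_integral p a b (Suc k) G * cylinder_integral p a b (Suc k) G)"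
        using cylinder_pair[OF ab _ G \<eta> D uv] by simp
    qed
    also have "\<dots> = ennreal ((1 + \<eta>) * (\<integral>\<gamma>. G \<gamma> \<partial>Q)\<^sup>2)"
      using c0 \<eta> by (simp add: ennreal_mult power2_eq_square del: ennreal_plus)
    finally show ?thesis .
  qed
  show ?thesis
  proof (cases "u \<le> v")
    case True
    then show ?thesis using uv by (intro main) auto
  next
    case False
    then show ?thesis using uv main[of u v] by (simp add: mult.commute)
  qed
qed

text \<open>Expanding the square gives a double time average of the correlation of \<open>G\<close>
  at times \<open>u\<close> and \<open>v\<close>. For given \<open>u\<close>, the times
  \<open>v\<close> within \<open>r = D + (b - a)\<close> of it form a fraction at most
  \<open>2 * r / l\<close> and cost \<open>M^2\<close> each; the others are bounded by mixing.
  Stationarity makes the mean exactly \<open>c\<close>, so subtracting \<open>c^2\<close> leaves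
  only \<open>\<eta> * c^2\<close> of the mixing term.\<close>

lemma time_average_second_moment:
  assumes ab: "a < b" and G: "continuous_map mark_path_topology euclideanreal G"
    and w: "window_functional {a..b} G" and b: "\<And>\<gamma>. \<gamma> \<in> mark_paths \<Longrightarrow> 0 \<le> G \<gamma> \<and> G \<gamma> \<le> M"
    and \<eta>: "0 \<le> \<eta>" and D: "\<And>s x y :: real ^ 'n. D \<le> s \<Longrightarrow> neumann_kernel s x y \<le> 1 + \<eta>" "0 < D"
    and \<alpha>\<beta>: "\<alpha> < \<beta>"
  shows "(\<integral>\<gamma>. (time_average \<alpha> \<beta> G \<gamma> - (\<integral>\<gamma>. G \<gamma> \<partial>Q))\<^sup>2 \<partial>Q) \<le>
    2 * (D + (b - a)) * M\<^sup>2 / (\<beta> - \<alpha>) + \<eta> * (\<integral>\<gamma>. G \<gamma> \<partial>Q)\<^sup>2"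
proof -
  let ?U = "uniform_measure lborel {\<alpha>..\<beta>}"
  interpret Q: prob_space Q by (rule stationary_law_space)
  interpret U: prob_space ?U by (rule prob_space_uniform_Icc[OF \<alpha>\<beta>])
  interpret UQ: pair_sigma_finite ?U Q ..
  define c where "c = (\<integral>\<gamma>. G \<gamma> \<partial>Q)"
  define A where "A = time_average \<alpha> \<beta> G"
  define l where "l = \<beta> - \<alpha>"
  define r where "r = D + (b - a)"
  have l: "0 < l" and r: "0 < r" using \<alpha>\<beta> D ab by (auto simp: l_def r_def)
  have b': "\<bar>G \<gamma>\<bar> \<le> M" if "\<gamma> \<in> mark_paths" for \<gamma> using b[OF that] by simp
  have M: "0 \<le> M"
    using b[of "\<lambda>_. 0"] by (auto simp: mem_mark_paths mem_closed_cube)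
  note sp = stationary_law_space(3)
  have c0: "0 \<le> c"
    unfolding c_def using b by (intro integral_nonneg_AE AE_I2) (auto simp: sp)
  have mp: "(\<lambda>z. G (shift (fst z) (snd z))) \<in> borel_measurable (?U \<Otimes>\<^sub>M Q)"
    using borel_measurable_shift_pair[OF G] stationary_law_space(2)
    by (simp cong: measurable_cong_sets sets_pair_measure_cong)
  have mA: "A \<in> borel_measurable Q"
    unfolding A_def by (rule stationary_law_measurable[OF continuous_map_time_average[OF \<alpha>\<beta> G b']])
  have mG: "(\<lambda>\<gamma>. G (shift u \<gamma>)) \<in> borel_measurable Q" for u
    by (rule stationary_law_measurable[OF continuous_map_shift[OF G]])
  have A: "0 \<le> A \<gamma>" "A \<gamma> \<le> M" "ennreal (A \<gamma>) = (\<integral>\<^sup>+u. ennreal (G (shift u \<gamma>)) \<partial>?U)" if "\<gamma> \<in> mark_paths" for \<gamma>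
    unfolding A_def using time_average_bounds[OF \<alpha>\<beta> G b that] by auto
  have intA: "integrable Q A"
    using A mA by (intro Q.integrable_const_bound[where B=M] AE_I2) (auto simp: sp)
  have A2: "(A \<gamma>)\<^sup>2 \<le> M * M" if "\<gamma> \<in> mark_paths" for \<gamma>
    using A[OF that] M by (auto simp: power2_eq_square intro: mult_mono)
  have intA2: "integrable Q (\<lambda>\<gamma>. (A \<gamma>)\<^sup>2)"
    using A2 mA by (intro Q.integrable_const_bound[where B="M * M"] AE_I2) (auto simp: sp)
  have intG: "integrable Q (\<lambda>\<gamma>. G (shift u \<gamma>))" for u
    using b'[OF shift_mark_paths] mG by (intro Q.integrable_const_bound[where B=M] AE_I2) (auto simp: sp)
  have bs: "0 \<le> G (shift u \<gamma>)" "G (shift u \<gamma>) \<le> M" if "\<gamma> \<in> mark_paths" for u \<gamma>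
    using b[OF shift_mark_paths[OF that]] by auto
  have "ennreal (\<integral>\<gamma>. A \<gamma> \<partial>Q) = (\<integral>\<^sup>+\<gamma>. ennreal (A \<gamma>) \<partial>Q)"
    using intA A(1) by (intro nn_integral_eq_integral[symmetric] AE_I2) (auto simp: sp)
  also have "\<dots> = (\<integral>\<^sup>+\<gamma>. \<integral>\<^sup>+u. ennreal (G (shift u \<gamma>)) \<partial>?U \<partial>Q)"
    by (intro nn_integral_cong) (simp add: A(3) sp)
  also have "\<dots> = (\<integral>\<^sup>+u. \<integral>\<^sup>+\<gamma>. ennreal (G (shift u \<gamma>)) \<partial>Q \<partial>?U)"
    by (rule UQ.Fubini') (use mp in \<open>simp add: case_prod_beta'\<close>)
  also have "\<dots> = (\<integral>\<^sup>+u. ennreal c \<partial>?U)"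
  proof (rule nn_integral_cong)
    fix u
    have "(\<integral>\<^sup>+\<gamma>. ennreal (G (shift u \<gamma>)) \<partial>Q) = ennreal (\<integral>\<gamma>. G (shift u \<gamma>) \<partial>Q)"
      using bs by (intro nn_integral_eq_integral intG AE_I2) (auto simp: sp)
    also have "\<dots> = ennreal c"
      unfolding c_def by (simp add: stationary_law_shift[OF ab G w b])
    finally show "(\<integral>\<^sup>+\<gamma>. ennreal (G (shift u \<gamma>)) \<partial>Q) = ennreal c" .
  qed
  also have "\<dots> = ennreal c" using U.emeasure_space_1 by simp
  finally have EA: "(\<integral>\<gamma>. A \<gamma> \<partial>Q) = c"
    using c0 A(1) by (subst (asm) ennreal_inj) (auto intro!: integral_nonneg_AE AE_I2 simp: sp)
  have "ennreal (\<integral>\<gamma>. (A \<gamma>)\<^sup>2 \<partial>Q) = (\<integral>\<^sup>+\<gamma>. ennreal ((A \<gamma>)\<^sup>2) \<partial>Q)"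
    using intA2 by (intro nn_integral_eq_integral[symmetric] AE_I2) auto
  \<comment> \<open>Only one of the two factors is unfolded here; the other stays as
    \<open>A\<close>, so that Fubini exchanges one time variable at a time.\<close>
  also have "\<dots> = (\<integral>\<^sup>+\<gamma>. \<integral>\<^sup>+u. ennreal (G (shift u \<gamma>)) * ennreal (A \<gamma>) \<partial>?U \<partial>Q)"
  proof (rule nn_integral_cong)
    fix \<gamma> assume "\<gamma> \<in> space Q"
    then have \<gamma>: "\<gamma> \<in> mark_paths" by (simp add: sp)
    have "ennreal ((A \<gamma>)\<^sup>2) = ennreal (A \<gamma>) * ennreal (A \<gamma>)"
      using A(1)[OF \<gamma>] by (simp add: power2_eq_square ennreal_mult)
    also have "\<dots> = (\<integral>\<^sup>+u. ennreal (G (shift u \<gamma>)) \<partial>?U) * ennreal (A \<gamma>)"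
      by (simp only: A(3)[OF \<gamma>])
    also have "\<dots> = (\<integral>\<^sup>+u. ennreal (G (shift u \<gamma>)) * ennreal (A \<gamma>) \<partial>?U)"
      using borel_measurable_shift_time[OF G \<gamma>] by (intro nn_integral_multc[symmetric]) simp
    finally show "ennreal ((A \<gamma>)\<^sup>2) = (\<integral>\<^sup>+u. ennreal (G (shift u \<gamma>)) * ennreal (A \<gamma>) \<partial>?U)" .
  qed
  also have "\<dots> = (\<integral>\<^sup>+u. \<integral>\<^sup>+\<gamma>. ennreal (G (shift u \<gamma>)) * ennreal (A \<gamma>) \<partial>Q \<partial>?U)"
  proof (rule UQ.Fubini')
    show "(\<lambda>(u, \<gamma>). ennreal (G (shift u \<gamma>)) * ennreal (A \<gamma>)) \<in> borel_measurable (?U \<Otimes>\<^sub>M Q)"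
      unfolding case_prod_beta'
      by (intro borel_measurable_times_ennreal measurable_compose[OF mp measurable_ennreal]
          measurable_compose[OF measurable_snd measurable_compose[OF mA measurable_ennreal]])
  qed
  also have "\<dots> \<le> (\<integral>\<^sup>+u. ennreal (M\<^sup>2 * (2 * r / l) + (1 + \<eta>) * c\<^sup>2) \<partial>?U)"
  proof (rule nn_integral_mono)
    fix u
    have "(\<integral>\<^sup>+\<gamma>. ennreal (G (shift u \<gamma>)) * ennreal (A \<gamma>) \<partial>Q) =
        (\<integral>\<^sup>+\<gamma>. \<integral>\<^sup>+v. ennreal (G (shift u \<gamma>) * G (shift v \<gamma>)) \<partial>?U \<partial>Q)"
    proof (rule nn_integral_cong)
      fix \<gamma> assume "\<gamma> \<in> space Q"
      then have \<gamma>: "\<gamma> \<in> mark_paths" by (simp add: sp)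
      have "ennreal (G (shift u \<gamma>)) * ennreal (A \<gamma>) = ennreal (G (shift u \<gamma>)) * (\<integral>\<^sup>+v. ennreal (G (shift v \<gamma>)) \<partial>?U)"
        by (simp only: A(3)[OF \<gamma>])
      also have "\<dots> = (\<integral>\<^sup>+v. ennreal (G (shift u \<gamma>)) * ennreal (G (shift v \<gamma>)) \<partial>?U)"
        using borel_measurable_shift_time[OF G \<gamma>] by (intro nn_integral_cmult[symmetric]) simp
      also have "\<dots> = (\<integral>\<^sup>+v. ennreal (G (shift u \<gamma>) * G (shift v \<gamma>)) \<partial>?U)"
        using bs[OF \<gamma>] by (simp add: ennreal_mult)
      finally show "ennreal (G (shift u \<gamma>)) * ennreal (A \<gamma>) = (\<integral>\<^sup>+v. ennreal (G (shift u \<gamma>) * G (shift v \<gamma>)) \<partial>?U)" .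
    qed
    also have "\<dots> = (\<integral>\<^sup>+v. \<integral>\<^sup>+\<gamma>. ennreal (G (shift u \<gamma>) * G (shift v \<gamma>)) \<partial>Q \<partial>?U)"
    proof (rule UQ.Fubini')
      show "(\<lambda>(v, \<gamma>). ennreal (G (shift u \<gamma>) * G (shift v \<gamma>))) \<in> borel_measurable (?U \<Otimes>\<^sub>M Q)"
        unfolding case_prod_beta'
        by (intro measurable_compose[OF _ measurable_ennreal] borel_measurable_times mp
            measurable_compose[OF measurable_snd mG])
    qed
    \<comment> \<open>Near the diagonal the trivial bound, elsewhere the mixing bound; adding both
      instead of choosing one keeps the integrand simple.\<close>
    also have "\<dots> \<le> (\<integral>\<^sup>+v. ennreal (M\<^sup>2) * indicator {u - r..u + r} v + ennreal ((1 + \<eta>) * c\<^sup>2) \<partial>?U)"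
    proof (rule nn_integral_mono)
      fix v
      show "(\<integral>\<^sup>+\<gamma>. ennreal (G (shift u \<gamma>) * G (shift v \<gamma>)) \<partial>Q) \<le>
          ennreal (M\<^sup>2) * indicator {u - r..u + r} v + ennreal ((1 + \<eta>) * c\<^sup>2)"
      proof (cases "v \<in> {u - r..u + r}")
        case True
        have "(\<integral>\<^sup>+\<gamma>. ennreal (G (shift u \<gamma>) * G (shift v \<gamma>)) \<partial>Q) \<le> (\<integral>\<^sup>+\<gamma>. ennreal (M\<^sup>2) \<partial>Q)"
          using bs M by (intro nn_integral_mono ennreal_leI) (auto simp: power2_eq_square sp intro: mult_mono)
        also have "\<dots> = ennreal (M\<^sup>2)" by (simp add: Q.emeasure_space_1)
        finally show ?thesis using True by (simp add: add_increasing2)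
      next
        case False
        then have "D + (b - a) \<le> \<bar>v - u\<bar>" by (auto simp: r_def)
        from stationary_law_mixing[OF ab G w b \<eta> D this] show ?thesis
          using False by (simp add: c_def)
      qed
    qed
    also have "\<dots> = ennreal (M\<^sup>2) * emeasure ?U {u - r..u + r} + ennreal ((1 + \<eta>) * c\<^sup>2)"
      using U.emeasure_space_1 by (subst nn_integral_add) (auto simp: nn_integral_cmult_indicator)
    also have "\<dots> \<le> ennreal (M\<^sup>2) * ennreal (2 * r / l) + ennreal ((1 + \<eta>) * c\<^sup>2)"
    proof (intro add_right_mono mult_left_mono)
      have "emeasure ?U {u - r..u + r} = emeasure lborel ({\<alpha>..\<beta>} \<inter> {u - r..u + r}) / ennreal l"
        using \<alpha>\<beta> by (simp add: l_def)
      also have "\<dots> \<le> emeasure lborel {u - r..u + r} / ennreal l"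
        by (intro divide_right_mono_ennreal emeasure_mono) auto
      also have "\<dots> = ennreal (2 * r / l)"
        using r l by (simp add: divide_ennreal)
      finally show "emeasure ?U {u - r..u + r} \<le> ennreal (2 * r / l)" .
    qed simp
    also have "\<dots> = ennreal (M\<^sup>2 * (2 * r / l) + (1 + \<eta>) * c\<^sup>2)"
      using r l \<eta> by (simp only: ennreal_mult[symmetric] ennreal_plus[symmetric] zero_le_power2 mult_nonneg_nonneg
          divide_nonneg_nonneg add_nonneg_nonneg zero_le_one less_imp_le zero_le_numeral)
    finally show "(\<integral>\<^sup>+\<gamma>. ennreal (G (shift u \<gamma>)) * ennreal (A \<gamma>) \<partial>Q) \<le> ennreal (M\<^sup>2 * (2 * r / l) + (1 + \<eta>) * c\<^sup>2)" .
  qed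
  also have "\<dots> = ennreal (M\<^sup>2 * (2 * r / l) + (1 + \<eta>) * c\<^sup>2)" using U.emeasure_space_1 by simp
  finally have "(\<integral>\<gamma>. (A \<gamma>)\<^sup>2 \<partial>Q) \<le> M\<^sup>2 * (2 * r / l) + (1 + \<eta>) * c\<^sup>2"
    using r l \<eta> by (subst (asm) ennreal_le_iff) auto
  \<comment> \<open>The cross term becomes \<open>- 2 * c^2\<close> because the mean of
    \<open>A\<close> is exactly \<open>c\<close>.\<close>
  moreover have "(\<integral>\<gamma>. (A \<gamma> - c)\<^sup>2 \<partial>Q) = (\<integral>\<gamma>. (A \<gamma>)\<^sup>2 \<partial>Q) - c\<^sup>2"
  proof -
    have "(\<integral>\<gamma>. (A \<gamma> - c)\<^sup>2 \<partial>Q) = (\<integral>\<gamma>. (A \<gamma>)\<^sup>2 - 2 * c * A \<gamma> + c\<^sup>2 \<partial>Q)"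
      by (simp add: power2_diff algebra_simps)
    also have "\<dots> = (\<integral>\<gamma>. (A \<gamma>)\<^sup>2 \<partial>Q) - 2 * c * (\<integral>\<gamma>. A \<gamma> \<partial>Q) + c\<^sup>2"
      using intA intA2 by (simp add: Q.prob_space)
    finally show ?thesis by (simp add: EA power2_eq_square)
  qed
  ultimately show ?thesis
    by (simp add: A_def[symmetric] c_def[symmetric] l_def r_def algebra_simps)
qed

end

section \<open>Rescaled loops\<close>

abbreviation loop_paths :: "real \<Rightarrow> real \<Rightarrow> (real \<Rightarrow> real ^ 'n) set" where
  "loop_paths L T \<equiv> path_space {0..T} (closed_cube L) \<inter> {\<omega>. \<omega> 0 = \<omega> T}"

lemma topspace_loop_topology [simp]: "topspace (loop_topology L T) = loop_paths L T"
  by (simp add: loop_topology_def topspace_path_topology)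

lemma rescaled_loop_eq:
  assumes "0 < L" "s \<in> {0..<T / L\<^sup>2}"
  shows "rescaled_loop L T \<omega> s = (1 / L) *\<^sub>R \<omega> (L\<^sup>2 * s)"
proof -
  have "s rmod (T / L\<^sup>2) = s" 
    using assms abs_ge_self[of "T / L\<^sup>2"] by (intro rmod_idem) (auto simp del: abs_divide)
  then show ?thesis by (simp add: rescaled_loop_def)
qed

lemma scaled_rmod_mem:
  assumes "0 < L" "0 < T"
  shows "L\<^sup>2 * (s rmod (T / L\<^sup>2)) \<in> {0..T}"
proof -
  have 1: "0 < T / L\<^sup>2" using assms by simp
  have "0 \<le> s rmod (T / L\<^sup>2)" using 1 by (intro rmod_nonneg) auto
  moreover have "s rmod (T / L\<^sup>2) \<le> T / L\<^sup>2" using 1 by (rule rmod_le)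
  then have "L\<^sup>2 * (s rmod (T / L\<^sup>2)) \<le> L\<^sup>2 * (T / L\<^sup>2)" by (intro mult_left_mono) auto
  ultimately show ?thesis using assms by simp
qed

text \<open>On each closed period the periodic extension is given by a continuous formula, the loop
  condition making it valid at the right end as well. Any time is interior to the union of two
  adjacent periods, which turns this into continuity on the line.\<close>

lemma rescaled_loop_mark_paths:
  fixes \<omega> :: "real \<Rightarrow> real ^ 'n"
  assumes L: "0 < L" and T: "0 < T" and \<omega>: "\<omega> \<in> loop_paths L T"
  shows "rescaled_loop L T \<omega> \<in> mark_paths"
  unfolding mem_mark_paths
proof (intro conjI allI)
  let ?S = "T / L\<^sup>2"
  have S: "0 < ?S" using L T by simp
  have \<omega>c: "continuous_on {0..T} \<omega>" and \<omega>m: "\<And>t. t \<in> {0..T} \<Longrightarrow> \<omega> t \<in> closed_cube L" and eq: "\<omega> 0 = \<omega> T"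
    using \<omega> by (auto simp: path_space_def)
  show "rescaled_loop L T \<omega> t \<in> closed_cube 1" for t
    using \<omega>m[OF scaled_rmod_mem[OF L T, of t]] L
    by (auto simp: rescaled_loop_def mem_closed_cube field_simps)
  have piece: "continuous_on {of_int k * ?S..of_int (k + 1) * ?S} (rescaled_loop L T \<omega>)" for k
  proof -
    let ?I = "{of_int k * ?S..of_int (k + 1) * ?S}"
    have "continuous_on ?I (\<lambda>s. (1 / L) *\<^sub>R \<omega> (L\<^sup>2 * (s - of_int k * ?S)))"
    proof (intro continuous_on_scaleR continuous_on_const continuous_on_compose2[OF \<omega>c])
      show "(\<lambda>s. L\<^sup>2 * (s - of_int k * ?S)) ` ?I \<subseteq> {0..T}"
      proof (rule image_subsetI)
        fix s assume "s \<in> ?I"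
        then have h: "0 \<le> s - of_int k * ?S" "s - of_int k * ?S \<le> ?S"
          by (simp_all add: algebra_simps add_divide_distrib)
        have "L\<^sup>2 * ?S = T" using L by simp
        then show "L\<^sup>2 * (s - of_int k * ?S) \<in> {0..T}"
          using mult_nonneg_nonneg[OF zero_le_power2 h(1), of L] mult_left_mono[OF h(2) zero_le_power2, of L]
          by (simp only: atLeastAtMost_iff)
      qed
    qed (intro continuous_intros)
    also have "?this \<longleftrightarrow> continuous_on ?I (rescaled_loop L T \<omega>)"
    proof (intro continuous_on_cong refl)
      fix s assume s: "s \<in> ?I"
      show "(1 / L) *\<^sub>R \<omega> (L\<^sup>2 * (s - of_int k * ?S)) = rescaled_loop L T \<omega> s"
      \<comment> \<open>At the right end \<open>rmod\<close> has already jumped to 0 while the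
        formula still evaluates the loop at \<open>T\<close>; the equality \<open>eq\<close> of the
        two loop values closes the gap.\<close>
      proof (cases "s = of_int (k + 1) * ?S")
        case True
        then have "s rmod ?S = 0" by (simp only: rmod_self_multiple_int)
        moreover have "s - of_int k * ?S = ?S"
          unfolding True of_int_add of_int_1 distrib_right by simp
        then have "L\<^sup>2 * (s - of_int k * ?S) = T" using L by simp
        ultimately show ?thesis by (simp add: rescaled_loop_def eq)
      next
        case False
        have e: "of_int (k + 1) * ?S = of_int k * ?S + ?S"
          by (simp only: of_int_add of_int_1 distrib_right mult_1_left)
        have "of_int k * ?S \<le> s" "s < of_int (k + 1) * ?S"
          using s False unfolding atLeastAtMost_iff less_le by blast+
        then have "0 \<le> s - of_int k * ?S" "s - of_int k * ?S < ?S"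
          unfolding e by linarith+
        then have "s - of_int k * ?S \<in> {0..<\<bar>?S\<bar>}"
          unfolding abs_of_pos[OF S] atLeastLessThan_iff by blast
        then have "s rmod ?S = s - of_int k * ?S"
          by (rule rmod_unique[where n=k]) simp
        then show ?thesis by (simp add: rescaled_loop_def)
      qed
    qed
    finally show ?thesis .
  qed
  show "continuous_on UNIV (rescaled_loop L T \<omega>)"
  proof (rule continuous_at_imp_continuous_on, rule ballI)
    fix s :: real
    define k where "k = \<lfloor>s / ?S\<rfloor>"
    have "of_int k \<le> s / ?S" unfolding k_def by (rule of_int_floor_le)
    then have k1: "of_int k * ?S \<le> s" by (rule pos_le_divide_eq[OF S, THEN iffD1])
    have "s / ?S < of_int (k + 1)" unfolding k_def by linarith
    then have k2: "s < of_int (k + 1) * ?S" by (rule pos_divide_less_eq[OF S, THEN iffD1])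
    note k = k1 k2
    \<comment> \<open>\<open>s\<close> may be the left end of its own period, hence the preceding
      period is included.\<close>
    have "continuous_on ({of_int (k - 1) * ?S..of_int k * ?S} \<union> {of_int k * ?S..of_int (k + 1) * ?S}) (rescaled_loop L T \<omega>)"
      using piece[of "k - 1"] piece[of k] by (intro continuous_on_closed_Un) auto
    then have "continuous_on {of_int (k - 1) * ?S<..<of_int (k + 1) * ?S} (rescaled_loop L T \<omega>)"
      by (rule continuous_on_subset) auto
    moreover have "s \<in> {of_int (k - 1) * ?S<..<of_int (k + 1) * ?S}"
    proof -
      have "of_int (k - 1) * ?S < of_int k * ?S" using S by (intro mult_strict_right_mono) auto
      then show ?thesis using k unfolding greaterThanLessThan_iff by linarith
    qed
    ultimately show "isCont (rescaled_loop L T \<omega>) s"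
      by (simp add: continuous_on_eq_continuous_at)
  qed
qed

lemma path_tendsto_rescaled_loop:
  fixes \<omega> :: "real \<Rightarrow> real ^ 'n"
  assumes L: "0 < L" and T: "0 < T" and u: "uniform_limit {0..T} \<omega>s \<omega> sequentially"
  shows "path_tendsto (\<lambda>n. rescaled_loop L T (\<omega>s n)) (rescaled_loop L T \<omega>)"
  unfolding path_tendsto_def rescaled_loop_def
proof
  fix r
  have "uniform_limit {- r..r} (\<lambda>n s. \<omega>s n (L\<^sup>2 * (s rmod (T / L\<^sup>2)))) (\<lambda>s. \<omega> (L\<^sup>2 * (s rmod (T / L\<^sup>2)))) sequentially"
    by (rule uniform_limit_compose'[OF u]) (use scaled_rmod_mem[OF L T] in blast)
  then show "uniform_limit {- r..r} (\<lambda>n s. (1 / L) *\<^sub>R \<omega>s n (L\<^sup>2 * (s rmod (T / L\<^sup>2))))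
      (\<lambda>s. (1 / L) *\<^sub>R \<omega> (L\<^sup>2 * (s rmod (T / L\<^sup>2)))) sequentially"
    by (rule bounded_linear.uniform_limit[OF bounded_linear_scaleR_right])
qed

text \<open>The loop space is a subspace, so an open set of the full path space has to be exhibited.
  \<open>V\<close> includes every path that is not a loop; such paths form an open set, and only
  sequences converging to a loop require an argument.\<close>

lemma continuous_map_rescaled_loop:
  assumes L: "0 < L" and T: "0 < T"
  shows "continuous_map (loop_topology L T) (mark_path_topology :: (real \<Rightarrow> real ^ 'n) topology) (rescaled_loop L T)"
  unfolding continuous_map_def
proof (intro conjI allI impI)
  show "rescaled_loop L T \<in> topspace (loop_topology L T) \<rightarrow> topspace mark_path_topology"
    using rescaled_loop_mark_paths[OF L T] by auto
  fix U :: "(real \<Rightarrow> real ^ 'n) set" assume U: "openin mark_path_topology U"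
  define V where "V = {\<omega> \<in> path_space {0..T} (closed_cube L). \<omega> 0 = \<omega> T \<longrightarrow> rescaled_loop L T \<omega> \<in> U}"
  have "openin (path_topology {0..T} (closed_cube L)) V"
  proof (subst openin_path_topology_seq[where K="\<lambda>_. {0..T}"])
    show "V \<subseteq> path_space {0..T} (closed_cube L) \<and>
      (\<forall>\<gamma>\<in>V. \<forall>\<gamma>s. (\<forall>n. \<gamma>s n \<in> path_space {0..T} (closed_cube L)) \<and> (\<forall>m::nat. uniform_limit {0..T} \<gamma>s \<gamma> sequentially) \<longrightarrow>
         (\<forall>\<^sub>F n in sequentially. \<gamma>s n \<in> V))"
    proof (intro conjI ballI allI impI)
      show "V \<subseteq> path_space {0..T} (closed_cube L)" by (auto simp: V_def)
      fix \<omega> and \<omega>s :: "nat \<Rightarrow> real \<Rightarrow> real ^ 'n" assume \<omega>: "\<omega> \<in> V"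
      assume "(\<forall>n. \<omega>s n \<in> path_space {0..T} (closed_cube L)) \<and> (\<forall>m::nat. uniform_limit {0..T} \<omega>s \<omega> sequentially)"
      then have \<omega>s: "\<And>n. \<omega>s n \<in> path_space {0..T} (closed_cube L)" and ul: "uniform_limit {0..T} \<omega>s \<omega> sequentially"
        by auto
      show "\<forall>\<^sub>F n in sequentially. \<omega>s n \<in> V"
      proof (cases "\<omega> 0 = \<omega> T")
        case False
        have "(\<lambda>n. \<omega>s n 0) \<longlonglongrightarrow> \<omega> 0" "(\<lambda>n. \<omega>s n T) \<longlonglongrightarrow> \<omega> T"
          using T by (auto intro!: tendsto_uniform_limitI[OF ul])
        then have "(\<lambda>n. \<omega>s n 0 - \<omega>s n T) \<longlonglongrightarrow> \<omega> 0 - \<omega> T" by (intro tendsto_diff)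
        then have "\<forall>\<^sub>F n in sequentially. \<omega>s n 0 - \<omega>s n T \<noteq> 0"
          using False by (intro tendsto_imp_eventually_ne) auto
        then show ?thesis
          by eventually_elim (use \<omega>s in \<open>auto simp: V_def\<close>)
      next
        case True
        then have \<omega>L: "\<omega> \<in> loop_paths L T" and \<omega>U: "rescaled_loop L T \<omega> \<in> U" using \<omega> by (auto simp: V_def)
        \<comment> \<open>Members of the sequence that are not loops are replaced by the limit, so
          that every rescaled path is a mark path; convergence is not affected.\<close>
        define \<omega>s' where "\<omega>s' n = (if \<omega>s n 0 = \<omega>s n T then \<omega>s n else \<omega>)" for n
        have \<omega>s': "\<omega>s' n \<in> loop_paths L T" for n using \<omega>s \<omega>L by (auto simp: \<omega>s'_def)
        have "uniform_limit {0..T} \<omega>s' \<omega> sequentially"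
        proof (rule uniform_limitI)
          fix e :: real assume "0 < e"
          with ul have "\<forall>\<^sub>F n in sequentially. \<forall>x\<in>{0..T}. dist (\<omega>s n x) (\<omega> x) < e"
            by (rule uniform_limitD)
          then show "\<forall>\<^sub>F n in sequentially. \<forall>x\<in>{0..T}. dist (\<omega>s' n x) (\<omega> x) < e"
            by eventually_elim (use \<open>0 < e\<close> in \<open>auto simp: \<omega>s'_def\<close>)
        qed
        from path_tendsto_rescaled_loop[OF L T this]
        have pt: "path_tendsto (\<lambda>n. rescaled_loop L T (\<omega>s' n)) (rescaled_loop L T \<omega>)" .
        have mp: "\<forall>n. rescaled_loop L T (\<omega>s' n) \<in> mark_paths"
          using rescaled_loop_mark_paths[OF L T \<omega>s'] by blast
        have "\<forall>\<^sub>F n in sequentially. rescaled_loop L T (\<omega>s' n) \<in> U"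
          using U[unfolded openin_mark_path_iff, THEN conjunct2, rule_format, OF \<omega>U, of "\<lambda>n. rescaled_loop L T (\<omega>s' n)"]
            pt mp by blast
        then show ?thesis
          by eventually_elim (use \<omega>s in \<open>auto simp: V_def \<omega>s'_def split: if_splits\<close>)
      qed
    qed
  qed (auto simp: incseq_def)
  moreover have "{\<omega> \<in> topspace (loop_topology L T). rescaled_loop L T \<omega> \<in> U} = V \<inter> {\<omega>. \<omega> 0 = \<omega> T}"
    by (auto simp: V_def)
  ultimately show "openin (loop_topology L T) {\<omega> \<in> topspace (loop_topology L T). rescaled_loop L T \<omega> \<in> U}"
    unfolding loop_topology_def openin_subtopology topspace_loop_topology by blast
qed

section \<open>Scaling of integrals from the large cube to the unit cube\<close>

abbreviation cube_measure_L :: "real \<Rightarrow> (real ^ 'n) measure" where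
  "cube_measure_L L \<equiv> restrict_space lborel (closed_cube L)"

lemma emeasure_cube_scaling:
  fixes A :: "(real ^ 'n) set"
  assumes L: "0 < L" and A: "A \<in> sets cube_measure"
  shows "emeasure (cube_measure_L L) {x \<in> closed_cube L. (1 / L) *\<^sub>R x \<in> A} = ennreal (L ^ CARD('n)) * emeasure cube_measure A"
proof -
  have A1: "A \<subseteq> closed_cube 1" and A2[measurable]: "A \<in> sets borel"
    using A by (auto simp: sets_restrict_space)
  have cube: "(1 / L) *\<^sub>R x \<in> closed_cube 1 \<longleftrightarrow> x \<in> closed_cube L" for x :: "real ^ 'n"
    using L by (auto simp: mem_closed_cube field_simps)
  let ?B = "{x \<in> closed_cube L. (1 / L) *\<^sub>R x \<in> A}"
  have B: "?B = (\<lambda>x. (1 / L) *\<^sub>R x) -` A"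
    using A1 cube by auto
  have mB[measurable]: "(\<lambda>x. (1 / L) *\<^sub>R x) -` A \<in> sets borel"
    using measurable_sets[of "\<lambda>x. (1 / L) *\<^sub>R x" borel borel A] A2 by simp
  have "emeasure (cube_measure_L L) ?B = emeasure lborel ((\<lambda>x. (1 / L) *\<^sub>R x) -` A)"
    unfolding B[symmetric] by (subst emeasure_restrict_space) (auto simp: Int_absorb2)
  also have "\<dots> = (\<integral>\<^sup>+x. ennreal (L ^ CARD('n)) * indicator ((\<lambda>x. (1 / L) *\<^sub>R x) -` A) (L *\<^sub>R x) \<partial>lborel)"
    using L by (subst lborel_affine[of L 0]) (simp_all add: emeasure_density nn_integral_distr)
  also have "\<dots> = (\<integral>\<^sup>+x. ennreal (L ^ CARD('n)) * indicator A x \<partial>lborel)"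
    using L by (intro nn_integral_cong) (auto simp: indicator_def)
  also have "\<dots> = ennreal (L ^ CARD('n)) * emeasure lborel A"
    by (subst nn_integral_cmult) auto
  also have "emeasure lborel A = emeasure cube_measure A"
    using A1 by (subst emeasure_restrict_space) (auto simp: Int_absorb2)
  finally show ?thesis .
qed

lemma measurable_cube_scaling:
  assumes L: "0 < L"
  shows "(\<lambda>x. \<lambda>i\<in>I. (1 / L) *\<^sub>R x i) \<in> (\<Pi>\<^sub>M i\<in>I. cube_measure_L L) \<rightarrow>\<^sub>M (\<Pi>\<^sub>M i\<in>I. cube_measure :: (real ^ 'n) measure)"
proof (rule measurable_restrict)
  fix i assume i: "i \<in> I"
  have "(\<lambda>x. (1 / L) *\<^sub>R x) \<in> cube_measure_L L \<rightarrow>\<^sub>M (cube_measure :: (real ^ 'n) measure)"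
    using L by (intro measurable_restrict_space2 measurable_restrict_space1)
      (auto simp: space_restrict_space mem_closed_cube field_simps)
  then show "(\<lambda>x. (1 / L) *\<^sub>R x i) \<in> (\<Pi>\<^sub>M i\<in>I. cube_measure_L L) \<rightarrow>\<^sub>M (cube_measure :: (real ^ 'n) measure)"
    using measurable_component_singleton[OF i, of "\<lambda>_. cube_measure_L L"] by (rule measurable_compose[rotated])
qed

text \<open>A change of variables at the level of measures: the push-forward, divided by its total
  mass \<open>r\<close>, agrees with the unit product measure on rectangles and hence
  everywhere.\<close>

lemma nn_integral_cube_scaling:
  fixes F :: "('i \<Rightarrow> real ^ 'n) \<Rightarrow> ennreal"
  assumes L: "0 < L" and I: "finite I" and F: "F \<in> borel_measurable (\<Pi>\<^sub>M i\<in>I. cube_measure)"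
  shows "(\<integral>\<^sup>+x. F (\<lambda>i\<in>I. (1 / L) *\<^sub>R x i) \<partial>(\<Pi>\<^sub>M i\<in>I. cube_measure_L L)) =
     ennreal (L ^ CARD('n)) ^ card I * (\<integral>\<^sup>+x. F x \<partial>(\<Pi>\<^sub>M i\<in>I. cube_measure))"
proof -
  let ?c = "ennreal (L ^ CARD('n)) ^ card I"
  let ?N = "cube_measure_L L :: (real ^ 'n) measure"
  define r where "r = (L ^ CARD('n)) ^ card I"
  have r: "?c = ennreal r" "0 < r"
    using L by (simp_all add: r_def ennreal_power)
  have c: "ennreal (1 / r) * (?c * y) = y" "?c * (ennreal (1 / r) * y) = y" for y
    using r(2) unfolding r(1) by (simp_all add: mult.assoc[symmetric] ennreal_mult[symmetric])
  interpret C: prob_space "cube_measure :: (real ^ 'n) measure" by (rule prob_space_cube_measure)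
  interpret CL: finite_measure ?N
    by (rule finite_measureI)
       (use L in \<open>simp add: space_restrict_space emeasure_restrict_space emeasure_closed_cube\<close>)
  interpret C: product_sigma_finite "\<lambda>_::'i. cube_measure :: (real ^ 'n) measure" ..
  interpret CL: product_sigma_finite "\<lambda>_::'i. ?N" ..
  define P where "P = scale_measure (ennreal (1 / r)) (distr (\<Pi>\<^sub>M i\<in>I. ?N) (\<Pi>\<^sub>M i\<in>I. cube_measure) (\<lambda>x. \<lambda>i\<in>I. (1 / L) *\<^sub>R x i))"
  have "P = (\<Pi>\<^sub>M i\<in>I. cube_measure)"
  proof (rule C.PiM_eqI[OF I])
    show "sets P = sets (\<Pi>\<^sub>M i\<in>I. cube_measure)" by (simp add: P_def)
    fix A :: "'i \<Rightarrow> (real ^ 'n) set" assume A: "\<And>i. i \<in> I \<Longrightarrow> A i \<in> sets cube_measure"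
    let ?B = "\<lambda>i. {x \<in> closed_cube L. (1 / L) *\<^sub>R x \<in> A i}"
    have B: "?B i \<in> sets ?N" if "i \<in> I" for i
    proof -
      have "A i \<in> sets borel" using A[OF that] by (auto simp: sets_restrict_space)
      then have "(\<lambda>x. (1 / L) *\<^sub>R x) -` A i \<in> sets borel"
        using measurable_sets[of "\<lambda>x. (1 / L) *\<^sub>R x" borel borel "A i"] by simp
      then show ?thesis by (auto simp: sets_restrict_space)
    qed
    have eq: "(\<lambda>x. \<lambda>i\<in>I. (1 / L) *\<^sub>R x i) -` Pi\<^sub>E I A \<inter> space (\<Pi>\<^sub>M i\<in>I. ?N) = Pi\<^sub>E I ?B"
      by (auto simp: space_PiM space_restrict_space PiE_def Pi_def)
    have "emeasure P (Pi\<^sub>E I A) = ennreal (1 / r) * emeasure (\<Pi>\<^sub>M i\<in>I. ?N) (Pi\<^sub>E I ?B)"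
      unfolding P_def emeasure_scale_measure
      by (subst emeasure_distr[OF measurable_cube_scaling[OF L] sets_PiM_I_finite[OF I A]]) (simp_all only: eq)
    also have "emeasure (\<Pi>\<^sub>M i\<in>I. ?N) (Pi\<^sub>E I ?B) = (\<Prod>i\<in>I. emeasure ?N (?B i))"
      by (rule CL.emeasure_PiM[OF I B])
    also have "\<dots> = (\<Prod>i\<in>I. ennreal (L ^ CARD('n)) * emeasure cube_measure (A i))"
      using A by (intro prod.cong refl emeasure_cube_scaling L)
    also have "\<dots> = ?c * (\<Prod>i\<in>I. emeasure cube_measure (A i))"
      by (simp add: prod.distrib)
    also have "ennreal (1 / r) * (?c * (\<Prod>i\<in>I. emeasure cube_measure (A i))) = (\<Prod>i\<in>I. emeasure cube_measure (A i))"
      by (rule c(1))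
    finally show "emeasure P (Pi\<^sub>E I A) = (\<Prod>i\<in>I. emeasure cube_measure (A i))" .
  qed
  then have "(\<integral>\<^sup>+x. F x \<partial>(\<Pi>\<^sub>M i\<in>I. cube_measure)) = (\<integral>\<^sup>+x. F x \<partial>P)" by simp
  also have "\<dots> = ennreal (1 / r) * (\<integral>\<^sup>+x. F (\<lambda>i\<in>I. (1 / L) *\<^sub>R x i) \<partial>(\<Pi>\<^sub>M i\<in>I. ?N))"
    unfolding P_def using F
    by (subst nn_integral_scale_measure, simp, subst nn_integral_distr[OF measurable_cube_scaling[OF L]]) simp_all
  finally show ?thesis
    by (simp only: c(2))
qed

section \<open>Domination of the loop law by the stationary law\<close>

text \<open>Scaling turns this into the large-time bound for \<open>neumann_kernel\<close> at time
  \<open>t / L^2\<close>, so \<open>D\<close> does not depend on \<open>L\<close>. The tolerance 1/2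
  is one admissible choice; it fixes the numbers from which the later factor 9/2 is formed.\<close>

lemma neumann_heat_kernel_near_one:
  fixes q :: "real \<Rightarrow> real ^ 'n \<Rightarrow> real ^ 'n \<Rightarrow> real"
  assumes L: "0 < L" and K: "neumann_heat_kernel L q" and D: "0 < D"
    and near: "\<And>s x y :: real ^ 'n. D \<le> s \<Longrightarrow> \<bar>neumann_kernel s x y - 1\<bar> \<le> 1 / 2"
    and t: "D \<le> t / L\<^sup>2" and x: "x \<in> closed_cube L" and y: "y \<in> closed_cube L"
  shows "1 / 2 \<le> q t x y * L ^ CARD('n)" and "q t x y * L ^ CARD('n) \<le> 3 / 2"
proof -
  have "0 < t" using t D L by (metis less_le_trans zero_less_divide_iff zero_less_power pos_less_divide_eq mult_zero_left)
  then have "q t x y * L ^ CARD('n) = neumann_kernel (t / L\<^sup>2) ((1 / L) *\<^sub>R x) ((1 / L) *\<^sub>R y)"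
    using neumann_heat_kernel_eq[OF L K _ x y, of t] L by simp
  with near[OF t, of "(1 / L) *\<^sub>R x" "(1 / L) *\<^sub>R y"]
  show "1 / 2 \<le> q t x y * L ^ CARD('n)" "q t x y * L ^ CARD('n) \<le> 3 / 2"
    unfolding abs_le_iff by linarith+
qed

context
  fixes p :: "real \<Rightarrow> real ^ 'n \<Rightarrow> real ^ 'n \<Rightarrow> real" and Q :: "(real \<Rightarrow> real ^ 'n) measure"
    and L T D :: real and q :: "real \<Rightarrow> real ^ 'n \<Rightarrow> real ^ 'n \<Rightarrow> real"
    and B :: "real ^ 'n \<Rightarrow> (real \<Rightarrow> real ^ 'n) measure"
  assumes K1: "neumann_heat_kernel 1 p" and Q: "two_sided_stationary_law p Q"
    and L: "0 < L" and K: "neumann_heat_kernel L q" and B: "bridge_kernel L q T B"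
    and D: "0 < D" and near: "\<And>s x y :: real ^ 'n. D \<le> s \<Longrightarrow> \<bar>neumann_kernel s x y - 1\<bar> \<le> 1 / 2"
    and TD: "2 * D < T / L\<^sup>2"
begin

lemma T_pos: "0 < T"
proof -
  have "0 < T / L\<^sup>2" using TD D by linarith
  then show ?thesis using L by (simp add: zero_less_divide_iff)
qed

section \<open>Root law, loop law and their measurability\<close>

lemma diagonal_bounds:
  "a \<in> closed_cube L \<Longrightarrow> 1 / 2 \<le> q T a a * L ^ CARD('n)"
  "a \<in> closed_cube L \<Longrightarrow> q T a a * L ^ CARD('n) \<le> 3 / 2"
  using neumann_heat_kernel_near_one[OF L K D near, of T a a] TD D by auto

lemma diagonal_pos: "a \<in> closed_cube L \<Longrightarrow> 0 < q T a a"
proof -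
  assume "a \<in> closed_cube L"
  then have "0 < q T a a * L ^ CARD('n)" using diagonal_bounds(1)[of a] by linarith
  then show "0 < q T a a" using L by (simp add: zero_less_mult_iff)
qed

definition partition_function :: real where
  "partition_function = (LINT z:open_cube L|lborel. q T z z)"

lemma diagonal_continuous: "continuous_on (closed_cube L) (\<lambda>a. q T a a)"
proof -
  have "continuous_on (closed_cube L) (\<lambda>a :: real ^ 'n. (T, a, a))" by (intro continuous_intros)
  moreover have "(\<lambda>a. (T, a, a)) ` closed_cube L \<subseteq> {0<..} \<times> closed_cube L \<times> closed_cube L"
    using T_pos by auto
  ultimately show ?thesis
    using continuous_on_compose2[OF neumann_heat_kernelD(1)[OF K]] by fastforce
qed

lemma diagonal_measurable: "(\<lambda>a. indicator (open_cube L) a * q T a a) \<in> borel_measurable lborel"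
  and diagonal_integrable: "set_integrable lborel (open_cube L) (\<lambda>a. q T a a)"
proof -
  show i: "set_integrable lborel (open_cube L) (\<lambda>a. q T a a)"
    by (rule set_integrable_subset[OF set_integral_continuous_cube(1)[OF diagonal_continuous]])
       (auto simp: open_cube_subset)
  from borel_measurable_integrable[OF i[unfolded set_integrable_def]]
  show "(\<lambda>a. indicator (open_cube L) a * q T a a) \<in> borel_measurable lborel" by simp
qed

lemma diagonal_measurable_restrict: "(\<lambda>a. q T a a) \<in> borel_measurable (restrict_space lborel (open_cube L))"
  using diagonal_measurable by (subst borel_measurable_restrict_space_iff) auto

text \<open>On a cube of volume \<open>L ^ CARD('n)\<close> the diagonal is at least half the
  inverse volume.\<close>

lemma partition_function_ge: "1 / 2 \<le> partition_function"
proof -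
  have "1 / 2 = (LINT z:(open_cube L :: (real ^ 'n) set)|lborel. 1 / (2 * L ^ CARD('n)) :: real)"
    using L by (simp add: set_lebesgue_integral_def measure_def emeasure_open_cube)
  also have "\<dots> \<le> partition_function"
    unfolding partition_function_def
  proof (rule set_integral_mono[OF _ diagonal_integrable])
    show "set_integrable lborel (open_cube L) (\<lambda>z :: real ^ 'n. 1 / (2 * L ^ CARD('n)) :: real)"
      using L unfolding set_integrable_def
      by (intro integrable_scaleR_left integrable_real_indicator) (auto simp: emeasure_open_cube)
    fix z :: "real ^ 'n" assume "z \<in> open_cube L"
    then have "1 / 2 \<le> q T z z * L ^ CARD('n)" using diagonal_bounds(1) open_cube_subset by blast
    then show "1 / (2 * L ^ CARD('n)) \<le> q T z z" using L by (simp add: field_simps)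
  qed
  finally show ?thesis .
qed

lemma root_law_prob: "root_law L q T \<in> space (prob_algebra (restrict_space lborel (open_cube L)))"
  unfolding space_prob_algebra root_law_def partition_function_def[symmetric]
proof (intro CollectI conjI prob_spaceI)
  let ?N = "restrict_space lborel (open_cube L :: (real ^ 'n) set)"
  have m: "(\<lambda>a. ennreal (q T a a / partition_function)) \<in> borel_measurable ?N"
    using diagonal_measurable_restrict by measurable
  have Z: "0 < partition_function" using partition_function_ge by linarith
  have "emeasure (density ?N (\<lambda>a. ennreal (q T a a / partition_function)))
      (space (density ?N (\<lambda>a. ennreal (q T a a / partition_function)))) = (\<integral>\<^sup>+a. ennreal (q T a a / partition_function) \<partial>?N)"
  proof -
    have "open_cube L \<in> sets ?N"
      using sets.top[of ?N] by (simp add: space_restrict_space)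
    then show ?thesis
      using m by (subst emeasure_density) (auto intro!: nn_integral_cong simp: space_restrict_space)
  qed
  also have "\<dots> = (\<integral>\<^sup>+a. ennreal (indicator (open_cube L) a * q T a a / partition_function) \<partial>lborel)"
    by (subst nn_integral_restrict_space) (auto intro!: nn_integral_cong simp: indicator_def)
  also have "\<dots> = ennreal (\<integral>a. indicator (open_cube L) a * q T a a / partition_function \<partial>lborel)"
  proof (rule nn_integral_eq_integral)
    show "integrable lborel (\<lambda>a. indicator (open_cube L) a * q T a a / partition_function)"
      using diagonal_integrable by (simp add: set_integrable_def)
    show "AE a in lborel. 0 \<le> indicator (open_cube L) a * q T a a / partition_function"
    proof (rule AE_I2)
      fix a :: "real ^ 'n"
      have "0 \<le> q T a a" if "a \<in> open_cube L"
        using diagonal_pos[of a] that open_cube_subset[of L] by fastforce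
      then show "0 \<le> indicator (open_cube L) a * q T a a / partition_function"
        using Z by (auto simp: indicator_def)
    qed
  qed
  also have "(\<integral>a. indicator (open_cube L) a * q T a a / partition_function \<partial>lborel) = 1"
    using Z by (simp add: partition_function_def set_lebesgue_integral_def)
  finally show "emeasure (density ?N (\<lambda>a. ennreal (q T a a / partition_function)))
      (space (density ?N (\<lambda>a. ennreal (q T a a / partition_function)))) = 1" by simp
qed simp

lemma bridge_measurable: "B \<in> restrict_space lborel (open_cube L) \<rightarrow>\<^sub>M prob_algebra (borel_of (loop_topology L T))"
  using B by (simp add: bridge_kernel_def)

lemma loop_law_space:
  shows "prob_space (loop_law L q T B)" and "sets (loop_law L q T B) = sets (borel_of (loop_topology L T))"
    and "space (loop_law L q T B) = loop_paths L T"
proof -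
  show "prob_space (loop_law L q T B)"
    unfolding loop_law_def by (rule prob_space_bind'[OF root_law_prob bridge_measurable])
  show s: "sets (loop_law L q T B) = sets (borel_of (loop_topology L T))"
    unfolding loop_law_def by (rule sets_bind'[OF root_law_prob bridge_measurable])
  show "space (loop_law L q T B) = loop_paths L T"
    using sets_eq_imp_space_eq[OF s] by simp
qed

lemma bridge_space:
  assumes "a \<in> open_cube L"
  shows "sets (B a) = sets (borel_of (loop_topology L T))" and "space (B a) = loop_paths L T"
proof -
  have "B a \<in> space (prob_algebra (borel_of (loop_topology L T)))"
    using measurable_space[OF bridge_measurable, of a] assms by (simp add: space_restrict_space)
  then show s: "sets (B a) = sets (borel_of (loop_topology L T))"
    by (simp add: space_prob_algebra)
  show "space (B a) = loop_paths L T" using sets_eq_imp_space_eq[OF s] by simp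
qed

lemma loop_functional_measurable:
  assumes "continuous_map mark_path_topology euclideanreal G"
  shows "(\<lambda>\<omega>. G (rescaled_loop L T \<omega>)) \<in> borel_measurable (borel_of (loop_topology L T))"
  using continuous_map_compose[OF continuous_map_rescaled_loop[OF L T_pos] assms]
  by (intro borel_measurable_continuous_map) (simp add: comp_def)

text \<open>In \<open>le\<close> the root density stays attached to \<open>f\<close>: when
  \<open>f\<close> is a bridge expectation, \<open>q T a a\<close> cancels against the bridge
  normalisation, and only the product has a bound that is uniform in the root.\<close>

lemma nn_integral_root_law:
  assumes f: "f \<in> borel_measurable (restrict_space lborel (open_cube L))"
    and le: "\<And>a. a \<in> open_cube L \<Longrightarrow> ennreal (q T a a / partition_function) * f a \<le> C"
  shows "(\<integral>\<^sup>+a. f a \<partial>root_law L q T) \<le> C * ennreal (L ^ CARD('n))"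
proof -
  let ?N = "restrict_space lborel (open_cube L :: (real ^ 'n) set)"
  have m: "(\<lambda>a. ennreal (q T a a / partition_function)) \<in> borel_measurable ?N"
    using diagonal_measurable_restrict by measurable
  have "(\<integral>\<^sup>+a. f a \<partial>root_law L q T) = (\<integral>\<^sup>+a. ennreal (q T a a / partition_function) * f a \<partial>?N)"
    unfolding root_law_def partition_function_def[symmetric] using m f by (rule nn_integral_density)
  also have "\<dots> \<le> (\<integral>\<^sup>+a. C \<partial>?N)"
    using le by (intro nn_integral_mono) (simp add: space_restrict_space)
  also have "\<dots> = C * emeasure lborel (open_cube L :: (real ^ 'n) set)"
    by (simp add: space_restrict_space emeasure_restrict_space)
  also have "\<dots> = C * ennreal (L ^ CARD('n))" using L by (simp add: emeasure_open_cube)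
  finally show ?thesis .
qed

section \<open>Comparison of loop and stationary densities\<close>

lemma transition_product_scaling:
  fixes x :: "nat \<Rightarrow> real ^ 'n"
  assumes t: "strict_mono_on {..k} t" and x: "\<And>i. i \<le> k \<Longrightarrow> x i \<in> closed_cube L"
  shows "transition_product q k (\<lambda>i. L\<^sup>2 * t i) x =
    transition_product p k t (\<lambda>i. (1 / L) *\<^sub>R x i) / (L ^ CARD('n)) ^ k"
proof -
  have "q (L\<^sup>2 * t (Suc i) - L\<^sup>2 * t i) (x i) (x (Suc i)) =
      p (t (Suc i) - t i) ((1 / L) *\<^sub>R x i) ((1 / L) *\<^sub>R x (Suc i)) / L ^ CARD('n)" if i: "i < k" for i
  proof -
    have ti: "0 < t (Suc i) - t i" using strict_mono_onD[OF t, of i "Suc i"] i by simp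
    have c: "(1 / L) *\<^sub>R x j \<in> closed_cube 1" if "j \<le> k" for j
      using x[OF that] L by (auto simp: mem_closed_cube field_simps)
    have "q (L\<^sup>2 * (t (Suc i) - t i)) (x i) (x (Suc i)) =
       neumann_kernel (L\<^sup>2 * (t (Suc i) - t i) / L\<^sup>2) ((1 / L) *\<^sub>R x i) ((1 / L) *\<^sub>R x (Suc i)) / L ^ CARD('n)"
      using L ti i x by (intro neumann_heat_kernel_eq[OF L K]) auto
    also have "L\<^sup>2 * (t (Suc i) - t i) / L\<^sup>2 = t (Suc i) - t i" using L by simp
    finally show ?thesis
      using unit_kernel_eq[OF K1 Q ti c c, of i "Suc i"] i by (simp add: right_diff_distrib)
  qed
  then show ?thesis
    by (simp add: transition_product_def prod_dividef)
qed

text \<open>The root density cancels the denominator of the bridge density, and the interior factors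
  are those of \<open>p\<close> after scaling. Only the two legs between the root and the window are
  estimated, each by 3/2 over the volume since it lasts at least \<open>D\<close> in rescaled time.
  With the partition function at least 1/2 this gives \<open>9 / (4 * Z)\<close>, at most
  9/2.\<close>

lemma loop_cylinder_bound:
  assumes ab: "D \<le> a" "a < b" "b \<le> T / L\<^sup>2 - D" and k: "0 < k"
    and G: "continuous_map mark_path_topology euclideanreal G"
  shows "(\<lambda>\<omega>. G (bernstein_path a b k (\<lambda>i. rescaled_loop L T \<omega> (node a b k i)))) \<in> borel_measurable (loop_law L q T B)"
      (is ?m)
    and "(\<integral>\<^sup>+\<omega>. ennreal (G (bernstein_path a b k (\<lambda>i. rescaled_loop L T \<omega> (node a b k i)))) \<partial>loop_law L q T B)
      \<le> ennreal (9 / 2) * cylinder_integral p a b k G" (is ?e)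
proof -
  let ?V = "L ^ CARD('n)"
  let ?Z = "partition_function"
  let ?n = "node a b k"
  let ?h = "\<lambda>x. ennreal (G (bernstein_path a b k x))"
  let ?N = "\<Pi>\<^sub>M i\<in>{..k}. cube_measure_L L :: (real ^ 'n) measure"
  let ?sc = "\<lambda>x :: nat \<Rightarrow> real ^ 'n. \<lambda>i\<in>{..k}. (1 / L) *\<^sub>R x i"
  define t where "t i = L\<^sup>2 * ?n i" for i
  define I where "I = cylinder_integral p a b k G"
  have V: "0 < ?V" using L by simp
  have Z: "1 / 2 \<le> ?Z" by (rule partition_function_ge)
  have ns: "strict_mono_on {..k} ?n" by (rule node_strict_mono[OF ab(2) k])
  \<comment> \<open>The nodes stay strictly below the period, so \<open>rmod\<close> acts trivially
    on them.\<close>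
  have n01: "?n i \<in> {0..<T / L\<^sup>2}" if "i \<le> k" for i
    using node_mem[OF ab(2) k that] ab D by auto
  have ts: "strict_mono_on {..k} t \<and> 0 < t 0 \<and> t k < T"
  proof (intro conjI)
    show "strict_mono_on {..k} t"
      using strict_mono_onD[OF ns] L by (auto intro!: strict_mono_onI simp: t_def)
    show "0 < t 0" using ab D L by (simp add: t_def)
    have "L\<^sup>2 * b < L\<^sup>2 * (T / L\<^sup>2)" using ab D L by (intro mult_strict_left_mono) auto
    then show "t k < T" using L k by (simp add: t_def)
  qed
  have Y: "bernstein_path a b k (\<lambda>i. rescaled_loop L T \<omega> (?n i)) = bernstein_path a b k (?sc (\<lambda>i\<in>{..k}. \<omega> (t i)))" for \<omega>
  proof -
    have r: "rescaled_loop L T \<omega> (?n i) = ?sc (\<lambda>i\<in>{..k}. \<omega> (t i)) i" if "i \<le> k" for i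
      using rescaled_loop_eq[OF L n01[OF that], of \<omega>] that by (simp add: t_def)
    show ?thesis
      unfolding bernstein_path_def by (intro ext sum.cong refl) (simp add: r del: restrict_apply)
  qed
  have dist: "distributed (B c) ?N (\<lambda>\<omega>. \<lambda>i\<in>{..k}. \<omega> (t i))
      (\<lambda>x. ennreal (q (t 0) c (x 0) * transition_product q k t x * q (T - t k) (x k) c / q T c c))"
    if "c \<in> open_cube L" for c
    using B that ts unfolding bridge_kernel_def by blast
  note mG = borel_measurable_bernstein_functional[OF ab(2) G, of k]
  have msc: "(\<lambda>x. G (bernstein_path a b k (?sc x))) \<in> borel_measurable ?N"
    using measurable_compose[OF measurable_cube_scaling[OF L] mG] .
  have mB: "(\<lambda>\<omega>. G (bernstein_path a b k (\<lambda>i. rescaled_loop L T \<omega> (?n i)))) \<in> borel_measurable (B c)"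
    if "c \<in> open_cube L" for c
    unfolding Y using measurable_compose[OF distributed_measurable[OF dist[OF that]] msc] .
  \<comment> \<open>Measurability concerns only the sigma-algebra, which each bridge law shares with
    the loop space; one bridge, rooted at the centre of the cube, therefore settles it.\<close>
  have "(\<chi> i. L / 2) \<in> (open_cube L :: (real ^ 'n) set)" using L by (simp add: mem_open_cube)
  from mB[OF this] bridge_space(1)[OF this]
  have mloop: "(\<lambda>\<omega>. G (bernstein_path a b k (\<lambda>i. rescaled_loop L T \<omega> (?n i)))) \<in> borel_measurable (borel_of (loop_topology L T))"
    by (simp cong: measurable_cong_sets)
  then show ?m
    using loop_law_space(2) by (simp cong: measurable_cong_sets)
  have mloop': "(\<lambda>\<omega>. ?h (\<lambda>i. rescaled_loop L T \<omega> (?n i))) \<in> borel_measurable (borel_of (loop_topology L T))"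
    using mloop by simp
  have B': "B \<in> root_law L q T \<rightarrow>\<^sub>M subprob_algebra (borel_of (loop_topology L T))"
    using measurable_prob_algebraD[OF bridge_measurable] root_law_prob
    by (simp cong: measurable_cong_sets add: space_prob_algebra)
  define f where "f c = (\<integral>\<^sup>+\<omega>. ?h (\<lambda>i. rescaled_loop L T \<omega> (?n i)) \<partial>B c)" for c
  have mf: "f \<in> borel_measurable (restrict_space lborel (open_cube L))"
    unfolding f_def[abs_def]
    by (rule measurable_compose[OF measurable_prob_algebraD[OF bridge_measurable] nn_integral_measurable_subprob_algebra[OF mloop']])
  have "(\<integral>\<^sup>+\<omega>. ?h (\<lambda>i. rescaled_loop L T \<omega> (?n i)) \<partial>loop_law L q T B) = (\<integral>\<^sup>+c. f c \<partial>root_law L q T)"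
    unfolding loop_law_def f_def by (rule nn_integral_bind[OF mloop' B'])
  \<comment> \<open>Volume powers: \<open>?V ^ 2\<close> from the two legs and \<open>?V ^ k\<close>
    from the scaled transitions in the denominator; \<open>?V ^ Suc k\<close> from rescaling the
    \<open>k + 1\<close> points and a last \<open>?V\<close> from integrating over the root. They
    cancel exactly.\<close>
  also have "\<dots> \<le> (ennreal (9 / (4 * ?Z * ?V ^ 2 * ?V ^ k)) * (ennreal ?V ^ Suc k * I)) * ennreal ?V"
  proof (rule nn_integral_root_law[OF mf])
    fix c :: "real ^ 'n" assume c: "c \<in> open_cube L"
    then have cc: "c \<in> closed_cube L" using open_cube_subset by blast
    have qc: "0 < q T c c" by (rule diagonal_pos[OF cc])
    let ?d = "\<lambda>x. q (t 0) c (x 0) * transition_product q k t x * q (T - t k) (x k) c / q T c c"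
    have md: "(\<lambda>x. ennreal (?d x)) \<in> borel_measurable ?N"
      by (rule distributed_borel_measurable[OF dist[OF c]])
    have mh: "(\<lambda>x. ?h (?sc x)) \<in> borel_measurable ?N" using msc by simp
    have "f c = (\<integral>\<^sup>+x. ennreal (?d x) * ?h (?sc x) \<partial>?N)"
      unfolding f_def Y by (rule distributed_nn_integral[OF dist[OF c] mh, symmetric])
    then have "ennreal (q T c c / ?Z) * f c = (\<integral>\<^sup>+x. ennreal (q T c c / ?Z) * (ennreal (?d x) * ?h (?sc x)) \<partial>?N)"
      using md mh by (simp add: nn_integral_cmult)
    also have "\<dots> \<le> (\<integral>\<^sup>+x. ennreal (9 / (4 * ?Z * ?V ^ 2 * ?V ^ k)) * cylinder_density p a b k G (?sc x) \<partial>?N)"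
    proof (rule nn_integral_mono)
      fix x assume "x \<in> space ?N"
      then have x: "x i \<in> closed_cube L" if "i \<le> k" for i
        using that by (auto simp: space_PiM space_restrict_space PiE_def Pi_def)
      have sx: "(1 / L) *\<^sub>R x i \<in> closed_cube 1" if "i \<le> k" for i
        using x[OF that] L by (auto simp: mem_closed_cube field_simps)
      let ?TP = "transition_product p k ?n (?sc x)"
      have TP0: "0 \<le> ?TP"
        by (rule transition_product_nonneg[OF K1 Q ns]) (use sx in auto)
      have TP: "transition_product q k t x = ?TP / ?V ^ k"
      proof -
        have "transition_product q k t x = transition_product p k ?n (\<lambda>i. (1 / L) *\<^sub>R x i) / ?V ^ k"
          unfolding t_def by (rule transition_product_scaling[OF ns x])
        also have "transition_product p k ?n (\<lambda>i. (1 / L) *\<^sub>R x i) = ?TP"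
          by (rule transition_product_cong) simp
        finally show ?thesis .
      qed
      have q1: "0 \<le> q (t 0) c (x 0)" "q (t 0) c (x 0) \<le> 3 / (2 * ?V)"
      proof -
        have "D \<le> t 0 / L\<^sup>2" using ab L by (simp add: t_def)
        from neumann_heat_kernel_near_one[OF L K D near this cc x[of 0]] V
        show "0 \<le> q (t 0) c (x 0)" "q (t 0) c (x 0) \<le> 3 / (2 * ?V)"
          by (auto simp: field_simps intro: neumann_heat_kernelD(2)[OF K] ts[THEN conjunct2, THEN conjunct1] cc x)
      qed
      have q2: "0 \<le> q (T - t k) (x k) c" "q (T - t k) (x k) c \<le> 3 / (2 * ?V)"
      proof -
        have "D \<le> (T - t k) / L\<^sup>2" using ab L k by (simp add: t_def diff_divide_distrib)
        from neumann_heat_kernel_near_one[OF L K D near this x[of k] cc] V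
        show "0 \<le> q (T - t k) (x k) c" "q (T - t k) (x k) c \<le> 3 / (2 * ?V)"
          using ts by (auto simp: field_simps intro: neumann_heat_kernelD(2)[OF K] cc x)
      qed
      have "q T c c / ?Z * ?d x = q (t 0) c (x 0) * q (T - t k) (x k) c * (?TP / (?Z * ?V ^ k))"
        unfolding TP using qc Z by (simp add: field_simps)
      also have "\<dots> \<le> (3 / (2 * ?V)) * (3 / (2 * ?V)) * (?TP / (?Z * ?V ^ k))"
        using q1 q2 TP0 Z V by (intro mult_right_mono mult_mono) auto
      also have "\<dots> = 9 / (4 * ?Z * ?V ^ 2 * ?V ^ k) * ?TP"
        by (simp add: power2_eq_square)
      finally have le: "q T c c / ?Z * ?d x \<le> 9 / (4 * ?Z * ?V ^ 2 * ?V ^ k) * ?TP" .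
      have d0: "0 \<le> ?d x" using q1(1) q2(1) TP0 V qc unfolding TP by (intro divide_nonneg_pos mult_nonneg_nonneg) auto
      have "ennreal (q T c c / ?Z) * (ennreal (?d x) * ?h (?sc x)) = ennreal (q T c c / ?Z * ?d x) * ?h (?sc x)"
      proof -
        have "ennreal (q T c c / ?Z * ?d x) = ennreal (q T c c / ?Z) * ennreal (?d x)"
          using d0 qc Z by (intro ennreal_mult) auto
        then show ?thesis by (simp only: mult.assoc)
      qed
      also have "\<dots> \<le> ennreal (9 / (4 * ?Z * ?V ^ 2 * ?V ^ k) * ?TP) * ?h (?sc x)"
        by (intro mult_right_mono ennreal_leI le) simp
      also have "\<dots> = ennreal (9 / (4 * ?Z * ?V ^ 2 * ?V ^ k)) * cylinder_density p a b k G (?sc x)"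
      proof -
        have "ennreal (9 / (4 * ?Z * ?V ^ 2 * ?V ^ k) * ?TP) = ennreal (9 / (4 * ?Z * ?V ^ 2 * ?V ^ k)) * ennreal ?TP"
          using TP0 Z V by (intro ennreal_mult) auto
        then show ?thesis by (simp only: cylinder_density_def mult.assoc)
      qed
      finally show "ennreal (q T c c / ?Z) * (ennreal (?d x) * ?h (?sc x)) \<le>
          ennreal (9 / (4 * ?Z * ?V ^ 2 * ?V ^ k)) * cylinder_density p a b k G (?sc x)" .
    qed
    also have "\<dots> = ennreal (9 / (4 * ?Z * ?V ^ 2 * ?V ^ k)) * (\<integral>\<^sup>+x. cylinder_density p a b k G (?sc x) \<partial>?N)"
      by (rule nn_integral_cmult)
         (rule measurable_compose[OF measurable_cube_scaling[OF L] cylinder_density_measurable[OF K1 Q ab(2) k G]])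
    also have "(\<integral>\<^sup>+x. cylinder_density p a b k G (?sc x) \<partial>?N) = ennreal ?V ^ Suc k * I"
      unfolding I_def cylinder_integral_def
      using nn_integral_cube_scaling[OF L _ cylinder_density_measurable[OF K1 Q ab(2) k G]] by simp
    finally show "ennreal (q T c c / ?Z) * f c \<le> ennreal (9 / (4 * ?Z * ?V ^ 2 * ?V ^ k)) * (ennreal ?V ^ Suc k * I)" .
  qed
  also have "\<dots> = ennreal (9 / (4 * ?Z)) * I"
  proof -
    have "ennreal (9 / (4 * ?Z * ?V ^ 2 * ?V ^ k)) * (ennreal ?V ^ Suc k * I) * ennreal ?V
        = ennreal (9 / (4 * ?Z * ?V ^ 2 * ?V ^ k) * (?V ^ Suc k * ?V)) * I"
    proof -
      have "ennreal (9 / (4 * ?Z * ?V ^ 2 * ?V ^ k) * (?V ^ Suc k * ?V)) =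
          ennreal (9 / (4 * ?Z * ?V ^ 2 * ?V ^ k)) * (ennreal (?V ^ Suc k) * ennreal ?V)"
        using V Z by (subst ennreal_mult; (subst ennreal_mult)?) auto
      then show ?thesis using V by (simp only: ennreal_power less_imp_le mult_ac)
    qed
    also have "9 / (4 * ?Z * ?V ^ 2 * ?V ^ k) * (?V ^ Suc k * ?V) = 9 / (4 * ?Z)"
      using L V Z by (simp add: power2_eq_square)
    finally show ?thesis .
  qed
  also have "\<dots> \<le> ennreal (9 / 2) * I"
    using Z by (intro mult_right_mono ennreal_leI) (auto simp: field_simps)
  finally show ?e unfolding I_def .
qed

text \<open>Both expectations are limits along the same grids, so the cylinder inequality passes to
  the limit; \<open>M\<close> enters only as the dominating bound and not in the conclusion.\<close>

lemma loop_functional_bound: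
  assumes ab: "D \<le> a" "a < b" "b \<le> T / L\<^sup>2 - D"
    and G: "continuous_map mark_path_topology euclideanreal G"
    and w: "window_functional {a..b} G" and bd: "\<And>\<gamma>. \<gamma> \<in> mark_paths \<Longrightarrow> 0 \<le> G \<gamma> \<and> G \<gamma> \<le> M"
  shows "(\<integral>\<omega>. G (rescaled_loop L T \<omega>) \<partial>loop_law L q T B) \<le> 9 / 2 * (\<integral>\<gamma>. G \<gamma> \<partial>Q)"
proof -
  let ?P = "loop_law L q T B"
  let ?B = "\<lambda>k \<omega>. G (bernstein_path a b (Suc k) (\<lambda>i. rescaled_loop L T \<omega> (node a b (Suc k) i)))"
  interpret prob_space ?P by (rule loop_law_space)
  have bd': "\<bar>G \<gamma>\<bar> \<le> M" if "\<gamma> \<in> mark_paths" for \<gamma> using bd[OF that] by simp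
  have Y: "rescaled_loop L T \<omega> \<in> mark_paths" if "\<omega> \<in> space ?P" for \<omega>
    using that rescaled_loop_mark_paths[OF L T_pos] by (simp add: loop_law_space)
  have Z: "bernstein_path a b (Suc k) (\<lambda>i. rescaled_loop L T \<omega> (node a b (Suc k) i)) \<in> mark_paths"
    if "\<omega> \<in> space ?P" for k \<omega>
    using Y[OF that] by (intro bernstein_path_mark_paths ab) (auto simp: mem_mark_paths)
  have mB: "?B k \<in> borel_measurable ?P" for k
    by (rule loop_cylinder_bound(1)[OF ab _ G]) simp
  have lim: "(\<lambda>k. \<integral>\<omega>. ?B k \<omega> \<partial>?P) \<longlonglongrightarrow> (\<integral>\<omega>. G (rescaled_loop L T \<omega>) \<partial>?P)"
    by (rule integral_bernstein_tendsto[OF loop_law_space(1) ab(2) G w bd' Y mB])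
  have "(\<lambda>k. ennreal (\<integral>\<omega>. ?B k \<omega> \<partial>?P)) \<longlonglongrightarrow> ennreal (\<integral>\<omega>. G (rescaled_loop L T \<omega>) \<partial>?P)"
    by (rule tendsto_ennrealI[OF lim])
  moreover have "(\<lambda>k. ennreal (9 / 2) * cylinder_integral p a b (Suc k) G) \<longlonglongrightarrow> ennreal (9 / 2) * ennreal (\<integral>\<gamma>. G \<gamma> \<partial>Q)"
    using window_cylinder_limit[OF K1 Q ab(2) G w bd, of 0] by (intro ennreal_tendsto_cmult) (auto simp: shift_def)
  moreover have "ennreal (\<integral>\<omega>. ?B k \<omega> \<partial>?P) \<le> ennreal (9 / 2) * cylinder_integral p a b (Suc k) G" for k
  proof -
    have "integrable ?P (?B k)"
      by (rule integrable_const_bound[where B=M]) (use bd'[OF Z] mB in \<open>auto intro!: AE_I2\<close>)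
    from nn_integral_eq_integral[OF this] bd[OF Z]
    have "ennreal (\<integral>\<omega>. ?B k \<omega> \<partial>?P) = (\<integral>\<^sup>+\<omega>. ennreal (?B k \<omega>) \<partial>?P)"
      by (auto intro!: sym)
    then show ?thesis using loop_cylinder_bound(2)[OF ab _ G, of "Suc k"] by simp
  qed
  ultimately have "ennreal (\<integral>\<omega>. G (rescaled_loop L T \<omega>) \<partial>?P) \<le> ennreal (9 / 2) * ennreal (\<integral>\<gamma>. G \<gamma> \<partial>Q)"
    by (intro LIMSEQ_le) auto
  also have "\<dots> = ennreal (9 / 2 * (\<integral>\<gamma>. G \<gamma> \<partial>Q))"
    by (rule ennreal_mult''[symmetric])
       (use bd in \<open>auto intro!: integral_nonneg_AE AE_I2 simp: stationary_law_space(3)[OF K1 Q]\<close>)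
  finally show ?thesis
    using bd by (subst (asm) ennreal_le_iff) (auto intro!: mult_nonneg_nonneg integral_nonneg_AE AE_I2 simp: stationary_law_space(3)[OF K1 Q])
qed

end

section \<open>Self-averaging\<close>

lemma window_functional_mono:
  "window_functional I G \<Longrightarrow> I \<subseteq> J \<Longrightarrow> window_functional J G"
  unfolding window_functional_def by (meson subsetD)

lemma window_functional_time_average:
  assumes \<alpha>\<beta>: "\<alpha> < \<beta>" and g: "continuous_map mark_path_topology euclideanreal g"
    and w: "window_functional {-r..r} (g :: (real \<Rightarrow> real ^ 'n) \<Rightarrow> real)"
  shows "window_functional {\<alpha> - r..\<beta> + r} (time_average \<alpha> \<beta> g)"
  unfolding window_functional_def
proof (intro ballI impI)
  fix \<gamma> \<gamma>' :: "real \<Rightarrow> real ^ 'n"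
  assume \<gamma>: "\<gamma> \<in> mark_paths" and \<gamma>': "\<gamma>' \<in> mark_paths" and eq: "\<forall>t\<in>{\<alpha> - r..\<beta> + r}. \<gamma> t = \<gamma>' t"
  show "time_average \<alpha> \<beta> g \<gamma> = time_average \<alpha> \<beta> g \<gamma>'"
    unfolding time_average_def
  proof (rule integral_cong_AE)
    show "(\<lambda>u. g (shift u \<gamma>)) \<in> borel_measurable (uniform_measure lborel {\<alpha>..\<beta>})"
      using borel_measurable_shift_time[OF g \<gamma>] by simp
    show "(\<lambda>u. g (shift u \<gamma>')) \<in> borel_measurable (uniform_measure lborel {\<alpha>..\<beta>})"
      using borel_measurable_shift_time[OF g \<gamma>'] by simp
    show "AE u in uniform_measure lborel {\<alpha>..\<beta>}. g (shift u \<gamma>) = g (shift u \<gamma>')"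
    proof (rule AE_uniform_measureI)
      show "AE u in lborel. u \<in> {\<alpha>..\<beta>} \<longrightarrow> g (shift u \<gamma>) = g (shift u \<gamma>')"
      proof (intro AE_I2 impI)
        fix u assume u: "u \<in> {\<alpha>..\<beta>}"
        show "g (shift u \<gamma>) = g (shift u \<gamma>')"
        proof (rule window_functionalD[OF w shift_mark_paths[OF \<gamma>] shift_mark_paths[OF \<gamma>']])
          fix t assume "t \<in> {-r..r}"
          then have "u + t \<in> {\<alpha> - r..\<beta> + r}" using u by simp
          then show "shift u \<gamma> t = shift u \<gamma>' t" using eq by (simp add: shift_def)
        qed
      qed
    qed simp
  qed
qed

section \<open>Time averages over different intervals\<close>

lemma time_average_nn:
  assumes "\<alpha> < \<beta>" "continuous_map mark_path_topology euclideanreal G"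
    and "\<And>\<gamma>. \<gamma> \<in> mark_paths \<Longrightarrow> 0 \<le> G \<gamma> \<and> G \<gamma> \<le> M" and \<gamma>: "\<gamma> \<in> mark_paths"
  shows "(\<integral>\<^sup>+u. ennreal (G (shift u \<gamma>)) * indicator {\<alpha>..\<beta>} u \<partial>lborel) = ennreal ((\<beta> - \<alpha>) * time_average \<alpha> \<beta> G \<gamma>)"
proof -
  let ?I = "\<integral>\<^sup>+u. ennreal (G (shift u \<gamma>)) * indicator {\<alpha>..\<beta>} u \<partial>lborel"
  have m: "(\<lambda>u. ennreal (G (shift u \<gamma>))) \<in> borel_measurable lborel"
    using borel_measurable_shift_time[OF assms(2) \<gamma>] by simp
  have "ennreal (time_average \<alpha> \<beta> G \<gamma>) = ?I / ennreal (\<beta> - \<alpha>)"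
  proof -
    have "ennreal (time_average \<alpha> \<beta> G \<gamma>) = (\<integral>\<^sup>+u. ennreal (G (shift u \<gamma>)) \<partial>uniform_measure lborel {\<alpha>..\<beta>})"
      by (rule time_average_bounds(3)[OF assms])
    also have "\<dots> = ?I / ennreal (\<beta> - \<alpha>)"
      using assms(1) m by (subst nn_integral_uniform_measure) auto
    finally show ?thesis .
  qed
  then have "ennreal (\<beta> - \<alpha>) * ennreal (time_average \<alpha> \<beta> G \<gamma>) = ?I * (ennreal (\<beta> - \<alpha>) / ennreal (\<beta> - \<alpha>))"
    by (simp only: ennreal_times_divide) (simp only: mult.commute)
  also have "\<dots> = ?I" using assms(1) by (simp add: ennreal_divide_self)
  finally show ?thesis
    using assms(1) time_average_bounds(1)[OF assms] by (simp add: ennreal_mult)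
qed

text \<open>Without normalisation, shortening the interval loses at most \<open>M\<close> times the
  discarded length \<open>S - l\<close>. Dividing afterwards by different lengths is a second error
  of the same size.\<close>

lemma time_average_compare:
  assumes \<alpha>\<beta>: "0 \<le> \<alpha>" "\<alpha> < \<beta>" "\<beta> \<le> S" and G: "continuous_map mark_path_topology euclideanreal G"
    and b: "\<And>\<gamma>. \<gamma> \<in> mark_paths \<Longrightarrow> 0 \<le> G \<gamma> \<and> G \<gamma> \<le> M" and \<gamma>: "\<gamma> \<in> mark_paths"
  shows "\<bar>time_average 0 S G \<gamma> - time_average \<alpha> \<beta> G \<gamma>\<bar> \<le> M * (S - (\<beta> - \<alpha>)) / S"
proof -
  define A where "A = time_average 0 S G \<gamma>"
  define A' where "A' = time_average \<alpha> \<beta> G \<gamma>"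
  define l where "l = \<beta> - \<alpha>"
  have S: "0 < S" and l: "0 < l" "l \<le> S" using \<alpha>\<beta> by (auto simp: l_def)
  have A': "0 \<le> A'" "A' \<le> M" unfolding A'_def using time_average_bounds[OF \<alpha>\<beta>(2) G b \<gamma>] by auto
  have A: "0 \<le> A" "A \<le> M" unfolding A_def using time_average_bounds[OF S G b \<gamma>] by auto
  let ?f = "\<lambda>u. ennreal (G (shift u \<gamma>))"
  have m: "?f \<in> borel_measurable lborel"
    using borel_measurable_shift_time[OF G \<gamma>] by simp
  have bs: "G (shift u \<gamma>) \<le> M" for u using b shift_mark_paths[OF \<gamma>] by blast
  have I: "(\<integral>\<^sup>+u. ?f u * indicator {0..S} u \<partial>lborel) = ennreal (S * A)"
    using time_average_nn[OF S G b \<gamma>] by (simp add: A_def)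
  have I': "(\<integral>\<^sup>+u. ?f u * indicator {\<alpha>..\<beta>} u \<partial>lborel) = ennreal (l * A')"
    using time_average_nn[OF \<alpha>\<beta>(2) G b \<gamma>] by (simp add: A'_def l_def)
  have "ennreal (l * A') \<le> ennreal (S * A)"
    unfolding I[symmetric] I'[symmetric] using \<alpha>\<beta>
    by (intro nn_integral_mono mult_left_mono) (auto simp: indicator_def)
  then have 1: "l * A' \<le> S * A" using S A by (subst (asm) ennreal_le_iff) auto
  have "ennreal (S * A) \<le> (\<integral>\<^sup>+u. ?f u * indicator {\<alpha>..\<beta>} u + (ennreal M * indicator {0..\<alpha>} u + ennreal M * indicator {\<beta>..S} u) \<partial>lborel)"
    unfolding I[symmetric]
  proof (rule nn_integral_mono)
    fix u
    have "?f u \<le> ennreal M" using bs by (rule ennreal_leI)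
    then show "?f u * indicator {0..S} u \<le> ?f u * indicator {\<alpha>..\<beta>} u + (ennreal M * indicator {0..\<alpha>} u + ennreal M * indicator {\<beta>..S} u)"
    proof (cases "u \<in> {0..S}")
      case True
      then consider "u \<in> {\<alpha>..\<beta>}" | "u \<in> {0..\<alpha>}" | "u \<in> {\<beta>..S}" by force
      then show ?thesis
      proof cases
        case 1
        then show ?thesis using True by (simp add: add_increasing2)
      next
        case 2
        then have "?f u * indicator {0..S} u \<le> ennreal M * indicator {0..\<alpha>} u"
          using True \<open>?f u \<le> ennreal M\<close> by simp
        then show ?thesis by (rule add_increasing[OF zero_le add_increasing2[OF zero_le]])
      next
        case 3
        then have "?f u * indicator {0..S} u \<le> ennreal M * indicator {\<beta>..S} u"
          using True \<open>?f u \<le> ennreal M\<close> by simp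
        then show ?thesis by (rule add_increasing[OF zero_le add_increasing[OF zero_le]])
      qed
    qed simp
  qed
  also have "\<dots> = ennreal (l * A') + (ennreal M * ennreal \<alpha> + ennreal M * ennreal (S - \<beta>))"
    using m \<alpha>\<beta> by (simp add: nn_integral_add nn_integral_cmult_indicator I')
  also have "\<dots> = ennreal (l * A' + (M * \<alpha> + M * (S - \<beta>)))"
  proof -
    have M: "0 \<le> M" using A' by linarith
    then have "ennreal (l * A' + (M * \<alpha> + M * (S - \<beta>))) = ennreal (l * A') + (ennreal (M * \<alpha>) + ennreal (M * (S - \<beta>)))"
      using A' l \<alpha>\<beta> by (subst ennreal_plus; (subst ennreal_plus)?) auto
    then show ?thesis using M \<alpha>\<beta> by (simp only: ennreal_mult diff_ge_0_iff_ge)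
  qed
  finally have "S * A \<le> l * A' + (M * \<alpha> + M * (S - \<beta>))"
    using A' l \<alpha>\<beta> by (subst (asm) ennreal_le_iff) auto
  then have 2: "S * A \<le> l * A' + M * (S - l)" by (simp add: l_def algebra_simps)
  \<comment> \<open>\<open>S * A - S * A'\<close> is the difference of \<open>S * A - l * A'\<close>
    and \<open>(S - l) * A'\<close>. Both lie between 0 and \<open>M * (S - l)\<close>, so no factor
    2 arises.\<close>
  have 3: "0 \<le> (S - l) * A'" "(S - l) * A' \<le> M * (S - l)"
    using A' l by (auto simp: mult.commute[of M] intro: mult_left_mono)
  have "S * \<bar>A - A'\<bar> = \<bar>S * A - S * A'\<bar>"
    using S by (metis abs_mult abs_of_pos right_diff_distrib)
  also have "\<dots> \<le> M * (S - l)"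
    using 1 2 3 by (simp add: abs_le_iff algebra_simps)
  finally show ?thesis
    using S unfolding A_def[symmetric] A'_def[symmetric] l_def[symmetric] by (simp add: pos_le_divide_eq mult.commute)
qed

lemma time_average_abs_le:
  assumes S: "0 < S" and F: "continuous_map mark_path_topology euclideanreal F" "\<And>\<gamma>. \<gamma> \<in> mark_paths \<Longrightarrow> \<bar>F \<gamma>\<bar> \<le> M"
    and \<gamma>: "\<gamma> \<in> mark_paths"
  shows "\<bar>time_average 0 S F \<gamma>\<bar> \<le> M"
proof -
  interpret U: prob_space "uniform_measure lborel {0..S}" by (rule prob_space_uniform_Icc[OF S])
  have i: "integrable (uniform_measure lborel {0..S}) (\<lambda>u. F (shift u \<gamma>))"
    by (rule uniform_Icc_integrable[OF S F \<gamma>])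
  have fb: "- M \<le> F (shift u \<gamma>)" "F (shift u \<gamma>) \<le> M" for u
    using F(2)[OF shift_mark_paths[OF \<gamma>, of u]] by (simp_all add: abs_le_iff)
  have "- M \<le> time_average 0 S F \<gamma>" "time_average 0 S F \<gamma> \<le> M"
    unfolding time_average_def using fb by (auto intro!: U.integral_le_const U.integral_ge_const i AE_I2)
  then show ?thesis by (simp add: abs_le_iff)
qed

text \<open>The threshold on \<open>S\<close> is chosen before \<open>L\<close>, \<open>T\<close>,
  \<open>q\<close> and \<open>B\<close>. This uniformity over all loops of the same rescaled
  duration is what eventually controls the supremum over \<open>j\<close>.\<close>

definition self_averaging :: "((real \<Rightarrow> real ^ 'n) \<Rightarrow> real) \<Rightarrow> real \<Rightarrow> bool" where
  "self_averaging f c \<longleftrightarrow> (\<forall>\<epsilon>>0. \<forall>\<^sub>F S in at_top. \<forall>L T q B.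
     0 < L \<longrightarrow> neumann_heat_kernel L q \<longrightarrow> bridge_kernel L q T B \<longrightarrow> T / L\<^sup>2 = S \<longrightarrow>
     (\<integral>\<omega>. \<bar>time_average 0 S f (rescaled_loop L T \<omega>) - c\<bar> \<partial>loop_law L q T B) \<le> \<epsilon>)"

section \<open>From nonnegative window functionals to all bounded continuous functionals\<close>

context
  fixes p :: "real \<Rightarrow> real ^ 'n \<Rightarrow> real ^ 'n \<Rightarrow> real" and Q :: "(real \<Rightarrow> real ^ 'n) measure"
  assumes K1: "neumann_heat_kernel 1 p" and Q: "two_sided_stationary_law p Q"
begin

text \<open>The average over the trimmed interval depends only on times in
  \<open>[D, S - D]\<close>, so its squared deviation from \<open>c\<close> is a nonnegative
  functional to which the domination applies. The stationary variance bound then controls the loop,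
  and trimming costs a multiple of \<open>1 / S\<close>.\<close>

lemma self_averaging_nonneg_window:
  fixes g :: "(real \<Rightarrow> real ^ 'n) \<Rightarrow> real"
  assumes r: "0 < r" and g: "continuous_map mark_path_topology euclideanreal g"
    and w: "window_functional {-r..r} g" and b: "\<And>\<gamma>. \<gamma> \<in> mark_paths \<Longrightarrow> 0 \<le> g \<gamma> \<and> g \<gamma> \<le> M"
  shows "self_averaging g (\<integral>\<gamma>. g \<gamma> \<partial>Q)"
  unfolding self_averaging_def
proof (intro allI impI)
  fix \<epsilon> :: real assume \<epsilon>: "0 < \<epsilon>"
  interpret Q: prob_space Q by (rule stationary_law_space(1)[OF K1 Q])
  note spQ = stationary_law_space(3)[OF K1 Q]
  define c where "c = (\<integral>\<gamma>. g \<gamma> \<partial>Q)"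
  \<comment> \<open>The final error has four parts of size \<open>\<epsilon> / 4\<close>: trimming,
    \<open>\<kappa>\<close>, and the two terms of the second moment, multiplied by 9/2 and divided
    by \<open>\<kappa>\<close>. The choice of \<open>\<eta>\<close> settles the mixing term; the 1
    in \<open>C\<close> avoids division by 0 when \<open>c = 0\<close>.\<close>
  define \<kappa> where "\<kappa> = \<epsilon> / 4"
  define C where "C = c\<^sup>2 + 1"
  define \<eta> where "\<eta> = \<epsilon> * \<kappa> / (18 * C)"
  have \<kappa>: "0 < \<kappa>" using \<epsilon> by (simp add: \<kappa>_def)
  have c1: "0 < C" by (simp add: C_def add_nonneg_pos)
  have \<eta>: "0 < \<eta>" using \<epsilon> \<kappa> c1 by (simp add: \<eta>_def)
  have M: "0 \<le> M" using b[of "\<lambda>_. 0"] by (auto simp: mem_mark_paths mem_closed_cube)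
  have b': "\<bar>g \<gamma>\<bar> \<le> M" if "\<gamma> \<in> mark_paths" for \<gamma> using b[OF that] by simp
  have c: "0 \<le> c" "c \<le> M"
  proof -
    have i: "integrable Q g"
      using b' stationary_law_measurable[OF K1 Q g]
      by (intro Q.integrable_const_bound[where B=M] AE_I2) (auto simp: spQ)
    show "0 \<le> c" unfolding c_def using b by (intro integral_nonneg_AE AE_I2) (auto simp: spQ)
    show "c \<le> M" unfolding c_def using b by (intro Q.integral_le_const i AE_I2) (auto simp: spQ)
  qed
  obtain D1 where D1: "0 < D1" "\<And>s x y :: real ^ 'n. D1 \<le> s \<Longrightarrow> \<bar>neumann_kernel s x y - 1\<bar> \<le> \<eta>"
    using neumann_kernel_ergodic[OF \<eta>] by metis
  obtain D2 where D2: "0 < D2" "\<And>s x y :: real ^ 'n. D2 \<le> s \<Longrightarrow> \<bar>neumann_kernel s x y - 1\<bar> \<le> 1 / 2"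
    using neumann_kernel_ergodic[of "1 / 2"] by auto
  define D where "D = max D1 D2"
  have D: "0 < D" using D1 by (simp add: D_def)
  have up: "neumann_kernel s x y \<le> 1 + \<eta>" if "D \<le> s" for s and x y :: "real ^ 'n"
    using D1(2)[of s x y] that by (auto simp: D_def abs_le_iff)
  have near: "\<bar>neumann_kernel s x y - 1\<bar> \<le> 1 / 2" if "D \<le> s" for s and x y :: "real ^ 'n"
    using D2(2)[of s x y] that by (auto simp: D_def)
  \<comment> \<open>\<open>l0\<close> is the length from which the diagonal term, multiplied by 9/2,
    is at most \<open>\<kappa> * \<epsilon> / 4\<close>; the third summand of \<open>S0\<close>
    makes the trimming error \<open>2 * M * (D + r) / S\<close> at most
    \<open>\<epsilon> / 4\<close>.\<close>
  define l0 where "l0 = 36 * (D + 2 * r) * M\<^sup>2 / (\<kappa> * \<epsilon>)"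
  define S0 where "S0 = 2 * (D + r) + l0 + 8 * M * (D + r) / \<epsilon> + 1"
  have l0: "0 \<le> l0" using D r \<kappa> \<epsilon> by (simp add: l0_def)
  have err0: "0 \<le> 8 * M * (D + r) / \<epsilon>" using D r M \<epsilon> by simp
  show "\<forall>\<^sub>F S in at_top. \<forall>L T q B. 0 < L \<longrightarrow> neumann_heat_kernel L q \<longrightarrow> bridge_kernel L q T B \<longrightarrow> T / L\<^sup>2 = S \<longrightarrow>
     (\<integral>\<omega>. \<bar>time_average 0 S g (rescaled_loop L T \<omega>) - (\<integral>\<gamma>. g \<gamma> \<partial>Q)\<bar> \<partial>loop_law L q T B) \<le> \<epsilon>"
    unfolding c_def[symmetric]
  proof (rule eventually_mono[OF eventually_ge_at_top[of S0]], intro allI impI)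
    fix S L T :: real and q :: "real \<Rightarrow> real ^ 'n \<Rightarrow> real ^ 'n \<Rightarrow> real" and B :: "real ^ 'n \<Rightarrow> (real \<Rightarrow> real ^ 'n) measure"
    assume S0: "S0 \<le> S" and L: "0 < L" and K: "neumann_heat_kernel L q" and B: "bridge_kernel L q T B"
      and S: "T / L\<^sup>2 = S"
    \<comment> \<open>Trimming by \<open>r\<close> beyond \<open>D\<close> keeps the whole windows
      \<open>[u - r, u + r]\<close> at distance \<open>D\<close> from both ends.\<close>
    define \<alpha> where "\<alpha> = D + r"
    define \<beta> where "\<beta> = S - D - r"
    have S1: "2 * (D + r) + l0 + 1 \<le> S" "8 * M * (D + r) / \<epsilon> \<le> S"
      using S0 l0 err0 D r by (auto simp: S0_def)
    have TD: "2 * D < T / L\<^sup>2" using S1(1) l0 r S by simp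
    have \<alpha>\<beta>: "0 \<le> \<alpha>" "\<alpha> < \<beta>" "\<beta> \<le> S" using S1(1) l0 r D by (auto simp: \<alpha>_def \<beta>_def)
    have Spos: "0 < S" using S1(1) l0 D r by simp
    note loop = K1 Q L K B D near TD
    let ?P = "loop_law L q T B"
    interpret P: prob_space ?P by (rule loop_law_space(1)[OF loop])
    note spP = loop_law_space(3)[OF loop]
    define A where "A = time_average \<alpha> \<beta> g"
    define G where "G \<gamma> = (A \<gamma> - c)\<^sup>2" for \<gamma>
    have contA: "continuous_map mark_path_topology euclideanreal A"
      unfolding A_def by (rule continuous_map_time_average[OF \<alpha>\<beta>(2) g b'])
    have contA0: "continuous_map mark_path_topology euclideanreal (time_average 0 S g)"
      by (rule continuous_map_time_average[OF Spos g b'])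
    have contG: "continuous_map mark_path_topology euclideanreal G"
      unfolding G_def by (intro continuous_map_mark_pathI tendsto_intros continuous_map_mark_pathD[OF contA])
    have winG: "window_functional {D..S - D} G"
    proof -
      have wA: "window_functional {D..S - D} A"
        using window_functional_time_average[OF \<alpha>\<beta>(2) g w] by (simp add: A_def \<alpha>_def \<beta>_def)
      show ?thesis
        unfolding window_functional_def G_def
      proof (intro ballI impI)
        fix \<gamma> \<gamma>' :: "real \<Rightarrow> real ^ 'n"
        assume "\<gamma> \<in> mark_paths" "\<gamma>' \<in> mark_paths" "\<forall>t\<in>{D..S - D}. \<gamma> t = \<gamma>' t"
        then have "A \<gamma> = A \<gamma>'" by (intro window_functionalD[OF wA]) auto
        then show "(A \<gamma> - c)\<^sup>2 = (A \<gamma>' - c)\<^sup>2" by simp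
      qed
    qed
    have A: "0 \<le> A \<gamma>" "A \<gamma> \<le> M" if "\<gamma> \<in> mark_paths" for \<gamma>
      unfolding A_def using time_average_bounds[OF \<alpha>\<beta>(2) g b that] by auto
    have G: "0 \<le> G \<gamma> \<and> G \<gamma> \<le> M\<^sup>2" if "\<gamma> \<in> mark_paths" for \<gamma>
      unfolding G_def using A[OF that] c M by (auto intro!: power2_le_iff_abs_le[THEN iffD2])
    have Y: "rescaled_loop L T \<omega> \<in> mark_paths" if "\<omega> \<in> space ?P" for \<omega>
      using that rescaled_loop_mark_paths[OF L T_pos[OF loop]] spP by blast
    have meas: "(\<lambda>\<omega>. F (rescaled_loop L T \<omega>)) \<in> borel_measurable ?P"
      if "continuous_map mark_path_topology euclideanreal F" for F
      using loop_functional_measurable[OF loop that] loop_law_space(2)[OF loop]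
      by (simp cong: measurable_cong_sets)
    have intG: "integrable ?P (\<lambda>\<omega>. G (rescaled_loop L T \<omega>))"
      using G[OF Y] meas[OF contG] by (intro P.integrable_const_bound[where B="M\<^sup>2"] AE_I2) auto
    have EG: "(\<integral>\<omega>. G (rescaled_loop L T \<omega>) \<partial>?P) \<le> 9 / 2 * (2 * (D + 2 * r) * M\<^sup>2 / (\<beta> - \<alpha>) + \<eta> * c\<^sup>2)"
    proof -
      have "(\<integral>\<omega>. G (rescaled_loop L T \<omega>) \<partial>?P) \<le> 9 / 2 * (\<integral>\<gamma>. G \<gamma> \<partial>Q)"
        by (rule loop_functional_bound[OF loop, where a=D and b="S - D", OF _ order_refl _ _ contG winG G])
           (use S1(1) l0 r S in auto)
      also have "(\<integral>\<gamma>. G \<gamma> \<partial>Q) \<le> 2 * (D + (r - (- r))) * M\<^sup>2 / (\<beta> - \<alpha>) + \<eta> * c\<^sup>2"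
        unfolding G_def A_def c_def
        by (rule time_average_second_moment[OF K1 Q _ g w b less_imp_le[OF \<eta>] up D \<alpha>\<beta>(2)]) (use r in auto)
      finally show ?thesis by (simp add: algebra_simps)
    qed
    \<comment> \<open>Passes from the second moment to the first moment without a square root: small
      deviations cost \<open>\<kappa>\<close>, larger ones are dominated by the square.\<close>
    have abs_le: "\<bar>x\<bar> \<le> \<kappa> + x\<^sup>2 / \<kappa>" for x :: real
    proof (cases "\<bar>x\<bar> \<le> \<kappa>")
      case False
      then have "\<kappa> * \<bar>x\<bar> \<le> \<bar>x\<bar> * \<bar>x\<bar>" by (intro mult_right_mono) auto
      then have "\<bar>x\<bar> \<le> x\<^sup>2 / \<kappa>" using \<kappa> by (simp add: pos_le_divide_eq power2_eq_square mult.commute)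
      then show ?thesis using \<kappa> by simp
    qed (use \<kappa> in \<open>simp add: add_increasing2\<close>)
    have pw: "\<bar>time_average 0 S g \<gamma> - c\<bar> \<le> \<epsilon> / 4 + \<kappa> + G \<gamma> / \<kappa>" if \<gamma>: "\<gamma> \<in> mark_paths" for \<gamma>
    proof -
      have "\<bar>time_average 0 S g \<gamma> - A \<gamma>\<bar> \<le> M * (S - (\<beta> - \<alpha>)) / S"
        unfolding A_def by (rule time_average_compare[OF \<alpha>\<beta> g b \<gamma>])
      also have "\<dots> = 2 * M * (D + r) / S" by (simp add: \<alpha>_def \<beta>_def)
      also have "\<dots> \<le> \<epsilon> / 4" using S1(2) Spos \<epsilon> by (simp add: field_simps)
      finally have "\<bar>time_average 0 S g \<gamma> - A \<gamma>\<bar> \<le> \<epsilon> / 4" .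
      moreover have "\<bar>A \<gamma> - c\<bar> \<le> \<kappa> + G \<gamma> / \<kappa>" unfolding G_def by (rule abs_le)
      ultimately show ?thesis by linarith
    qed
    have "(\<integral>\<omega>. \<bar>time_average 0 S g (rescaled_loop L T \<omega>) - c\<bar> \<partial>?P) \<le>
        (\<integral>\<omega>. \<epsilon> / 4 + \<kappa> + G (rescaled_loop L T \<omega>) / \<kappa> \<partial>?P)"
    proof (rule integral_mono)
      have "\<bar>time_average 0 S g \<gamma> - c\<bar> \<le> M" if "\<gamma> \<in> mark_paths" for \<gamma>
        using time_average_bounds[OF Spos g b that] c by (simp add: abs_le_iff)
      then show "integrable ?P (\<lambda>\<omega>. \<bar>time_average 0 S g (rescaled_loop L T \<omega>) - c\<bar>)"
        using meas[OF contA0] Y by (intro P.integrable_const_bound[where B=M] AE_I2) auto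
      show "integrable ?P (\<lambda>\<omega>. \<epsilon> / 4 + \<kappa> + G (rescaled_loop L T \<omega>) / \<kappa>)"
        using intG by (intro Bochner_Integration.integrable_add integrable_divide) auto
    qed (use pw[OF Y] in auto)
    also have "\<dots> = \<epsilon> / 4 + \<kappa> + (\<integral>\<omega>. G (rescaled_loop L T \<omega>) \<partial>?P) / \<kappa>"
      using intG by (simp add: P.prob_space)
    also have "\<dots> \<le> \<epsilon> / 4 + \<epsilon> / 4 + (\<epsilon> / 4 + \<epsilon> / 4)"
    proof -
      have l: "l0 \<le> \<beta> - \<alpha>" "0 < \<beta> - \<alpha>" using S1(1) \<alpha>\<beta> by (auto simp: \<alpha>_def \<beta>_def)
      have "36 * (D + 2 * r) * M\<^sup>2 / (\<kappa> * \<epsilon>) \<le> \<beta> - \<alpha>" using l(1) by (simp add: l0_def)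
      then have "36 * (D + 2 * r) * M\<^sup>2 \<le> (\<beta> - \<alpha>) * (\<kappa> * \<epsilon>)" using \<kappa> \<epsilon> by (simp add: pos_divide_le_eq)
      then have 1: "9 / 2 * (2 * (D + 2 * r) * M\<^sup>2 / (\<beta> - \<alpha>)) \<le> \<kappa> * \<epsilon> / 4"
        using l(2) by (simp add: field_simps)
      have "\<eta> * c\<^sup>2 \<le> \<eta> * C" using \<eta> by (intro mult_left_mono) (auto simp: C_def)
      also have "\<dots> = \<epsilon> * \<kappa> / 18" using c1 by (simp add: \<eta>_def)
      finally have 2: "9 / 2 * (\<eta> * c\<^sup>2) \<le> \<kappa> * \<epsilon> / 4" by (simp add: mult_ac)
      have "(\<integral>\<omega>. G (rescaled_loop L T \<omega>) \<partial>?P) \<le> \<kappa> * (\<epsilon> / 4 + \<epsilon> / 4)"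
        using EG 1 2 by (simp add: distrib_left)
      then have "(\<integral>\<omega>. G (rescaled_loop L T \<omega>) \<partial>?P) / \<kappa> \<le> \<epsilon> / 4 + \<epsilon> / 4"
        using \<kappa> by (simp add: pos_divide_le_eq mult.commute)
      then show ?thesis by (simp add: \<kappa>_def)
    qed
    also have "\<dots> = \<epsilon>" by simp
    finally show "(\<integral>\<omega>. \<bar>time_average 0 S g (rescaled_loop L T \<omega>) - c\<bar> \<partial>?P) \<le> \<epsilon>" .
  qed
qed

lemma time_average_add_const:
  assumes "0 < S" "continuous_map mark_path_topology euclideanreal f"
    and "\<And>\<gamma>. \<gamma> \<in> mark_paths \<Longrightarrow> \<bar>f \<gamma>\<bar> \<le> M" and "\<gamma> \<in> mark_paths"
  shows "time_average 0 S (\<lambda>\<gamma>. f \<gamma> + a) \<gamma> = time_average 0 S f \<gamma> + a"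
proof -
  interpret prob_space "uniform_measure lborel {0..S}" by (rule prob_space_uniform_Icc) fact
  show ?thesis
    using uniform_Icc_integrable[OF assms] prob_space unfolding time_average_def
    by (subst Bochner_Integration.integral_add) (auto simp del: measure_uniform_measure)
qed

lemma time_average_mono:
  assumes "0 < S" "continuous_map mark_path_topology euclideanreal f" "continuous_map mark_path_topology euclideanreal g"
    and "\<And>\<gamma>. \<gamma> \<in> mark_paths \<Longrightarrow> \<bar>f \<gamma>\<bar> \<le> M" "\<And>\<gamma>. \<gamma> \<in> mark_paths \<Longrightarrow> \<bar>g \<gamma>\<bar> \<le> M"
    and "\<And>\<gamma>. \<gamma> \<in> mark_paths \<Longrightarrow> f \<gamma> \<le> g \<gamma>" and "\<gamma> \<in> mark_paths"
  shows "time_average 0 S f \<gamma> \<le> time_average 0 S g \<gamma>"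
  unfolding time_average_def
  by (intro integral_mono uniform_Icc_integrable[OF assms(1,2,4,7)] uniform_Icc_integrable[OF assms(1,3,5,7)]
      assms(6) shift_mark_paths[OF assms(7)])

lemma time_average_uminus: "time_average 0 S (\<lambda>\<gamma>. - f \<gamma>) \<gamma> = - time_average 0 S f \<gamma>"
  by (simp add: time_average_def)

lemma stationary_law_integrable:
  assumes "continuous_map mark_path_topology euclideanreal f" "\<And>\<gamma>. \<gamma> \<in> mark_paths \<Longrightarrow> \<bar>f \<gamma>\<bar> \<le> M"
  shows "integrable Q f"
proof -
  interpret prob_space Q by (rule stationary_law_space(1)[OF K1 Q])
  show ?thesis
    using assms(2) stationary_law_measurable[OF K1 Q assms(1)]
    by (intro integrable_const_bound[where B=M] AE_I2) (auto simp: stationary_law_space(3)[OF K1 Q])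
qed

text \<open>Adding \<open>M\<close> makes the functional nonnegative and moves its time average and
  its mean by the same amount, so the deviation is unchanged.\<close>

lemma self_averaging_window:
  fixes n :: nat
  assumes g: "continuous_map mark_path_topology euclideanreal g"
    and w: "window_functional {- real n..real n} g" and b: "\<And>\<gamma>. \<gamma> \<in> mark_paths \<Longrightarrow> \<bar>g \<gamma>\<bar> \<le> M"
  shows "self_averaging g (\<integral>\<gamma>. g \<gamma> \<partial>Q)"
proof -
  interpret Q: prob_space Q by (rule stationary_law_space(1)[OF K1 Q])
  let ?h = "\<lambda>\<gamma>. g \<gamma> + M"
  have h: "continuous_map mark_path_topology euclideanreal ?h"
    by (intro continuous_map_mark_pathI tendsto_intros continuous_map_mark_pathD[OF g])
  \<comment> \<open>\<open>Suc n\<close> instead of \<open>n\<close>, because the radius must be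
    positive and \<open>n\<close> may be 0.\<close>
  have "window_functional {- real (Suc n)..real (Suc n)} g"
    by (rule window_functional_mono[OF w]) auto
  then have wh: "window_functional {- real (Suc n)..real (Suc n)} ?h"
    unfolding window_functional_def by metis
  have bh: "0 \<le> ?h \<gamma> \<and> ?h \<gamma> \<le> 2 * M" if "\<gamma> \<in> mark_paths" for \<gamma> using b[OF that] by (auto simp: abs_le_iff)
  have ih: "(\<integral>\<gamma>. ?h \<gamma> \<partial>Q) = (\<integral>\<gamma>. g \<gamma> \<partial>Q) + M"
    using stationary_law_integrable[OF g b] by (simp add: Q.prob_space)
  have sh: "self_averaging ?h ((\<integral>\<gamma>. g \<gamma> \<partial>Q) + M)"
    using self_averaging_nonneg_window[OF _ h wh bh] by (simp add: ih)
  obtain D where D: "0 < D" "\<And>s x y :: real ^ 'n. D \<le> s \<Longrightarrow> \<bar>neumann_kernel s x y - 1\<bar> \<le> 1 / 2"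
    using neumann_kernel_ergodic[of "1 / 2"] by auto
  show ?thesis
    unfolding self_averaging_def
  proof (intro allI impI)
    fix \<epsilon> :: real assume "0 < \<epsilon>"
    with sh have "\<forall>\<^sub>F S in at_top. \<forall>L T q B. 0 < L \<longrightarrow> neumann_heat_kernel L q \<longrightarrow> bridge_kernel L q T B \<longrightarrow> T / L\<^sup>2 = S \<longrightarrow>
     (\<integral>\<omega>. \<bar>time_average 0 S ?h (rescaled_loop L T \<omega>) - ((\<integral>\<gamma>. g \<gamma> \<partial>Q) + M)\<bar> \<partial>loop_law L q T B) \<le> \<epsilon>"
      unfolding self_averaging_def by blast
    then show "\<forall>\<^sub>F S in at_top. \<forall>L T q B. 0 < L \<longrightarrow> neumann_heat_kernel L q \<longrightarrow> bridge_kernel L q T B \<longrightarrow> T / L\<^sup>2 = S \<longrightarrow>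
     (\<integral>\<omega>. \<bar>time_average 0 S g (rescaled_loop L T \<omega>) - (\<integral>\<gamma>. g \<gamma> \<partial>Q)\<bar> \<partial>loop_law L q T B) \<le> \<epsilon>"
      using eventually_gt_at_top[of "2 * D"]
    proof eventually_elim
      case (elim S)
      show ?case
      proof (intro allI impI)
        fix L T :: real and q :: "real \<Rightarrow> real ^ 'n \<Rightarrow> real ^ 'n \<Rightarrow> real" and B :: "real ^ 'n \<Rightarrow> (real \<Rightarrow> real ^ 'n) measure"
        assume L: "0 < L" and K: "neumann_heat_kernel L q" and B: "bridge_kernel L q T B" and S: "T / L\<^sup>2 = S"
        have TD: "2 * D < T / L\<^sup>2" using elim S by simp
        note loop = K1 Q L K B D TD
        have "(\<integral>\<omega>. \<bar>time_average 0 S g (rescaled_loop L T \<omega>) - (\<integral>\<gamma>. g \<gamma> \<partial>Q)\<bar> \<partial>loop_law L q T B) =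
          (\<integral>\<omega>. \<bar>time_average 0 S ?h (rescaled_loop L T \<omega>) - ((\<integral>\<gamma>. g \<gamma> \<partial>Q) + M)\<bar> \<partial>loop_law L q T B)"
        proof (rule Bochner_Integration.integral_cong[OF refl])
          fix \<omega> assume "\<omega> \<in> space (loop_law L q T B)"
          then have "rescaled_loop L T \<omega> \<in> mark_paths"
            using rescaled_loop_mark_paths[OF L T_pos[OF loop]] loop_law_space(3)[OF loop] by blast
          then have "time_average 0 S ?h (rescaled_loop L T \<omega>) = time_average 0 S g (rescaled_loop L T \<omega>) + M"
            using elim D(1) by (intro time_average_add_const[OF _ g b]) auto
          then show "\<bar>time_average 0 S g (rescaled_loop L T \<omega>) - (\<integral>\<gamma>. g \<gamma> \<partial>Q)\<bar> =
              \<bar>time_average 0 S ?h (rescaled_loop L T \<omega>) - ((\<integral>\<gamma>. g \<gamma> \<partial>Q) + M)\<bar>" by simp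
        qed
        also have "\<dots> \<le> \<epsilon>" using elim(1) L K B S by blast
        finally show "(\<integral>\<omega>. \<bar>time_average 0 S g (rescaled_loop L T \<omega>) - (\<integral>\<gamma>. g \<gamma> \<partial>Q)\<bar> \<partial>loop_law L q T B) \<le> \<epsilon>" .
      qed
    qed
  qed
qed

text \<open>A sandwich \<open>g1 \<le> f \<le> - g2\<close> with means within
  \<open>\<epsilon> / 4\<close> of that of \<open>f\<close>: an upward deviation of the time average
  of \<open>f\<close> is paid for by \<open>g2\<close>, a downward one by \<open>g1\<close>, so
  their sum plus \<open>\<epsilon> / 4\<close> bounds the absolute value.\<close>

theorem self_averaging_bounded_continuous:
  assumes f: "continuous_map mark_path_topology euclideanreal f"
    and b: "\<And>\<gamma>. \<gamma> \<in> mark_paths \<Longrightarrow> \<bar>f \<gamma>\<bar> \<le> M"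
  shows "self_averaging f (\<integral>\<gamma>. f \<gamma> \<partial>Q)"
  unfolding self_averaging_def
proof (intro allI impI)
  fix \<epsilon> :: real assume \<epsilon>: "0 < \<epsilon>"
  interpret Q: prob_space Q by (rule stationary_law_space(1)[OF K1 Q])
  have Qp: "Q \<in> space (prob_algebra (borel_of mark_path_topology))"
    using Q by (simp add: two_sided_stationary_law_def)
  have f': "continuous_map mark_path_topology euclideanreal (\<lambda>\<gamma>. - f \<gamma>)"
    by (intro continuous_map_mark_pathI tendsto_intros continuous_map_mark_pathD[OF f])
  have b': "\<bar>- f \<gamma>\<bar> \<le> M" if "\<gamma> \<in> mark_paths" for \<gamma> using b[OF that] by simp
  have e4: "0 < \<epsilon> / 4" using \<epsilon> by simp
  obtain n1 g1 where g1: "continuous_map mark_path_topology euclideanreal g1" "window_functional {- real n1..real n1} g1"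
    and g1b: "\<forall>\<gamma>\<in>mark_paths. \<bar>g1 \<gamma>\<bar> \<le> M \<and> g1 \<gamma> \<le> f \<gamma>" and g1e: "(\<integral>\<gamma>. f \<gamma> \<partial>Q) - (\<integral>\<gamma>. g1 \<gamma> \<partial>Q) < \<epsilon> / 4"
    using envelope_integral_approx[OF f b Qp e4] by blast
  obtain n2 g2 where g2: "continuous_map mark_path_topology euclideanreal g2" "window_functional {- real n2..real n2} g2"
    and g2b: "\<forall>\<gamma>\<in>mark_paths. \<bar>g2 \<gamma>\<bar> \<le> M \<and> g2 \<gamma> \<le> - f \<gamma>" and g2e: "(\<integral>\<gamma>. - f \<gamma> \<partial>Q) - (\<integral>\<gamma>. g2 \<gamma> \<partial>Q) < \<epsilon> / 4"
    using envelope_integral_approx[OF f' b' Qp e4] by blast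
  define c where "c = (\<integral>\<gamma>. f \<gamma> \<partial>Q)"
  define c1 where "c1 = (\<integral>\<gamma>. g1 \<gamma> \<partial>Q)"
  define c2 where "c2 = (\<integral>\<gamma>. g2 \<gamma> \<partial>Q)"
  have e: "c - c1 < \<epsilon> / 4" "- c - c2 < \<epsilon> / 4"
    using g1e g2e by (simp_all add: c_def c1_def c2_def)
  have sa1: "self_averaging g1 c1" unfolding c1_def
    by (rule self_averaging_window[OF g1, where M=M]) (use g1b in blast)
  have sa2: "self_averaging g2 c2" unfolding c2_def
    by (rule self_averaging_window[OF g2, where M=M]) (use g2b in blast)
  obtain D where D: "0 < D" "\<And>s x y :: real ^ 'n. D \<le> s \<Longrightarrow> \<bar>neumann_kernel s x y - 1\<bar> \<le> 1 / 2"
    using neumann_kernel_ergodic[of "1 / 2"] by auto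
  show "\<forall>\<^sub>F S in at_top. \<forall>L T q B. 0 < L \<longrightarrow> neumann_heat_kernel L q \<longrightarrow> bridge_kernel L q T B \<longrightarrow> T / L\<^sup>2 = S \<longrightarrow>
     (\<integral>\<omega>. \<bar>time_average 0 S f (rescaled_loop L T \<omega>) - (\<integral>\<gamma>. f \<gamma> \<partial>Q)\<bar> \<partial>loop_law L q T B) \<le> \<epsilon>"
    unfolding c_def[symmetric]
    using sa1[unfolded self_averaging_def, rule_format, OF e4] sa2[unfolded self_averaging_def, rule_format, OF e4]
      eventually_gt_at_top[of "2 * D"]
  proof eventually_elim
    case (elim S)
    show ?case
    proof (intro allI impI)
      fix L T :: real and q :: "real \<Rightarrow> real ^ 'n \<Rightarrow> real ^ 'n \<Rightarrow> real" and B :: "real ^ 'n \<Rightarrow> (real \<Rightarrow> real ^ 'n) measure"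
      assume L: "0 < L" and K: "neumann_heat_kernel L q" and B: "bridge_kernel L q T B" and S: "T / L\<^sup>2 = S"
      have TD: "2 * D < T / L\<^sup>2" using elim S by simp
      have Sp: "0 < S" using elim D by simp
      note loop = K1 Q L K B D TD
      let ?P = "loop_law L q T B"
      interpret P: prob_space ?P by (rule loop_law_space(1)[OF loop])
      have Y: "rescaled_loop L T \<omega> \<in> mark_paths" if "\<omega> \<in> space ?P" for \<omega>
        using that rescaled_loop_mark_paths[OF L T_pos[OF loop]] loop_law_space(3)[OF loop] by blast
      have int: "integrable ?P (\<lambda>\<omega>. \<bar>time_average 0 S F (rescaled_loop L T \<omega>) - d\<bar>)"
        if F: "continuous_map mark_path_topology euclideanreal F" "\<And>\<gamma>. \<gamma> \<in> mark_paths \<Longrightarrow> \<bar>F \<gamma>\<bar> \<le> M" for F d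
      proof -
        have cont: "continuous_map mark_path_topology euclideanreal (time_average 0 S F)"
          by (rule continuous_map_time_average[OF Sp F])
        have "(\<lambda>\<omega>. time_average 0 S F (rescaled_loop L T \<omega>)) \<in> borel_measurable ?P"
          using loop_functional_measurable[OF loop cont] loop_law_space(2)[OF loop]
          by (simp cong: measurable_cong_sets)
        moreover have "\<bar>\<bar>time_average 0 S F (rescaled_loop L T \<omega>) - d\<bar>\<bar> \<le> M + \<bar>d\<bar>" if "\<omega> \<in> space ?P" for \<omega>
          using time_average_abs_le[OF Sp F Y[OF that]] by linarith
        ultimately show ?thesis
          by (intro P.integrable_const_bound[where B="M + \<bar>d\<bar>"] AE_I2) auto
      qed
      have "(\<integral>\<omega>. \<bar>time_average 0 S f (rescaled_loop L T \<omega>) - c\<bar> \<partial>?P) \<le>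
         (\<integral>\<omega>. \<bar>time_average 0 S g1 (rescaled_loop L T \<omega>) - c1\<bar> + \<bar>time_average 0 S g2 (rescaled_loop L T \<omega>) - c2\<bar> + \<epsilon> / 4 \<partial>?P)"
      proof (rule integral_mono)
        show "integrable ?P (\<lambda>\<omega>. \<bar>time_average 0 S f (rescaled_loop L T \<omega>) - c\<bar>)" by (rule int[OF f b])
        show "integrable ?P (\<lambda>\<omega>. \<bar>time_average 0 S g1 (rescaled_loop L T \<omega>) - c1\<bar> + \<bar>time_average 0 S g2 (rescaled_loop L T \<omega>) - c2\<bar> + \<epsilon> / 4)"
          using int[OF g1(1)] int[OF g2(1)] g1b g2b by (intro Bochner_Integration.integrable_add) auto
        fix \<omega> assume "\<omega> \<in> space ?P"
        note Y' = Y[OF this]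
        have 1: "time_average 0 S g1 (rescaled_loop L T \<omega>) \<le> time_average 0 S f (rescaled_loop L T \<omega>)"
          by (rule time_average_mono[OF Sp g1(1) f _ b _ Y']) (use g1b in auto)
        have 2: "time_average 0 S g2 (rescaled_loop L T \<omega>) \<le> - time_average 0 S f (rescaled_loop L T \<omega>)"
          unfolding time_average_uminus[symmetric]
          by (rule time_average_mono[OF Sp g2(1) f' _ b' _ Y']) (use g2b in auto)
        show "\<bar>time_average 0 S f (rescaled_loop L T \<omega>) - c\<bar> \<le>
            \<bar>time_average 0 S g1 (rescaled_loop L T \<omega>) - c1\<bar> + \<bar>time_average 0 S g2 (rescaled_loop L T \<omega>) - c2\<bar> + \<epsilon> / 4"
          using 1 2 e by linarith
      qed
      also have "\<dots> = (\<integral>\<omega>. \<bar>time_average 0 S g1 (rescaled_loop L T \<omega>) - c1\<bar> \<partial>?P) +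
          (\<integral>\<omega>. \<bar>time_average 0 S g2 (rescaled_loop L T \<omega>) - c2\<bar> \<partial>?P) + \<epsilon> / 4"
        using int[OF g1(1)] int[OF g2(1)] g1b g2b by (simp add: P.prob_space)
      also have "\<dots> \<le> \<epsilon> / 4 + \<epsilon> / 4 + \<epsilon> / 4"
        using elim(1,2) L K B S by (intro add_mono) auto
      also have "\<dots> \<le> \<epsilon>" using \<epsilon> by simp
      finally show "(\<integral>\<omega>. \<bar>time_average 0 S f (rescaled_loop L T \<omega>) - c\<bar> \<partial>?P) \<le> \<epsilon>" .
    qed
  qed
qed

end

section \<open>Convergence of the marks\<close>

lemma mark_eq:
  fixes \<omega> :: "real \<Rightarrow> real ^ 'n"
  assumes "rescaled_loop L T \<omega> \<in> mark_paths"
  shows "mark L T \<omega> = distr (uniform_measure lborel {0..T / L\<^sup>2}) (borel_of mark_path_topology)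
    (\<lambda>u. shift u (rescaled_loop L T \<omega>))"
  unfolding mark_def using measurable_shift_time[OF assms]
  by (intro bind_return_distr') (auto cong: measurable_cong_sets)

lemma mark_prob:
  fixes \<omega> :: "real \<Rightarrow> real ^ 'n"
  assumes "rescaled_loop L T \<omega> \<in> mark_paths" "0 < T / L\<^sup>2"
  shows "mark L T \<omega> \<in> space (prob_algebra (borel_of mark_path_topology))"
  unfolding mark_eq[OF assms(1)] space_prob_algebra
  using prob_space_uniform_Icc[OF assms(2)] measurable_shift_time[OF assms(1)]
  by (auto intro!: prob_space.prob_space_distr cong: measurable_cong_sets)

lemma integral_mark:
  fixes f :: "(real \<Rightarrow> real ^ 'n) \<Rightarrow> real"
  assumes "rescaled_loop L T \<omega> \<in> mark_paths" "continuous_map mark_path_topology euclideanreal f"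
  shows "(\<integral>\<gamma>. f \<gamma> \<partial>mark L T \<omega>) = time_average 0 (T / L\<^sup>2) f (rescaled_loop L T \<omega>)"
  unfolding mark_eq[OF assms(1)] time_average_def
  using measurable_shift_time[OF assms(1)] borel_measurable_continuous_map[OF assms(2)]
  by (intro integral_distr) (auto cong: measurable_cong_sets)

section \<open>The weak topology and the law of the mark\<close>

lemma topspace_weak_topology: "topspace (weak_topology X) = space (prob_algebra (borel_of X))"
proof -
  have "space (prob_algebra (borel_of X)) \<in> {{\<mu> \<in> space (prob_algebra (borel_of X)). (\<integral>x. f x \<partial>\<mu>) \<in> U} | f U.
      continuous_map X euclideanreal f \<and> bounded (f ` topspace X) \<and> open (U :: real set)}"
    by (rule CollectI, rule exI[of _ "\<lambda>_. 0"], rule exI[of _ UNIV]) (auto simp: bounded_iff)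
  then show ?thesis
    unfolding weak_topology_def topology_generated_by_topspace by blast
qed

text \<open>Supplies the measurability of \<open>mark\<close> behind \<open>mark_law\<close>. On the
  generating sets the condition reads as continuity of a time average composed with the
  rescaling.\<close>

lemma continuous_map_mark:
  assumes L: "0 < L" and T: "0 < T"
  shows "continuous_map (loop_topology L T) (weak_topology (mark_path_topology :: (real \<Rightarrow> real ^ 'n) topology)) (mark L T)"
proof -
  have S: "0 < T / L\<^sup>2" using L T by simp
  have Y: "rescaled_loop L T \<omega> \<in> mark_paths" if "\<omega> \<in> loop_paths L T" for \<omega> :: "real \<Rightarrow> real ^ 'n"
    using rescaled_loop_mark_paths[OF L T that] .
  show ?thesis
    unfolding weak_topology_def
  proof (rule continuous_on_generated_topo)
    fix W assume "W \<in> {{\<mu> \<in> space (prob_algebra (borel_of mark_path_topology)). (\<integral>x. f x \<partial>\<mu>) \<in> U} | f U.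
        continuous_map (mark_path_topology :: (real \<Rightarrow> real ^ 'n) topology) euclideanreal f \<and>
        bounded (f ` topspace mark_path_topology) \<and> open (U :: real set)}"
    then obtain f and U :: "real set" where W: "W = {\<mu> \<in> space (prob_algebra (borel_of mark_path_topology)). (\<integral>x. f x \<partial>\<mu>) \<in> U}"
      and f: "continuous_map (mark_path_topology :: (real \<Rightarrow> real ^ 'n) topology) euclideanreal f"
      and bf: "bounded (f ` topspace mark_path_topology)" and U: "open U" by blast
    obtain M where M: "\<And>\<gamma>. \<gamma> \<in> mark_paths \<Longrightarrow> \<bar>f \<gamma>\<bar> \<le> M"
      using bf by (auto simp: bounded_iff)
    have "continuous_map (loop_topology L T) euclideanreal (time_average 0 (T / L\<^sup>2) f \<circ> rescaled_loop L T)"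
      by (rule continuous_map_compose[OF continuous_map_rescaled_loop[OF L T] continuous_map_time_average[OF S f M]])
    then have "openin (loop_topology L T)
        {\<omega> \<in> topspace (loop_topology L T). (time_average 0 (T / L\<^sup>2) f \<circ> rescaled_loop L T) \<omega> \<in> U}"
      by (rule openin_continuous_map_preimage) (use U in simp)
    also have "{\<omega> \<in> topspace (loop_topology L T). (time_average 0 (T / L\<^sup>2) f \<circ> rescaled_loop L T) \<omega> \<in> U}
        = mark L T -` W \<inter> topspace (loop_topology L T)"
      unfolding W using mark_prob[OF Y S] integral_mark[OF Y f] by auto
    finally show "openin (loop_topology L T) (mark L T -` W \<inter> topspace (loop_topology L T))" .
  next
    have "\<Union>{{\<mu> \<in> space (prob_algebra (borel_of mark_path_topology)). (\<integral>x. f x \<partial>\<mu>) \<in> U} | f U.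
        continuous_map (mark_path_topology :: (real \<Rightarrow> real ^ 'n) topology) euclideanreal f \<and>
        bounded (f ` topspace mark_path_topology) \<and> open (U :: real set)} = space (prob_algebra (borel_of mark_path_topology))"
      using topspace_weak_topology[of "mark_path_topology :: (real \<Rightarrow> real ^ 'n) topology"]
      unfolding weak_topology_def topology_generated_by_topspace .
    then show "mark L T ` topspace (loop_topology L T) \<subseteq> \<Union>{{\<mu> \<in> space (prob_algebra (borel_of mark_path_topology)). (\<integral>x. f x \<partial>\<mu>) \<in> U} | f U.
        continuous_map (mark_path_topology :: (real \<Rightarrow> real ^ 'n) topology) euclideanreal f \<and>
        bounded (f ` topspace mark_path_topology) \<and> open (U :: real set)}"
      using mark_prob[OF Y S] by auto
  qed
qed

text \<open>Induction over the generated topology yields a basic neighbourhood with finitely many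
  test functions and a single tolerance. This is the form in which separate mean deviation bounds
  can be summed.\<close>

lemma openin_weak_topologyD:
  assumes "openin (weak_topology X) W" "\<mu> \<in> W"
  shows "\<exists>F e. finite F \<and> 0 < (e :: real) \<and>
    (\<forall>f\<in>F. continuous_map X euclideanreal f \<and> bounded (f ` topspace X)) \<and>
    (\<forall>\<nu>\<in>space (prob_algebra (borel_of X)). (\<forall>f\<in>F. \<bar>(\<integral>x. f x \<partial>\<nu>) - (\<integral>x. f x \<partial>\<mu>)\<bar> < e) \<longrightarrow> \<nu> \<in> W)"
proof -
  have "generate_topology_on {{\<mu> \<in> space (prob_algebra (borel_of X)). (\<integral>x. f x \<partial>\<mu>) \<in> U} | f U.
        continuous_map X euclideanreal f \<and> bounded (f ` topspace X) \<and> open (U :: real set)} W"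
    using assms(1) by (simp add: weak_topology_def openin_topology_generated_by_iff)
  then show ?thesis using assms(2)
  proof induction
    case Empty
    then show ?case by simp
  next
    case (Int a b)
    obtain F1 e1 where 1: "finite F1" "0 < e1" "\<forall>f\<in>F1. continuous_map X euclideanreal f \<and> bounded (f ` topspace X)"
      "\<forall>\<nu>\<in>space (prob_algebra (borel_of X)). (\<forall>f\<in>F1. \<bar>(\<integral>x. f x \<partial>\<nu>) - (\<integral>x. f x \<partial>\<mu>)\<bar> < e1) \<longrightarrow> \<nu> \<in> a"
      using Int by blast
    obtain F2 e2 where 2: "finite F2" "0 < e2" "\<forall>f\<in>F2. continuous_map X euclideanreal f \<and> bounded (f ` topspace X)"
      "\<forall>\<nu>\<in>space (prob_algebra (borel_of X)). (\<forall>f\<in>F2. \<bar>(\<integral>x. f x \<partial>\<nu>) - (\<integral>x. f x \<partial>\<mu>)\<bar> < e2) \<longrightarrow> \<nu> \<in> b"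
      using Int by blast
    show ?case
    proof (rule exI[of _ "F1 \<union> F2"], rule exI[of _ "min e1 e2"], intro conjI ballI impI)
      fix \<nu> assume "\<nu> \<in> space (prob_algebra (borel_of X))"
        and "\<forall>f\<in>F1 \<union> F2. \<bar>(\<integral>x. f x \<partial>\<nu>) - (\<integral>x. f x \<partial>\<mu>)\<bar> < min e1 e2"
      then show "\<nu> \<in> a \<inter> b" using 1(4) 2(4) by simp
    qed (use 1 2 in auto)
  next
    case (UN k)
    then obtain k' where k': "k' \<in> k" "\<mu> \<in> k'" by auto
    from UN.IH[OF this] obtain F e where "finite F" "0 < e" "\<forall>f\<in>F. continuous_map X euclideanreal f \<and> bounded (f ` topspace X)"
      "\<forall>\<nu>\<in>space (prob_algebra (borel_of X)). (\<forall>f\<in>F. \<bar>(\<integral>x. f x \<partial>\<nu>) - (\<integral>x. f x \<partial>\<mu>)\<bar> < e) \<longrightarrow> \<nu> \<in> k'"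
      by blast
    with k' show ?case by (intro exI[of _ F] exI[of _ e]) auto
  next
    case (Basis s)
    then obtain f U where s: "s = {\<mu> \<in> space (prob_algebra (borel_of X)). (\<integral>x. f x \<partial>\<mu>) \<in> U}"
      and f: "continuous_map X euclideanreal f" "bounded (f ` topspace X)" and U: "open (U :: real set)" by blast
    have "(\<integral>x. f x \<partial>\<mu>) \<in> U" using Basis(2) s by simp
    then obtain e where e: "0 < e" "\<And>y. dist y (\<integral>x. f x \<partial>\<mu>) < e \<Longrightarrow> y \<in> U"
      using U unfolding open_dist by blast
    show ?case
      by (rule exI[of _ "{f}"], rule exI[of _ e]) (use e f s in \<open>auto simp: dist_real_def\<close>)
  qed
qed

text \<open>Continuity of \<open>\<Phi>\<close> is used only at \<open>Q\<close>, where it involves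
  finitely many test functions. For each of them \<open>integral_mark\<close> turns the deviation
  into one of a time average, which is small in mean by self-averaging.\<close>

lemma mark_law_limit:
  fixes p :: "real \<Rightarrow> real ^ 'n \<Rightarrow> real ^ 'n \<Rightarrow> real" and Q :: "(real \<Rightarrow> real ^ 'n) measure"
    and \<Phi> :: "(real \<Rightarrow> real ^ 'n) measure \<Rightarrow> real"
  assumes K1: "neumann_heat_kernel 1 p" and Q: "two_sided_stationary_law p Q"
    and \<Phi>: "continuous_map (weak_topology mark_path_topology) euclideanreal \<Phi>"
    and b\<Phi>: "bounded (\<Phi> ` topspace (weak_topology mark_path_topology))"
    and \<epsilon>: "0 < \<epsilon>"
  shows "\<forall>\<^sub>F S in at_top. \<forall>L T q B. 0 < L \<longrightarrow> neumann_heat_kernel L q \<longrightarrow> bridge_kernel L q T B \<longrightarrow> T / L\<^sup>2 = S \<longrightarrow>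
    \<bar>(\<integral>m. \<Phi> m \<partial>mark_law L q T B) - \<Phi> Q\<bar> \<le> \<epsilon>"
proof -
  let ?P = "space (prob_algebra (borel_of (mark_path_topology :: (real \<Rightarrow> real ^ 'n) topology)))"
  have QP: "Q \<in> ?P" using Q by (simp add: two_sided_stationary_law_def)
  obtain M where M: "\<And>m. m \<in> ?P \<Longrightarrow> \<bar>\<Phi> m\<bar> \<le> M"
    using b\<Phi> by (auto simp: bounded_iff topspace_weak_topology)
  have M0: "0 \<le> M" using M[OF QP] by linarith
  define W where "W = {m \<in> topspace (weak_topology mark_path_topology). \<Phi> m \<in> {\<Phi> Q - \<epsilon> / 2<..<\<Phi> Q + \<epsilon> / 2}}"
  have "openin (weak_topology mark_path_topology) W"
    unfolding W_def by (rule openin_continuous_map_preimage[OF \<Phi>]) simp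
  moreover have "Q \<in> W" using QP \<epsilon> by (simp add: W_def topspace_weak_topology)
  ultimately obtain F e where F: "finite F" and e: "0 < (e :: real)"
    and Fc: "\<And>f. f \<in> F \<Longrightarrow> continuous_map mark_path_topology euclideanreal f \<and> bounded (f ` mark_paths)"
    and FW: "\<And>\<nu>. \<nu> \<in> ?P \<Longrightarrow> (\<And>f. f \<in> F \<Longrightarrow> \<bar>(\<integral>x. f x \<partial>\<nu>) - (\<integral>x. f x \<partial>Q)\<bar> < e) \<Longrightarrow> \<nu> \<in> W"
    using openin_weak_topologyD[of mark_path_topology W Q] unfolding topspace_mark_path by meson
  \<comment> \<open>Chosen so that \<open>(card F + 1) * (2 * (M + 1) / e) * \<epsilon>'\<close> is
    \<open>\<epsilon> / 2\<close>; the added ones avoid division by 0 when \<open>F\<close> is empty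
    or \<open>M = 0\<close>.\<close>
  define \<epsilon>' where "\<epsilon>' = \<epsilon> * e / (4 * (M + 1) * (real (card F) + 1))"
  have \<epsilon>': "0 < \<epsilon>'" using \<epsilon> e M0 by (simp add: \<epsilon>'_def)
  \<comment> \<open>Markov's inequality and the union bound in pointwise form: if some test integral
    is off by at least \<open>e\<close>, the trivial bound \<open>2 * M\<close> is at most
    \<open>2 * M / e\<close> times that deviation.\<close>
  have pw: "\<bar>\<Phi> \<nu> - \<Phi> Q\<bar> \<le> \<epsilon> / 2 + (\<Sum>f\<in>F. 2 * M / e * \<bar>(\<integral>x. f x \<partial>\<nu>) - (\<integral>x. f x \<partial>Q)\<bar>)" if \<nu>: "\<nu> \<in> ?P" for \<nu>
  proof (cases "\<forall>f\<in>F. \<bar>(\<integral>x. f x \<partial>\<nu>) - (\<integral>x. f x \<partial>Q)\<bar> < e")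
    case True
    then have "\<nu> \<in> W" using FW[OF \<nu>] by blast
    then have "\<Phi> Q - \<epsilon> / 2 < \<Phi> \<nu>" "\<Phi> \<nu> < \<Phi> Q + \<epsilon> / 2" by (auto simp: W_def)
    then have "\<bar>\<Phi> \<nu> - \<Phi> Q\<bar> \<le> \<epsilon> / 2" by linarith
    moreover have "0 \<le> (\<Sum>f\<in>F. 2 * M / e * \<bar>(\<integral>x. f x \<partial>\<nu>) - (\<integral>x. f x \<partial>Q)\<bar>)"
      using M0 e by (intro sum_nonneg) auto
    ultimately show ?thesis by linarith
  next
    case False
    then obtain f where f: "f \<in> F" "e \<le> \<bar>(\<integral>x. f x \<partial>\<nu>) - (\<integral>x. f x \<partial>Q)\<bar>" by (auto simp: not_less)
    have "\<bar>\<Phi> \<nu> - \<Phi> Q\<bar> \<le> 2 * M" using M[OF \<nu>] M[OF QP] by linarith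
    also have "\<dots> = 2 * M / e * e" using e by simp
    also have "\<dots> \<le> 2 * M / e * \<bar>(\<integral>x. f x \<partial>\<nu>) - (\<integral>x. f x \<partial>Q)\<bar>"
      using f(2) M0 e by (intro mult_left_mono) auto
    also have "\<dots> \<le> (\<Sum>f\<in>F. 2 * M / e * \<bar>(\<integral>x. f x \<partial>\<nu>) - (\<integral>x. f x \<partial>Q)\<bar>)"
      using f(1) F M0 e by (intro member_le_sum[of f F "\<lambda>f. 2 * M / e * \<bar>(\<integral>x. f x \<partial>\<nu>) - (\<integral>x. f x \<partial>Q)\<bar>"]) auto
    finally show ?thesis using \<epsilon> by linarith
  qed
  obtain D where D: "0 < D" "\<And>s x y :: real ^ 'n. D \<le> s \<Longrightarrow> \<bar>neumann_kernel s x y - 1\<bar> \<le> 1 / 2"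
    using neumann_kernel_ergodic[of "1 / 2"] by auto
  have "self_averaging f (\<integral>\<gamma>. f \<gamma> \<partial>Q)" if fF: "f \<in> F" for f
  proof -
    obtain M where "\<And>\<gamma>. \<gamma> \<in> mark_paths \<Longrightarrow> \<bar>f \<gamma>\<bar> \<le> M"
      using Fc[OF fF] by (auto simp: bounded_iff)
    then show ?thesis using Fc[OF fF] by (intro self_averaging_bounded_continuous[OF K1 Q]) auto
  qed
  then have "\<forall>\<^sub>F S in at_top. \<forall>f\<in>F. \<forall>L T q B. 0 < L \<longrightarrow> neumann_heat_kernel L q \<longrightarrow> bridge_kernel L q T B \<longrightarrow> T / L\<^sup>2 = S \<longrightarrow>
     (\<integral>\<omega>. \<bar>time_average 0 S f (rescaled_loop L T \<omega>) - (\<integral>\<gamma>. f \<gamma> \<partial>Q)\<bar> \<partial>loop_law L q T B) \<le> \<epsilon>'"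
    using \<epsilon>' unfolding self_averaging_def by (intro eventually_ball_finite F) blast
  then show ?thesis
    using eventually_gt_at_top[of "2 * D"]
  proof eventually_elim
    case (elim S)
    show ?case
    proof (intro allI impI)
      fix L T :: real and q :: "real \<Rightarrow> real ^ 'n \<Rightarrow> real ^ 'n \<Rightarrow> real" and B :: "real ^ 'n \<Rightarrow> (real \<Rightarrow> real ^ 'n) measure"
      assume L: "0 < L" and K: "neumann_heat_kernel L q" and B: "bridge_kernel L q T B" and S: "T / L\<^sup>2 = S"
      have TD: "2 * D < T / L\<^sup>2" using elim S by simp
      have Sp: "0 < S" using elim D by simp
      note loop = K1 Q L K B D TD
      have T: "0 < T" by (rule T_pos[OF loop])
      let ?P = "loop_law L q T B"
      interpret P: prob_space ?P by (rule loop_law_space(1)[OF loop])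
      have Y: "rescaled_loop L T \<omega> \<in> mark_paths" if "\<omega> \<in> space ?P" for \<omega>
        using that rescaled_loop_mark_paths[OF L T] loop_law_space(3)[OF loop] by blast
      have mm: "mark L T \<in> ?P \<rightarrow>\<^sub>M borel_of (weak_topology mark_path_topology)"
        using continuous_map_measurable_borel_of[OF continuous_map_mark[OF L T, where 'n='n]] loop_law_space(2)[OF loop]
        by (simp cong: measurable_cong_sets)
      have m\<Phi>: "\<Phi> \<in> borel_measurable (borel_of (weak_topology mark_path_topology))"
        by (rule borel_measurable_continuous_map[OF \<Phi>])
      have mprob: "mark L T \<omega> \<in> space (prob_algebra (borel_of mark_path_topology))" if "\<omega> \<in> space ?P" for \<omega>
        using mark_prob[OF Y[OF that]] Sp S by simp
      have int\<Phi>: "integrable ?P (\<lambda>\<omega>. \<Phi> (mark L T \<omega>))"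
        using M[OF mprob] measurable_compose[OF mm m\<Phi>] by (intro P.integrable_const_bound[where B=M] AE_I2) auto
      let ?A = "\<lambda>f \<omega>. \<bar>time_average 0 S f (rescaled_loop L T \<omega>) - (\<integral>\<gamma>. f \<gamma> \<partial>Q)\<bar>"
      have intA: "integrable ?P (?A f)" if fF: "f \<in> F" for f
      proof -
        have f: "continuous_map mark_path_topology euclideanreal f" using Fc[OF fF] by simp
        obtain M where Mf: "\<And>\<gamma>. \<gamma> \<in> mark_paths \<Longrightarrow> \<bar>f \<gamma>\<bar> \<le> M"
          using Fc[OF fF] by (auto simp: bounded_iff)
        have cont: "continuous_map mark_path_topology euclideanreal (time_average 0 S f)"
          by (rule continuous_map_time_average[OF Sp f Mf])
        have "(\<lambda>\<omega>. time_average 0 S f (rescaled_loop L T \<omega>)) \<in> borel_measurable ?P"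
          using loop_functional_measurable[OF loop cont] loop_law_space(2)[OF loop]
          by (simp cong: measurable_cong_sets)
        moreover have "\<bar>?A f \<omega>\<bar> \<le> M + \<bar>\<integral>\<gamma>. f \<gamma> \<partial>Q\<bar>" if "\<omega> \<in> space ?P" for \<omega>
          using time_average_abs_le[OF Sp f Mf Y[OF that]] by linarith
        ultimately show ?thesis
          by (intro P.integrable_const_bound[where B="M + \<bar>\<integral>\<gamma>. f \<gamma> \<partial>Q\<bar>"] AE_I2) auto
      qed
      have "(\<integral>m. \<Phi> m \<partial>mark_law L q T B) = (\<integral>\<omega>. \<Phi> (mark L T \<omega>) \<partial>?P)"
        unfolding mark_law_def by (rule integral_distr[OF mm m\<Phi>])
      then have "(\<integral>m. \<Phi> m \<partial>mark_law L q T B) - \<Phi> Q = (\<integral>\<omega>. \<Phi> (mark L T \<omega>) - \<Phi> Q \<partial>?P)"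
        using int\<Phi> by (simp add: P.prob_space)
      then have "\<bar>(\<integral>m. \<Phi> m \<partial>mark_law L q T B) - \<Phi> Q\<bar> \<le> (\<integral>\<omega>. \<bar>\<Phi> (mark L T \<omega>) - \<Phi> Q\<bar> \<partial>?P)"
        using integral_abs_bound[of ?P "\<lambda>\<omega>. \<Phi> (mark L T \<omega>) - \<Phi> Q"] by simp
      also have "\<dots> \<le> (\<integral>\<omega>. \<epsilon> / 2 + (\<Sum>f\<in>F. 2 * M / e * ?A f \<omega>) \<partial>?P)"
      proof (rule integral_mono)
        show "integrable ?P (\<lambda>\<omega>. \<bar>\<Phi> (mark L T \<omega>) - \<Phi> Q\<bar>)" using int\<Phi> by simp
        show "integrable ?P (\<lambda>\<omega>. \<epsilon> / 2 + (\<Sum>f\<in>F. 2 * M / e * ?A f \<omega>))"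
          using intA by (intro Bochner_Integration.integrable_add Bochner_Integration.integrable_sum integrable_mult_right) auto
        fix \<omega> assume \<omega>: "\<omega> \<in> space ?P"
        have "(\<Sum>f\<in>F. 2 * M / e * \<bar>(\<integral>x. f x \<partial>mark L T \<omega>) - (\<integral>x. f x \<partial>Q)\<bar>) = (\<Sum>f\<in>F. 2 * M / e * ?A f \<omega>)"
          using Fc by (intro sum.cong refl) (simp add: integral_mark[OF Y[OF \<omega>]] S)
        then show "\<bar>\<Phi> (mark L T \<omega>) - \<Phi> Q\<bar> \<le> \<epsilon> / 2 + (\<Sum>f\<in>F. 2 * M / e * ?A f \<omega>)"
          using pw[OF mprob[OF \<omega>]] by simp
      qed
      also have "\<dots> = \<epsilon> / 2 + (\<Sum>f\<in>F. 2 * M / e * (\<integral>\<omega>. ?A f \<omega> \<partial>?P))"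
      proof -
        have "(\<integral>\<omega>. \<epsilon> / 2 + (\<Sum>f\<in>F. 2 * M / e * ?A f \<omega>) \<partial>?P) = \<epsilon> / 2 + (\<integral>\<omega>. (\<Sum>f\<in>F. 2 * M / e * ?A f \<omega>) \<partial>?P)"
          using intA by (subst Bochner_Integration.integral_add)
            (auto simp: P.prob_space intro!: Bochner_Integration.integrable_sum integrable_mult_right)
        also have "(\<integral>\<omega>. (\<Sum>f\<in>F. 2 * M / e * ?A f \<omega>) \<partial>?P) = (\<Sum>f\<in>F. (\<integral>\<omega>. 2 * M / e * ?A f \<omega> \<partial>?P))"
          using intA by (intro Bochner_Integration.integral_sum integrable_mult_right) auto
        also have "\<dots> = (\<Sum>f\<in>F. 2 * M / e * (\<integral>\<omega>. ?A f \<omega> \<partial>?P))"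
          by (simp only: integral_mult_right_zero)
        finally show ?thesis .
      qed
      also have "(\<Sum>f\<in>F. 2 * M / e * (\<integral>\<omega>. ?A f \<omega> \<partial>?P)) \<le> (\<Sum>f\<in>F. 2 * M / e * \<epsilon>')"
        using elim(1) L K B S M0 e by (intro sum_mono mult_left_mono) auto
      also have "\<dots> = real (card F) * (2 * M / e * \<epsilon>')" by simp
      also have "\<dots> \<le> (real (card F) + 1) * (2 * (M + 1) / e * \<epsilon>')"
        using M0 e \<epsilon>' by (intro mult_mono mult_right_mono divide_right_mono) auto
      also have "\<dots> = \<epsilon> / 2"
      proof -
        define a where "a = real (card F) + 1"
        define b where "b = M + 1"
        have "0 < a" "0 < b" using M0 by (auto simp: a_def b_def)
        then show ?thesis
          using e unfolding \<epsilon>'_def a_def[symmetric] b_def[symmetric] by simp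
      qed
      finally show "\<bar>(\<integral>m. \<Phi> m \<partial>mark_law L q T B) - \<Phi> Q\<bar> \<le> \<epsilon>" by simp
    qed
  qed
qed

section \<open>Uniformity over the range of \<open>j\<close>\<close>

theorem proposition4p4:
  fixes \<beta> \<delta> R :: real
    and q :: "real \<Rightarrow> real \<Rightarrow> real ^ 'n \<Rightarrow> real ^ 'n \<Rightarrow> real"
    and p :: "real \<Rightarrow> real ^ 'n \<Rightarrow> real ^ 'n \<Rightarrow> real"
    and B :: "real \<Rightarrow> nat \<Rightarrow> real ^ 'n \<Rightarrow> (real \<Rightarrow> real ^ 'n) measure"
    and Qref :: "(real \<Rightarrow> real ^ 'n) measure"
    and \<Phi> :: "(real \<Rightarrow> real ^ 'n) measure \<Rightarrow> real"
  assumes "CARD('n) > 2" and "\<beta> > 0"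
    and "\<And>L. L > 0 \<Longrightarrow> neumann_heat_kernel L (q L)"
    and "\<And>L j. L > 0 \<Longrightarrow> j \<ge> 1 \<Longrightarrow> bridge_kernel L (q L) (\<beta> * real j) (B L j)"
    and "neumann_heat_kernel 1 p"
    and "two_sided_stationary_law p Qref"
    and "0 < \<delta>" and "\<delta> < R"
    and "continuous_map (weak_topology mark_path_topology) euclideanreal \<Phi>"
    and "bounded (\<Phi> ` topspace (weak_topology mark_path_topology))"
  shows "((\<lambda>L. SUP j \<in> {j :: nat. \<delta> \<le> real j / L ^ CARD('n) \<and> real j / L ^ CARD('n) \<le> R}.
            \<bar>(\<integral>m. \<Phi> m \<partial>mark_law L (q L) (\<beta> * real j) (B L j)) - \<Phi> Qref\<bar>)
          \<longlongrightarrow> 0) at_top"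
proof (rule tendstoI)
  fix \<epsilon> :: real assume \<epsilon>: "0 < \<epsilon>"
  have "0 < \<epsilon> / 2" using \<epsilon> by simp
  from mark_law_limit[OF assms(5,6,9,10) this] obtain S0 where
    S0: "\<And>S L T (q :: real \<Rightarrow> real ^ 'n \<Rightarrow> real ^ 'n \<Rightarrow> real) B. S0 \<le> S \<Longrightarrow> 0 < L \<Longrightarrow> neumann_heat_kernel L q \<Longrightarrow>
      bridge_kernel L q T B \<Longrightarrow> T / L\<^sup>2 = S \<Longrightarrow> \<bar>(\<integral>m. \<Phi> m \<partial>mark_law L q T B) - \<Phi> Qref\<bar> \<le> \<epsilon> / 2"
    unfolding eventually_at_top_linorder by blast
  \<comment> \<open>The three bounds serve, in turn, to compare powers of \<open>L\<close>, to push
    the rescaled duration beyond \<open>S0\<close>, and to make the set of admissible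
    \<open>j\<close> nonempty.\<close>
  define L0 where "L0 = Max {1, S0 / (\<beta> * \<delta>), 1 / (R - \<delta>)}"
  let ?J = "\<lambda>L. {j :: nat. \<delta> \<le> real j / L ^ CARD('n) \<and> real j / L ^ CARD('n) \<le> R}"
  let ?E = "\<lambda>L j. \<bar>(\<integral>m. \<Phi> m \<partial>mark_law L (q L) (\<beta> * real j) (B L j)) - \<Phi> Qref\<bar>"
  show "\<forall>\<^sub>F L in at_top. dist (SUP j \<in> ?J L. ?E L j) 0 < \<epsilon>"
  proof (rule eventually_mono[OF eventually_ge_at_top[of L0]])
    fix L assume "L0 \<le> L"
    then have L: "1 \<le> L" "S0 / (\<beta> * \<delta>) \<le> L" "1 / (R - \<delta>) \<le> L" by (auto simp: L0_def)
    let ?V = "L ^ CARD('n)"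
    \<comment> \<open>The dimension enters here: of the three powers of \<open>L\<close>, rescaling
      time consumes two, and the remaining one drives the duration to infinity.\<close>
    have LV: "L ^ 3 \<le> ?V" using assms(1) L(1) by (intro power_increasing) auto
    have "L \<le> L ^ 3" using L(1) by (intro self_le_power) auto
    then have V: "L \<le> ?V" "0 < ?V" using LV L(1) by auto
    have bound: "?E L j \<le> \<epsilon> / 2" if "j \<in> ?J L" for j
    proof -
      have j: "\<delta> * ?V \<le> real j" using that V(2) by (simp add: pos_le_divide_eq)
      have "0 < \<delta> * ?V" using assms(7) V by simp
      \<comment> \<open>The bridge assumption speaks only about \<open>j \<ge> 1\<close>; the
        positive lower bound on \<open>j\<close> excludes 0.\<close>
      then have j1: "1 \<le> j" using j by (cases j) auto
      have "S0 \<le> \<beta> * \<delta> * L" using L(2) assms(2,7) by (simp add: pos_divide_le_eq mult.commute)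
      also have "\<beta> * \<delta> * L = \<beta> * (\<delta> * L ^ 3) / L\<^sup>2" using L(1) by (simp add: power3_eq_cube power2_eq_square)
      also have "\<dots> \<le> \<beta> * real j / L\<^sup>2"
      proof (intro divide_right_mono mult_left_mono)
        have "\<delta> * L ^ 3 \<le> \<delta> * ?V" using LV assms(7) by (intro mult_left_mono) auto
        then show "\<delta> * L ^ 3 \<le> real j" using j by linarith
      qed (use assms(2) in auto)
      finally show ?thesis
        using L(1) j1 assms(3,4) by (intro S0[OF _ _ _ _ refl]) auto
    qed
    \<comment> \<open>A supremum over the empty set of reals carries no information, so an
      admissible index is exhibited. Rounding \<open>\<delta> * ?V\<close> up works because the
      admissible interval has length at least 1.\<close>
    define j where "j = nat \<lceil>\<delta> * ?V\<rceil>"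
    have jj: "real j = of_int \<lceil>\<delta> * ?V\<rceil>" using assms(7) V by (simp add: j_def)
    have "1 \<le> (R - \<delta>) * L" using L(3) assms(8) by (simp add: pos_divide_le_eq mult.commute)
    also have "\<dots> \<le> (R - \<delta>) * ?V" using V assms(8) by (intro mult_left_mono) auto
    finally have "\<delta> * ?V + 1 \<le> R * ?V" by (simp add: algebra_simps)
    then have "real j \<le> R * ?V" "\<delta> * ?V \<le> real j" unfolding jj by linarith+
    then have jJ: "j \<in> ?J L" using V(2) by (simp add: pos_le_divide_eq pos_divide_le_eq)
    have le: "(SUP j \<in> ?J L. ?E L j) \<le> \<epsilon> / 2"
      using jJ bound by (intro cSUP_least) auto
    have "bdd_above (?E L ` ?J L)"
      by (rule bdd_aboveI2[OF bound])
    then have "0 \<le> (SUP j \<in> ?J L. ?E L j)"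
      using jJ by (intro cSUP_upper2[of _ _ j]) auto
    with le \<epsilon> show "dist (SUP j \<in> ?J L. ?E L j) 0 < \<epsilon>" by (simp add: dist_real_def)
  qed
qed

end
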